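(* Let $n\ge 2$ be even, let $q$ be a positive integer, and let $G$, $D$, $S$ be as defined in the context. Let $\mathcal{I}_q\subset\mathbb{C}$ be the set of $a+ib$ with integers $a,b\in[-\lceil\sqrt q/2\rceil,\lceil\sqrt q/2\rceil]$. Define the following $\varepsilon$-parametrized subsets of $G$: $$X=\{D^{-1}\exp(\varepsilon A)D\mid A\in S\},\qquad Z=\{D\exp(\varepsilon A)D^{-1}\mid A\in S\},$$ $$Y_q=\{\exp(\varepsilon A)\mid A\in S,\ \text{entries of }A\text{ lie in }\mathcal{I}_q\}.$$ Then, with $d_X=d_Z=n^2/4-n/2$, there exist (1) continuous functions $f_X\colon\mathbb{C}^{d_X}\to D^{-1}SD$ and $f_Z\colon\mathbb{C}^{d_Z}\to DSD^{-1}$, and polynomials $p_X\colon\mathrm{Lie}(G)\to\mathbb{C}^{d_X}$ and $p_Z\colon\mathrm{Lie}(G)\to\mathbb{C}^{d_Z}$ such that $p_X(f_X(v)-f_Z(v'))=v$ and $p_Z(f_X(v)-f_Z(v'))=v'$ for all $v\in\mathbb{C}^{d_X}$, $v'\in\mathbb{C}^{d_Z}$; and (2) a 1-parameter family of polynomials $p_0(g,\varepsilon)\in\mathrm{Inv}_{X,Z}$, of degree $O(q)$, such that $p_0(g,\varepsilon)=1+O(\varepsilon)$ if $g=I$ and $p_0(g,\varepsilon)=O(\varepsilon)$ if $g\in Y_q(\varepsilon)^{-1}Y_q(\varepsilon)\setminus\{I\}$. Hence there exist three $\varepsilon$-parametrized subsets $X_q,Y_q,Z_q\subseteq G$ (finite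 sets of 1-parameter families), all of size at least $q^{n^2/4-n/2}$, which satisfy the triple product property and admit border-separating polynomials of degree $O(q)$. Here the implicit constants in the degree bounds $O(q)$ may depend on $n$.
   Context: For a matrix $M$, $M^*$ is the conjugate transpose. Define $$G=\mathrm{SU}_{n/2,n/2}=\{M\in\mathrm{GL}_n(\mathbb{C})\mid M^*QM=Q,\ \det M=1\},\quad Q=\begin{pmatrix} I & 0 \\ 0 & -I \end{pmatrix},$$ with $(n/2)\times(n/2)$ blocks. Let $J$ be the $(n/2)\times(n/2)$ matrix with ones on the antidiagonal and zeros elsewhere, $U=\frac{1}{\sqrt{2}}\begin{pmatrix} I & J \\ J & -I \end{pmatrix}$, $D_0=\mathrm{diag}(n,n-1,\dots,n/2+1,(n/2+1)^{-1},(n/2+2)^{-1},\dots,n^{-1})$, and $D=UD_0U^*$ (which lies in $G$). Let $$S=\left\{\begin{pmatrix} A_0 & 0 \\ 0 & A_1 \end{pmatrix}\;\middle|\;A_0,A_1\text{ are }(n/2)\times(n/2)\text{ skew-Hermitian with zeros on the diagonal}\right\}.$$ $\mathrm{Lie}(G)\subseteq M_n(\mathbb{C})$ is the tangent space of $G$ at the identity. A polynomial on $G$ (or on $\mathrm{Lie}(G)$) is a function expressible as a polynomial with complex coefficients in the $n^2$ matrix entries (coordinatewise for vector-valued maps). A 1-parameter family of polynomials is a polynomial in the matrix entries whose coefficients are analytic functions of $\varepsilon\in(0,\alpha)$ for some $\alpha>0$; degree is measured in the matrix entries only. $\mathrm{Inv}_{X,Z}$ is the set of polynomials $p\in\mathbb{C}[M_{ij}]$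 with $p(xMz)=p(M)$ for all $x\in X$, $z\in Z$; a 1-parameter family lies in $\mathrm{Inv}_{X,Z}$ if it does so for each $\varepsilon$. ($X$ and $Z$, since $S$ is a vector space, are the sets $\{D^{-1}\exp(A)D: A\in S\}$ and $\{D\exp(A)D^{-1}: A\in S\}$, with tangent spaces at the identity $D^{-1}SD$ and $DSD^{-1}$.) A 1-parameter family of elements of $G$ is an analytic function $x\colon(0,\alpha)\to G$ for some $\alpha>0$; for a finite set $X$ of them, $X(\varepsilon)=\{x(\varepsilon):x\in X\}$ and $|X|$ counts families. Subsets $X,Y,Z$ of a group satisfy the triple product property (TPP) if for all $x,x'\in X$, $y,y'\in Y$, $z,z'\in Z$: $x^{-1}x'y^{-1}y'z^{-1}z'=1$ iff $x=x'$, $y=y'$, $z=z'$. Sets of 1-parameter families satisfy the TPP if $X(\varepsilon),Y(\varepsilon),Z(\varepsilon)$ do for all $\varepsilon$ in the common domain $(0,\alpha)$. A set of border-separating polynomials for $(X,Y,Z)$ is a collection $\{f_{x,z}\}_{x\in X,z\in Z}$ of 1-parameter families of polynomials on $G$ with $f_{x,z}(g,\varepsilon)=1+O(\varepsilon)$ if $g=x(\varepsilon)z(\varepsilon)^{-1}$ and $f_{x,z}(g,\varepsilon)=O(\varepsilon)$ if $g\in X(\varepsilon)Y(\varepsilon)^{-1}Y(\varepsilon)Z(\varepsilon)^{-1}\setminus\{x(\varepsilon)z(\varepsilon)^{-1}\}$, as $\varepsilon\to0$. *)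

theory Defs
  imports
    "HOL-Analysis.Analysis"
    "HOL-Algebra.Coset"
    "HOL-Library.Poly_Mapping"
    "Jordan_Normal_Form.Schur_Decomposition"
begin

section \<open>The group and its distinguished elements and subsets\<close>

text \<open>Rows and columns are numbered from 0, and \<open>n\<close> is meant to be even and positive throughout.\<close>

definition Q_mat :: "nat \<Rightarrow> complex mat" where
  "Q_mat n = (let m = n div 2 in
     four_block_mat (1\<^sub>m m) (0\<^sub>m m m) (0\<^sub>m m m) (- 1\<^sub>m m))"

definition SU_carrier :: "nat \<Rightarrow> complex mat set" where
  "SU_carrier n = {M \<in> carrier_mat n n. invertible_mat M \<and>
     mat_adjoint M * Q_mat n * M = Q_mat n \<and> Determinant.det M = 1}"

definition SU :: "nat \<Rightarrow> complex mat monoid" where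
  "SU n = \<lparr>carrier = SU_carrier n, mult = (*), one = 1\<^sub>m n\<rparr>"

definition J_mat :: "nat \<Rightarrow> complex mat" where
  "J_mat m = Matrix.mat m m (\<lambda>(i, j). if i + j + 1 = m then 1 else 0)"

definition U_mat :: "nat \<Rightarrow> complex mat" where
  "U_mat n = (let m = n div 2 in
     complex_of_real (1 / sqrt 2) \<cdot>\<^sub>m
       four_block_mat (1\<^sub>m m) (J_mat m) (J_mat m) (- 1\<^sub>m m))"

definition D0_mat :: "nat \<Rightarrow> complex mat" where
  "D0_mat n = mat_diag n (\<lambda>i. if i < n div 2 then of_nat (n - i) else 1 / of_nat (i + 1))"

definition D_mat :: "nat \<Rightarrow> complex mat" where
  "D_mat n = U_mat n * D0_mat n * mat_adjoint (U_mat n)"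

definition D_inv :: "nat \<Rightarrow> complex mat" where
  "D_inv n = inv\<^bsub>SU n\<^esub> (D_mat n)"

definition skew_zero_diag :: "nat \<Rightarrow> complex mat set" where
  "skew_zero_diag m = {A \<in> carrier_mat m m. mat_adjoint A = - A \<and> (\<forall>i<m. A $$ (i, i) = 0)}"

definition S_set :: "nat \<Rightarrow> complex mat set" where
  "S_set n = (let m = n div 2 in
     {four_block_mat A0 (0\<^sub>m m m) (0\<^sub>m m m) A1 | A0 A1.
        A0 \<in> skew_zero_diag m \<and> A1 \<in> skew_zero_diag m})"

definition mat_exp :: "complex mat \<Rightarrow> complex mat" where
  "mat_exp A = Matrix.mat (dim_row A) (dim_row A)
     (\<lambda>(i, j). suminf (\<lambda>k. (A ^\<^sub>m k) $$ (i, j) / fact k))"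

definition exp_fam :: "real \<Rightarrow> complex mat \<Rightarrow> complex mat" where
  "exp_fam \<epsilon> A = mat_exp (complex_of_real \<epsilon> \<cdot>\<^sub>m A)"

definition X_set :: "nat \<Rightarrow> real \<Rightarrow> complex mat set" where
  "X_set n \<epsilon> = {D_inv n * exp_fam \<epsilon> A * D_mat n | A. A \<in> S_set n}"

definition Z_set :: "nat \<Rightarrow> real \<Rightarrow> complex mat set" where
  "Z_set n \<epsilon> = {D_mat n * exp_fam \<epsilon> A * D_inv n | A. A \<in> S_set n}"

definition I_set :: "nat \<Rightarrow> complex set" where
  "I_set q = {Complex (of_int a) (of_int b) | a b.
     \<bar>a\<bar> \<le> \<lceil>sqrt (real q) / 2\<rceil> \<and> \<bar>b\<bar> \<le> \<lceil>sqrt (real q) / 2\<rceil>}"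

definition D_inv_S_D :: "nat \<Rightarrow> complex mat set" where
  "D_inv_S_D n = {D_inv n * A * D_mat n | A. A \<in> S_set n}"

definition D_S_D_inv :: "nat \<Rightarrow> complex mat set" where
  "D_S_D_inv n = {D_mat n * A * D_inv n | A. A \<in> S_set n}"

definition d_XZ :: "nat \<Rightarrow> nat" where
  "d_XZ n = n\<^sup>2 div 4 - n div 2"

text \<open>The tangent space at the identity, as the set of velocities of curves in the group.\<close>

definition Lie_SU :: "nat \<Rightarrow> complex mat set" where
  "Lie_SU n = {M \<in> carrier_mat n n. \<exists>\<gamma> :: real \<Rightarrow> complex mat.
     (\<forall>t. \<gamma> t \<in> carrier (SU n)) \<and> \<gamma> 0 = 1\<^sub>m n \<and>
     (\<forall>i<n. \<forall>j<n. ((\<lambda>t. \<gamma> t $$ (i, j)) has_vector_derivative M $$ (i, j)) (at 0))}"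

section \<open>Continuous maps and polynomials\<close>

text \<open>
  The type of matrices carries no topology and \<open>d_XZ n\<close> may be 0, so \<open>d\<close>-dimensional complex
  space is rendered as the product topology on functions on \<open>{..<d}\<close>, and continuity of a
  matrix-valued map is continuity of all entries.
\<close>

definition Cspace :: "nat \<Rightarrow> (nat \<Rightarrow> complex) topology" where
  "Cspace d = product_topology (\<lambda>_. euclidean) {..<d}"

definition continuous_mat_map :: "nat \<Rightarrow> nat \<Rightarrow> complex mat set \<Rightarrow>
    ((nat \<Rightarrow> complex) \<Rightarrow> complex mat) \<Rightarrow> bool" where
  "continuous_mat_map n d T f \<longleftrightarrow> f \<in> topspace (Cspace d) \<rightarrow> T \<and>
     (\<forall>i<n. \<forall>j<n. continuous_map (Cspace d) euclidean (\<lambda>v. f v $$ (i, j)))"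

text \<open>Polynomials in variables indexed by matrix positions.\<close>

type_synonym mat_poly = "(nat \<times> nat \<Rightarrow>\<^sub>0 nat) \<Rightarrow>\<^sub>0 complex"

definition mat_polys :: "nat \<Rightarrow> mat_poly set" where
  "mat_polys n = {p. \<forall>\<mu>\<in>Poly_Mapping.keys p. Poly_Mapping.keys \<mu> \<subseteq> {..<n} \<times> {..<n}}"

definition eval_mat_poly :: "mat_poly \<Rightarrow> complex mat \<Rightarrow> complex" where
  "eval_mat_poly p M = (\<Sum>\<mu>\<in>Poly_Mapping.keys p. Poly_Mapping.lookup p \<mu> *
     (\<Prod>e\<in>Poly_Mapping.keys \<mu>. (M $$ e) ^ Poly_Mapping.lookup \<mu> e))"

definition poly_degree_le :: "mat_poly \<Rightarrow> nat \<Rightarrow> bool" where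
  "poly_degree_le p k \<longleftrightarrow> (\<forall>\<mu>\<in>Poly_Mapping.keys p.
     (\<Sum>e\<in>Poly_Mapping.keys \<mu>. Poly_Mapping.lookup \<mu> e) \<le> k)"

definition polynomial_map_on :: "nat \<Rightarrow> complex mat set \<Rightarrow> nat \<Rightarrow>
    (complex mat \<Rightarrow> nat \<Rightarrow> complex) \<Rightarrow> bool" where
  "polynomial_map_on n L d p \<longleftrightarrow> p \<in> L \<rightarrow> topspace (Cspace d) \<and>
     (\<forall>k<d. \<exists>P\<in>mat_polys n. \<forall>M\<in>L. p M k = eval_mat_poly P M)"

definition Inv_polys :: "nat \<Rightarrow> complex mat set \<Rightarrow> complex mat set \<Rightarrow> mat_poly set" where
  "Inv_polys n X Z = {p \<in> mat_polys n. \<forall>x\<in>X. \<forall>z\<in>Z. \<forall>M\<in>carrier_mat n n.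
     eval_mat_poly p (x * M * z) = eval_mat_poly p M}"

section \<open>One-parameter families\<close>

definition real_analytic_on :: "real set \<Rightarrow> (real \<Rightarrow> complex) \<Rightarrow> bool" where
  "real_analytic_on I f \<longleftrightarrow> (\<forall>t\<in>I. \<exists>r>0. \<exists>a :: nat \<Rightarrow> complex.
     \<forall>s\<in>I. \<bar>s - t\<bar> < r \<longrightarrow> (\<lambda>k. a k * complex_of_real ((s - t) ^ k)) sums f s)"

text \<open>The bound \<open>k\<close> on the degree is uniform in the parameter, so only finitely many monomials occur.\<close>

definition poly_family :: "nat \<Rightarrow> nat \<Rightarrow> real \<Rightarrow> (real \<Rightarrow> mat_poly) \<Rightarrow> bool" where
  "poly_family n k \<alpha> p \<longleftrightarrow>
     (\<forall>\<epsilon>\<in>{0<..<\<alpha>}. p \<epsilon> \<in> mat_polys n \<and> poly_degree_le (p \<epsilon>) k) \<and>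
     (\<forall>\<mu>. real_analytic_on {0<..<\<alpha>} (\<lambda>\<epsilon>. Poly_Mapping.lookup (p \<epsilon>) \<mu>))"

text \<open>
  Families are extensional functions on their domain, so that equality of families, and hence
  the cardinality of a set of them, refers to their values on \<open>{0<..<\<alpha>}\<close> only.
\<close>

definition group_family :: "nat \<Rightarrow> real \<Rightarrow> (real \<Rightarrow> complex mat) \<Rightarrow> bool" where
  "group_family n \<alpha> x \<longleftrightarrow> x \<in> {0<..<\<alpha>} \<rightarrow>\<^sub>E carrier (SU n) \<and>
     (\<forall>i<n. \<forall>j<n. real_analytic_on {0<..<\<alpha>} (\<lambda>\<epsilon>. x \<epsilon> $$ (i, j)))"

definition at_eps :: "(real \<Rightarrow> complex mat) set \<Rightarrow> real \<Rightarrow> complex mat set" where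
  "at_eps X \<epsilon> = {x \<epsilon> | x. x \<in> X}"

definition Y_fam :: "nat \<Rightarrow> nat \<Rightarrow> real \<Rightarrow> (real \<Rightarrow> complex mat) set" where
  "Y_fam n q \<alpha> = {(\<lambda>\<epsilon>\<in>{0<..<\<alpha>}. exp_fam \<epsilon> A) | A.
     A \<in> S_set n \<and> (\<forall>i<n. \<forall>j<n. A $$ (i, j) \<in> I_set q)}"

text \<open>\<open>O_eps \<Gamma> h\<close>: \<open>h g \<epsilon> = O(\<epsilon>)\<close> as \<open>\<epsilon>\<close> tends to \<open>0\<close> from above, uniformly for \<open>g \<in> \<Gamma> \<epsilon>\<close>.\<close>

definition O_eps :: "(real \<Rightarrow> complex mat set) \<Rightarrow> (complex mat \<Rightarrow> real \<Rightarrow> complex) \<Rightarrow> bool" where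
  "O_eps \<Gamma> h \<longleftrightarrow> (\<exists>C::real. \<forall>\<^sub>F \<epsilon> in at_right 0. \<forall>g\<in>\<Gamma> \<epsilon>. cmod (h g \<epsilon>) \<le> C * \<epsilon>)"

definition TPP :: "('a, 'b) monoid_scheme \<Rightarrow> 'a set \<Rightarrow> 'a set \<Rightarrow> 'a set \<Rightarrow> bool" where
  "TPP G X Y Z \<longleftrightarrow> X \<subseteq> carrier G \<and> Y \<subseteq> carrier G \<and> Z \<subseteq> carrier G \<and>
     (\<forall>x\<in>X. \<forall>x'\<in>X. \<forall>y\<in>Y. \<forall>y'\<in>Y. \<forall>z\<in>Z. \<forall>z'\<in>Z.
        inv\<^bsub>G\<^esub> x \<otimes>\<^bsub>G\<^esub> x' \<otimes>\<^bsub>G\<^esub> inv\<^bsub>G\<^esub> y \<otimes>\<^bsub>G\<^esub> y' \<otimes>\<^bsub>G\<^esub> inv\<^bsub>G\<^esub> z \<otimes>\<^bsub>G\<^esub> z' = \<one>\<^bsub>G\<^esub>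
        \<longleftrightarrow> x = x' \<and> y = y' \<and> z = z')"

definition TPP_families :: "nat \<Rightarrow> real \<Rightarrow> (real \<Rightarrow> complex mat) set \<Rightarrow>
    (real \<Rightarrow> complex mat) set \<Rightarrow> (real \<Rightarrow> complex mat) set \<Rightarrow> bool" where
  "TPP_families n \<alpha> X Y Z \<longleftrightarrow>
     (\<forall>\<epsilon>\<in>{0<..<\<alpha>}. TPP (SU n) (at_eps X \<epsilon>) (at_eps Y \<epsilon>) (at_eps Z \<epsilon>))"

text \<open>Border-separating polynomials of degree at most \<open>k\<close>.\<close>

definition border_separating :: "nat \<Rightarrow> nat \<Rightarrow> (real \<Rightarrow> complex mat) set \<Rightarrow>
    (real \<Rightarrow> complex mat) set \<Rightarrow> (real \<Rightarrow> complex mat) set \<Rightarrow>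
    ((real \<Rightarrow> complex mat) \<Rightarrow> (real \<Rightarrow> complex mat) \<Rightarrow> real \<Rightarrow> mat_poly) \<Rightarrow> bool" where
  "border_separating n k X Y Z f \<longleftrightarrow> (\<forall>x\<in>X. \<forall>z\<in>Z.
     (\<exists>\<beta>>0. poly_family n k \<beta> (f x z)) \<and>
     O_eps (\<lambda>\<epsilon>. {x \<epsilon> \<otimes>\<^bsub>SU n\<^esub> inv\<^bsub>SU n\<^esub> (z \<epsilon>)})
       (\<lambda>g \<epsilon>. eval_mat_poly (f x z \<epsilon>) g - 1) \<and>
     O_eps (\<lambda>\<epsilon>. (at_eps X \<epsilon> <#>\<^bsub>SU n\<^esub> set_inv\<^bsub>SU n\<^esub> (at_eps Y \<epsilon>)
                    <#>\<^bsub>SU n\<^esub> at_eps Y \<epsilon> <#>\<^bsub>SU n\<^esub> set_inv\<^bsub>SU n\<^esub> (at_eps Z \<epsilon>))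
                 - {x \<epsilon> \<otimes>\<^bsub>SU n\<^esub> inv\<^bsub>SU n\<^esub> (z \<epsilon>)})
       (\<lambda>g \<epsilon>. eval_mat_poly (f x z \<epsilon>) g))"

end

theory Submission
  imports
    Defs
    "HOL-Complex_Analysis.Complex_Analysis"
begin

text \<open>
  Let \<open>K\<close> be the group of block diagonal elements of \<open>SU n\<close>. Since \<open>X_set\<close> and \<open>Z_set\<close> come from
  exponentials of block diagonal matrices conjugated by \<open>D\<close> and its inverse, every function
  of \<open>D M D\<close> that is invariant under \<open>K\<close> on both sides takes the same value at \<open>x M z\<close> and \<open>M\<close>. With
  \<open>N = D M D\<close>, the polynomial \<open>det (t N - Q N Q)\<close> in \<open>t\<close> is such a function, because elements of \<open>K\<close>
  commute with \<open>Q\<close> and have determinant 1. Its coefficient of degree \<open>n - 1\<close>, up to sign, is the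
  invariant used here (\<open>invar\<close>). On the group it is the trace of \<open>Q N Q N\<^sup>-\<^sup>1\<close>, so at \<open>M = y \<in> K\<close> it
  equals the trace of \<open>H y H y\<^sup>-\<^sup>1\<close> with \<open>H = D\<^sup>-\<^sup>2\<close>.

  For \<open>y = exp (- \<epsilon> A) exp (\<epsilon> A')\<close> and \<open>B = A' - A\<close> this has the expansion
  \<open>tr H\<^sup>2 - (\<epsilon>\<^sup>2 / 2) \<parallel>[B, H]\<parallel>\<^sup>2 + O(\<epsilon>\<^sup>3)\<close> (\<open>invar_expansion\<close>). The matrix \<open>H\<close> lives on the diagonal and the
  antidiagonal, with rational entries, and its diagonal entries are distinct inside each block.
  Therefore \<open>\<parallel>[B, H]\<parallel>\<^sup>2\<close>, multiplied by a constant depending on \<open>n\<close> only, is a positive integer of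
  size \<open>O(q)\<close> whenever \<open>A \<noteq> A'\<close> have entries in \<open>I_set q\<close> (\<open>qform_lattice\<close>). Twice that
  constant times \<open>(tr H\<^sup>2 - invar M) / \<epsilon>\<^sup>2\<close> thus tends to one of \<open>O(q)\<close> known positive integers along
  \<open>M = y\<close>, while it vanishes at the identity; the product of the linear factors that are 1 at 0 and vanish at these integers is the required \<open>p\<^sub>0\<close>
  (\<open>inv_poly\<close>).

  The coordinates come from the equation \<open>D (D\<^sup>-\<^sup>1 s D - D s' D\<^sup>-\<^sup>1) D = s D\<^sup>2 - D\<^sup>2 s'\<close>. Its entries at
  \<open>(i, j)\<close> and at the positions with \<open>i\<close> or \<open>j\<close> reflected form four linear equations for four
  entries of \<open>s\<close> and \<open>s'\<close>, and these are solvable because the values of \<open>tanh\<close> at twice the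
  logarithms of the diagonal entries \<open>n, n - 1, \<dots>, n / 2 + 1\<close> are distinct (\<open>coordinates\<close>).

  For the three families, \<open>X\<close> and \<open>Z\<close> are indexed by integer coordinates in \<open>{..<q}\<close>, and a separating polynomial is \<open>p\<^sub>0\<close> times Lagrange polynomials in the coordinates of
  \<open>(g - 1) / \<epsilon>\<close>: when \<open>y \<noteq> y'\<close> the first factor is \<open>O(\<epsilon>)\<close>, and when \<open>y = y'\<close> the others read off
  \<open>x\<close> and \<open>z\<close> up to \<open>O(\<epsilon>)\<close> (\<open>sep_poly_limit\<close>). The triple product property for small \<open>\<epsilon>\<close> follows from
  the values of these finitely many polynomials.
\<close>

section \<open>Square matrices: entries, trace, adjoint\<close>

lemma mult_entry:
  assumes "A \<in> carrier_mat n n" "B \<in> carrier_mat n n" "i < n" "j < n"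
  shows "(A * B) $$ (i, j) = (\<Sum>k<n. A $$ (i, k) * (B $$ (k, j) :: 'a :: comm_semiring_1))"
  using assms by (auto simp: scalar_prod_def lessThan_atLeast0)

lemma mult_entry3:
  assumes "(A :: complex mat) \<in> carrier_mat n n" "M \<in> carrier_mat n n" "B \<in> carrier_mat n n" "i < n" "j < n"
  shows "(A * M * B) $$ (i, j) = (\<Sum>l<n. B $$ (l, j) * (\<Sum>k<n. A $$ (i, k) * M $$ (k, l)))"
proof -
  have "A * M \<in> carrier_mat n n" using assms by auto
  from mult_entry[OF this assms(3-5)] show ?thesis
    using assms by (simp add: mult_entry[OF assms(1,2)] mult.commute del: index_mult_mat)
qed

text \<open>The trace of an \<open>n\<close> by \<open>n\<close> matrix.\<close>

definition mtr :: "nat \<Rightarrow> complex mat \<Rightarrow> complex" where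
  "mtr n A = (\<Sum>i<n. A $$ (i, i))"

lemma mtr_comm:
  assumes "A \<in> carrier_mat n n" "B \<in> carrier_mat n n"
  shows "mtr n (A * B) = mtr n (B * A)"
proof -
  have "mtr n (A * B) = (\<Sum>i<n. \<Sum>k<n. A $$ (i, k) * B $$ (k, i))"
    unfolding mtr_def using assms by (intro sum.cong) (auto simp: mult_entry simp del: index_mult_mat)
  also have "\<dots> = (\<Sum>k<n. \<Sum>i<n. A $$ (i, k) * B $$ (k, i))"
    by (rule sum.swap)
  also have "\<dots> = mtr n (B * A)"
    unfolding mtr_def using assms
    by (intro sum.cong) (auto simp: mult_entry mult.commute simp del: index_mult_mat)
  finally show ?thesis .
qed

lemma mtr_similar:
  assumes "P \<in> carrier_mat n n" "P' \<in> carrier_mat n n" "P' * P = 1\<^sub>m n" "T \<in> carrier_mat n n"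
  shows "mtr n (P * T * P') = mtr n T"
proof -
  have "mtr n (P * T * P') = mtr n (P' * (P * T))" using assms by (intro mtr_comm) auto
  also have "P' * (P * T) = P' * P * T"
    using assms(1,2,4) by (simp add: assoc_mult_mat[of _ n n _ n _ n])
  finally show ?thesis using assms by simp
qed

lemma mtr_add:
  assumes "A \<in> carrier_mat n n" "B \<in> carrier_mat n n"
  shows "mtr n (A + B) = mtr n A + mtr n B"
  using assms by (auto simp: mtr_def sum.distrib)

lemma mtr_uminus:
  assumes "A \<in> carrier_mat n n"
  shows "mtr n (- A) = - mtr n A"
  using assms by (auto simp: mtr_def sum_negf)

lemma mat_adjoint_carrier [simp, intro]:
  assumes "A \<in> carrier_mat n n"
  shows "mat_adjoint A \<in> carrier_mat n n"
  using assms by (auto simp: mat_adjoint_def mat_of_rows_def)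

lemma mat_adjoint_dim [simp]:
  "dim_row (mat_adjoint A) = dim_col A" "dim_col (mat_adjoint A) = dim_row A"
  by (auto simp: mat_adjoint_def mat_of_rows_def)

lemma mat_adjoint_entry:
  assumes "(A :: complex mat) \<in> carrier_mat n n" "i < n" "j < n"
  shows "mat_adjoint A $$ (i, j) = cnj (A $$ (j, i))"
  using assms by (auto simp: mat_adjoint_def mat_of_rows_def)

lemma mat_adjoint_mult:
  assumes A: "(A :: complex mat) \<in> carrier_mat n n" and B: "B \<in> carrier_mat n n"
  shows "mat_adjoint (A * B) = mat_adjoint B * mat_adjoint A"
proof (rule eq_matI)
  fix i j assume "i < dim_row (mat_adjoint B * mat_adjoint A)" "j < dim_col (mat_adjoint B * mat_adjoint A)"
  then have ij: "i < n" "j < n"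
    using mat_adjoint_carrier[OF A] mat_adjoint_carrier[OF B] by auto
  have AB: "A * B \<in> carrier_mat n n" using A B by auto
  show "mat_adjoint (A * B) $$ (i, j) = (mat_adjoint B * mat_adjoint A) $$ (i, j)"
    unfolding mat_adjoint_entry[OF AB ij]
      mult_entry[OF mat_adjoint_carrier[OF B] mat_adjoint_carrier[OF A] ij]
      mult_entry[OF A B ij(2,1)]
    using A B ij by (auto simp: mat_adjoint_entry mult.commute intro!: sum.cong)
qed (use mat_adjoint_carrier[OF A] mat_adjoint_carrier[OF B] mat_adjoint_carrier[of "A*B" n] A B in auto)

lemma mat_adjoint_one [simp]: "mat_adjoint (1\<^sub>m n :: complex mat) = 1\<^sub>m n"
  by (rule eq_matI) (use mat_adjoint_carrier[of "1\<^sub>m n" n] in \<open>auto simp: mat_adjoint_entry[of _ n]\<close>)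

text \<open>Matrices supported on the diagonal (entries \<open>p i\<close>) and the antidiagonal (entry \<open>q i\<close> in row \<open>i\<close>). For
  even \<open>n\<close> the two do not meet, and these matrices are closed under products (\<open>xmat_mult\<close>).\<close>

definition xmat :: "nat \<Rightarrow> (nat \<Rightarrow> complex) \<Rightarrow> (nat \<Rightarrow> complex) \<Rightarrow> complex mat" where
  "xmat n p q = Matrix.mat n n (\<lambda>(i, j). if i = j then p i else if i + j + 1 = n then q i else 0)"

lemma xmat_carrier [simp, intro]: "xmat n p q \<in> carrier_mat n n"
  by (simp add: xmat_def)

lemma xmat_cong:
  assumes "\<And>i. i < n \<Longrightarrow> p i = p' i" "\<And>i. i < n \<Longrightarrow> q i = q' i"
  shows "xmat n p q = xmat n p' q'"
  using assms by (auto simp: xmat_def intro!: eq_matI)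

lemma xmat_one: "1\<^sub>m n = xmat n (\<lambda>_. 1) (\<lambda>_. 0)"
  by (auto simp: xmat_def intro!: eq_matI)

text \<open>The standing assumptions on the size, with the two halves of the index range as diagonal blocks.\<close>

locale even_size =
  fixes n :: nat
  assumes even_n: "even n" and n_ge_2: "n \<ge> 2"
begin

text \<open>The reflection of the index range. It exchanges the two halves, so it has no fixed point.\<close>

definition opp :: "nat \<Rightarrow> nat" where "opp i = n - 1 - i"

lemma opp_less [simp, intro]: "i < n \<Longrightarrow> opp i < n"
  by (auto simp: opp_def)

lemma opp_opp [simp]: "i < n \<Longrightarrow> opp (opp i) = i"
  by (auto simp: opp_def)

lemma half: "n div 2 + n div 2 = n"
  using even_n by presburger

lemma opp_neq: "i < n \<Longrightarrow> opp i \<noteq> i" "i < n \<Longrightarrow> i \<noteq> opp i"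
  using even_n unfolding opp_def by presburger+

lemma opp_low: "i < n \<Longrightarrow> opp i < n div 2 \<longleftrightarrow> \<not> i < n div 2"
  using even_n by (auto simp: opp_def elim!: evenE)

lemma xmat_entry:
  "i < n \<Longrightarrow> j < n \<Longrightarrow> xmat n p q $$ (i, j) = (if j = i then p i else if j = opp i then q i else 0)"
  by (auto simp: xmat_def opp_def)

lemma sum_on_pair:
  assumes "i < n" "\<And>k. k < n \<Longrightarrow> k \<noteq> i \<Longrightarrow> k \<noteq> opp i \<Longrightarrow> f k = 0"
  shows "(\<Sum>k<n. f k) = f i + (f (opp i) :: complex)"
proof -
  have "(\<Sum>k<n. f k) = (\<Sum>k\<in>{i, opp i}. f k)"
    using assms by (intro sum.mono_neutral_right) auto
  then show ?thesis using opp_neq[OF assms(1)] by simp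
qed

lemma xmat_mult_left_entry:
  assumes "M \<in> carrier_mat n n" "i < n" "j < n"
  shows "(xmat n p q * M) $$ (i, j) = p i * M $$ (i, j) + q i * M $$ (opp i, j)"
proof -
  have "(xmat n p q * M) $$ (i, j) = (\<Sum>k<n. xmat n p q $$ (i, k) * M $$ (k, j))"
    by (rule mult_entry) (use assms in auto)
  also have "\<dots> = xmat n p q $$ (i, i) * M $$ (i, j) + xmat n p q $$ (i, opp i) * M $$ (opp i, j)"
    by (rule sum_on_pair) (use assms in \<open>auto simp: xmat_entry\<close>)
  finally show ?thesis using assms opp_neq by (simp add: xmat_entry)
qed

lemma xmat_mult_right_entry:
  assumes "M \<in> carrier_mat n n" "i < n" "j < n"
  shows "(M * xmat n p q) $$ (i, j) = M $$ (i, j) * p j + M $$ (i, opp j) * q (opp j)"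
proof -
  have "(M * xmat n p q) $$ (i, j) = (\<Sum>k<n. M $$ (i, k) * xmat n p q $$ (k, j))"
    by (rule mult_entry) (use assms in auto)
  also have "\<dots> = M $$ (i, j) * xmat n p q $$ (j, j) + M $$ (i, opp j) * xmat n p q $$ (opp j, j)"
    by (rule sum_on_pair) (use assms in \<open>auto simp: xmat_entry\<close>)
  finally show ?thesis using assms opp_neq by (simp add: xmat_entry)
qed

lemma xmat_mult:
  "xmat n p q * xmat n r s =
     xmat n (\<lambda>i. p i * r i + q i * s (opp i)) (\<lambda>i. p i * s i + q i * r (opp i))"
proof (rule eq_matI)
  fix i j
  assume "i < dim_row (xmat n (\<lambda>i. p i * r i + q i * s (opp i)) (\<lambda>i. p i * s i + q i * r (opp i)))"
    "j < dim_col (xmat n (\<lambda>i. p i * r i + q i * s (opp i)) (\<lambda>i. p i * s i + q i * r (opp i)))"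
  then have ij: "i < n" "j < n" by (auto simp: xmat_def)
  have *: "j = opp i \<Longrightarrow> opp j = i" using ij by auto
  show "(xmat n p q * xmat n r s) $$ (i, j) =
    xmat n (\<lambda>i. p i * r i + q i * s (opp i)) (\<lambda>i. p i * s i + q i * r (opp i)) $$ (i, j)"
    using ij opp_neq[OF ij(1)] opp_neq[OF ij(2)] *
    by (auto simp: xmat_mult_left_entry xmat_entry simp del: index_mult_mat)
qed (auto simp: xmat_def)

text \<open>
  The diagonal entries of \<open>D0_mat\<close> are \<open>av i\<close> in the upper half and \<open>1 / av i\<close> in the lower half, with
  \<open>av\<close> invariant under reflection. Conjugation by \<open>U_mat\<close> turns such a pair into the
  hyperbolic cosine \<open>ch i\<close> and sine \<open>sh i\<close> of \<open>ln (av i)\<close>, on the diagonal and the antidiagonal (\<open>D_mat_xmat\<close>).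
  The signs \<open>sgnQ\<close> are the diagonal of \<open>Q_mat\<close>.
\<close>

definition av :: "nat \<Rightarrow> real" where "av i = real (max (n - i) (i + 1))"

lemma av_opp [simp]: "i < n \<Longrightarrow> av (opp i) = av i"
  by (auto simp: av_def opp_def)

lemma av_gt_1: "av i > 1"
  using n_ge_2 by (auto simp: av_def)

lemma av_pos [simp]: "av i > 0" "av i \<noteq> 0"
  using av_gt_1[of i] by auto

lemma av_inj:
  assumes "i < n" "j < n" "i < n div 2 \<longleftrightarrow> j < n div 2" "av i = av j"
  shows "i = j"
  using assms even_n by (auto simp: av_def max_def split: if_splits elim!: evenE)

definition ch :: "nat \<Rightarrow> complex" where "ch i = of_real ((av i + 1 / av i) / 2)"
definition sh :: "nat \<Rightarrow> complex" where "sh i = of_real ((av i - 1 / av i) / 2)"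
definition sgnQ :: "nat \<Rightarrow> complex" where "sgnQ i = (if i < n div 2 then 1 else - 1)"

lemma ch_opp [simp]: "i < n \<Longrightarrow> ch (opp i) = ch i" and sh_opp [simp]: "i < n \<Longrightarrow> sh (opp i) = sh i"
  by (auto simp: ch_def sh_def)

lemma ch_sh: "ch i * ch i - sh i * sh i = 1"
proof -
  have "((av i + 1 / av i) / 2) * ((av i + 1 / av i) / 2) - ((av i - 1 / av i) / 2) * ((av i - 1 / av i) / 2) = 1"
    by (simp add: field_simps)
  then show ?thesis unfolding ch_def sh_def by (metis of_real_1 of_real_diff of_real_mult)
qed

lemma sgnQ_opp [simp]: "i < n \<Longrightarrow> sgnQ (opp i) = - sgnQ i"
  using opp_low by (auto simp: sgnQ_def)

lemma sgnQ_sq [simp]: "sgnQ i * sgnQ i = 1"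
  by (simp add: sgnQ_def)

lemma Q_mat_xmat: "Q_mat n = xmat n sgnQ (\<lambda>_. 0)"
  using half by (auto simp: Q_mat_def xmat_def sgnQ_def Let_def intro!: eq_matI)

text \<open>The scalar factor \<open>1 / \<surd>2\<close> of \<open>U_mat\<close>.\<close>

definition rt2 :: complex where "rt2 = of_real (1 / sqrt 2)"

lemma rt2_sq: "rt2 * rt2 = 1 / 2"
  by (simp add: rt2_def flip: of_real_mult)

lemma cnj_rt2 [simp]: "cnj rt2 = rt2"
  by (simp add: rt2_def)

lemma U_mat_xmat: "U_mat n = xmat n (\<lambda>i. rt2 * sgnQ i) (\<lambda>i. rt2)"
proof -
  define h where "h = n div 2"
  have n: "n = h + h" using half by (simp add: h_def)
  have B: "four_block_mat (1\<^sub>m h) (J_mat h) (J_mat h) (- 1\<^sub>m h) =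
      xmat n (\<lambda>i. if i < h then 1 else - 1) (\<lambda>_. 1)"
    (is "?L = ?R")
  proof (rule eq_matI)
    fix i j assume "i < dim_row ?R" "j < dim_col ?R"
    then have ij: "i < h + h" "j < h + h" by (auto simp: xmat_def n)
    consider "i < h" "j < h" | j' where "i < h" "j = h + j'" "j' < h"
      | i' where "i = h + i'" "i' < h" "j < h"
      | i' j' where "i = h + i'" "i' < h" "j = h + j'" "j' < h"
      using ij by (metis add_less_cancel_left le_Suc_ex not_less)
    then show "?L $$ (i, j) = ?R $$ (i, j)"
      by cases (auto simp: J_mat_def xmat_def n)
  qed (auto simp: xmat_def J_mat_def n)
  show ?thesis
    unfolding U_mat_def Let_def rt2_def h_def[symmetric] B
    by (rule eq_matI) (auto simp: xmat_def sgnQ_def h_def)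
qed

lemma D0_mat_xmat:
  "D0_mat n = xmat n (\<lambda>i. if i < n div 2 then of_real (av i) else of_real (1 / av i)) (\<lambda>_. 0)"
  using half by (auto simp: D0_mat_def mat_diag_def xmat_def av_def max_def of_nat_diff intro!: eq_matI)

lemma xmat_adjoint:
  "mat_adjoint (xmat n p q) = xmat n (\<lambda>i. cnj (p i)) (\<lambda>i. cnj (q (opp i)))"
proof (rule eq_matI)
  fix i j assume "i < dim_row (xmat n (\<lambda>i. cnj (p i)) (\<lambda>i. cnj (q (opp i))))"
    "j < dim_col (xmat n (\<lambda>i. cnj (p i)) (\<lambda>i. cnj (q (opp i))))"
  then have "i < n" "j < n" by (auto simp: xmat_def)
  then show "mat_adjoint (xmat n p q) $$ (i, j) = xmat n (\<lambda>i. cnj (p i)) (\<lambda>i. cnj (q (opp i))) $$ (i, j)"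
    by (subst mat_adjoint_entry[of _ n]) (auto simp: xmat_entry)
qed (use mat_adjoint_carrier[of "xmat n p q" n] in \<open>auto simp: xmat_def\<close>)

lemma U_adjoint: "mat_adjoint (U_mat n) = U_mat n"
  unfolding U_mat_xmat xmat_adjoint by (rule xmat_cong) (auto simp: sgnQ_def)

lemma U_U: "U_mat n * U_mat n = 1\<^sub>m n"
  unfolding U_mat_xmat xmat_one xmat_mult
proof (rule xmat_cong)
  fix i assume "i < n"
  show "rt2 * sgnQ i * (rt2 * sgnQ i) + rt2 * rt2 = 1"
    using rt2_sq by (simp add: sgnQ_def mult.commute)
  show "rt2 * sgnQ i * rt2 + rt2 * (rt2 * sgnQ (opp i)) = 0"
    using \<open>i < n\<close> by simp
qed

lemma D_mat_xmat: "D_mat n = xmat n ch sh"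
  unfolding D_mat_def U_adjoint
  unfolding U_mat_xmat D0_mat_xmat xmat_mult
proof (rule xmat_cong, goal_cases)
  case (1 i)
  then show ?case using rt2_sq
    by (cases "i < n div 2") (simp_all add: opp_low sgnQ_def ch_def algebra_simps flip: mult.assoc)
next
  case (2 i)
  then show ?case using rt2_sq
    by (cases "i < n div 2") (simp_all add: opp_low sgnQ_def sh_def algebra_simps flip: mult.assoc)
qed

text \<open>The inverse of \<open>D_mat n\<close>, see \<open>D_Dm\<close>.\<close>

definition Dm :: "complex mat" where "Dm = xmat n ch (\<lambda>i. - sh i)"

lemma D_carrier [simp, intro]: "D_mat n \<in> carrier_mat n n" "Dm \<in> carrier_mat n n"
  by (auto simp: D_mat_xmat Dm_def)

lemma Q_carrier [simp, intro]: "Q_mat n \<in> carrier_mat n n"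
  by (auto simp: Q_mat_xmat)

lemma D_Dm: "D_mat n * Dm = 1\<^sub>m n" "Dm * D_mat n = 1\<^sub>m n"
  unfolding D_mat_xmat Dm_def xmat_one xmat_mult
  by (rule xmat_cong; use ch_sh in \<open>auto simp: algebra_simps\<close>)+

lemma Q_Q: "Q_mat n * Q_mat n = 1\<^sub>m n"
  unfolding Q_mat_xmat xmat_one xmat_mult by (rule xmat_cong) auto

lemma QDQ: "Q_mat n * D_mat n * Q_mat n = Dm"
  unfolding Q_mat_xmat D_mat_xmat Dm_def xmat_mult
proof (rule xmat_cong)
  fix i assume i: "i < n"
  show "(sgnQ i * ch i + 0 * sh (opp i)) * sgnQ i + (sgnQ i * sh i + 0 * ch (opp i)) * 0 = ch i"
    by (simp add: sgnQ_def)
  have "sgnQ i * sh i * (- sgnQ i) = - sh i"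
    by (simp add: sgnQ_def)
  then show "(sgnQ i * ch i + 0 * sh (opp i)) * 0 + (sgnQ i * sh i + 0 * ch (opp i)) * sgnQ (opp i) = - sh i"
    using i by simp
qed

lemma D_adjoint: "mat_adjoint (D_mat n) = D_mat n"
  unfolding D_mat_xmat xmat_adjoint by (rule xmat_cong) (auto simp: ch_def sh_def)

lemma D_Q_D: "mat_adjoint (D_mat n) * Q_mat n * D_mat n = Q_mat n"
  unfolding D_adjoint
  unfolding Q_mat_xmat D_mat_xmat xmat_mult
proof (rule xmat_cong)
  fix i assume i: "i < n"
  have "ch i * sgnQ i * ch i - sh i * sgnQ i * sh i = (ch i * ch i - sh i * sh i) * sgnQ i"
    by (simp add: algebra_simps)
  then show "(ch i * sgnQ i + sh i * 0) * ch i + (ch i * 0 + sh i * sgnQ (opp i)) * sh (opp i) = sgnQ i"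
    using i ch_sh[of i] by simp
  show "(ch i * sgnQ i + sh i * 0) * sh i + (ch i * 0 + sh i * sgnQ (opp i)) * ch (opp i) = 0"
    using i by simp
qed

lemma det_D0: "Determinant.det (D0_mat n) = 1"
proof -
  have "Determinant.det (D0_mat n) = prod_list (diag_mat (D0_mat n))"
    by (rule det_upper_triangular[of _ n]) (auto simp: D0_mat_def mat_diag_def)
  also have "\<dots> = (\<Prod>i<n. D0_mat n $$ (i, i))"
    by (simp add: prod_list_diag_prod D0_mat_def mat_diag_def lessThan_atLeast0)
  also have "\<dots> = (\<Prod>i<n. if i < n div 2 then of_real (av i) else of_real (1 / av i))"
    by (intro prod.cong) (auto simp: D0_mat_xmat xmat_entry)
  also have "\<dots> = (\<Prod>i\<in>{..<n} \<inter> {i. i < n div 2}. complex_of_real (av i)) *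
      (\<Prod>i\<in>{..<n} \<inter> - {i. i < n div 2}. of_real (1 / av i))"
    by (simp add: prod.If_cases)
  also have "(\<Prod>i\<in>{..<n} \<inter> - {i. i < n div 2}. complex_of_real (1 / av i)) =
      (\<Prod>i\<in>{..<n} \<inter> {i. i < n div 2}. of_real (1 / av i))"
    by (rule prod.reindex_bij_witness[of _ opp opp]) (auto simp: opp_low)
  also have "(\<Prod>i\<in>{..<n} \<inter> {i. i < n div 2}. complex_of_real (av i)) * \<dots> = 1"
    by (simp flip: prod.distrib)
  finally show ?thesis .
qed

lemma det_D: "Determinant.det (D_mat n) = 1"
proof -
  have U: "U_mat n \<in> carrier_mat n n" and D0: "D0_mat n \<in> carrier_mat n n"
    by (auto simp: U_mat_xmat D0_mat_xmat)
  have "Determinant.det (U_mat n) * Determinant.det (U_mat n) = 1"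
    using det_mult[OF U U] U_U by simp
  then show ?thesis
    unfolding D_mat_def U_adjoint using U D0 by (simp add: det_mult[of _ n] det_D0)
qed

end

section \<open>The matrix exponential\<close>

lemma pow_entry_bound:
  assumes A: "A \<in> carrier_mat n n" and c: "\<And>i j. i < n \<Longrightarrow> j < n \<Longrightarrow> cmod (A $$ (i, j)) \<le> c"
    and ij: "i < n" "j < n"
  shows "cmod ((A ^\<^sub>m k) $$ (i, j)) \<le> (real n * c) ^ k"
  using ij
proof (induction k arbitrary: i j)
  case 0
  then show ?case using A by auto
next
  case (Suc k)
  have c0: "c \<ge> 0" using c[OF Suc.prems] norm_ge_zero order_trans by blast
  have P: "A ^\<^sub>m k \<in> carrier_mat n n" using A by auto
  have "cmod ((A ^\<^sub>m Suc k) $$ (i, j)) = cmod (\<Sum>l<n. (A ^\<^sub>m k) $$ (i, l) * A $$ (l, j))"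
    using mult_entry[OF P A Suc.prems] by simp
  also have "\<dots> \<le> (\<Sum>l<n. (real n * c) ^ k * c)"
    by (rule sum_norm_le) (use Suc c c0 in \<open>auto simp: norm_mult intro!: mult_mono\<close>)
  also have "\<dots> = (real n * c) ^ Suc k" by simp
  finally show ?case .
qed

lemma entry_bound_ex:
  "\<exists>c\<ge>0. \<forall>i<n. \<forall>j<n. cmod ((A :: complex mat) $$ (i, j)) \<le> c"
proof (intro exI[of _ "\<Sum>i<n. \<Sum>j<n. cmod (A $$ (i, j))"] conjI allI impI)
  fix i j assume "i < n" "j < n"
  have "cmod (A $$ (i, j)) \<le> (\<Sum>j<n. cmod (A $$ (i, j)))"
    by (rule member_le_sum) (use \<open>j < n\<close> in auto)
  also have "\<dots> \<le> (\<Sum>i<n. \<Sum>j<n. cmod (A $$ (i, j)))"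
    by (rule member_le_sum[of _ _ "\<lambda>i. \<Sum>j<n. cmod (A $$ (i, j))"]) (use \<open>i < n\<close> in \<open>auto intro: sum_nonneg\<close>)
  finally show "cmod (A $$ (i, j)) \<le> (\<Sum>i<n. \<Sum>j<n. cmod (A $$ (i, j)))" .
qed (auto intro!: sum_nonneg)

lemma mat_exp_summable:
  assumes A: "(A :: complex mat) \<in> carrier_mat n n" and ij: "i < n" "j < n"
  shows "summable (\<lambda>k. norm ((A ^\<^sub>m k) $$ (i, j) / fact k))"
proof -
  obtain c where c: "\<And>i j. i < n \<Longrightarrow> j < n \<Longrightarrow> cmod (A $$ (i, j)) \<le> c"
    using entry_bound_ex[of n A] by blast
  show ?thesis
  proof (rule summable_comparison_test')
    show "summable (\<lambda>k. inverse (fact k) * (real n * c) ^ k)" by (rule summable_exp)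
    show "norm (norm ((A ^\<^sub>m k) $$ (i, j) / fact k)) \<le> inverse (fact k) * (real n * c) ^ k"
      if "k \<ge> 0" for k
      using pow_entry_bound[OF A c ij, of k] by (simp add: norm_divide field_simps)
  qed
qed

lemma mat_exp_carrier [simp, intro]:
  "A \<in> carrier_mat n n \<Longrightarrow> mat_exp A \<in> carrier_mat n n"
  by (auto simp: mat_exp_def)

lemma exp_fam_square: "A \<in> carrier_mat n n \<Longrightarrow> exp_fam \<epsilon> A \<in> carrier_mat n n"
  by (auto simp: exp_fam_def)

lemma mat_exp_sums:
  assumes A: "(A :: complex mat) \<in> carrier_mat n n" and ij: "i < n" "j < n"
  shows "(\<lambda>k. (A ^\<^sub>m k) $$ (i, j) / fact k) sums (mat_exp A $$ (i, j))"
  using summable_sums[OF summable_norm_cancel[OF mat_exp_summable[OF A ij]]] A ij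
  by (simp add: mat_exp_def)

lemma pow_smult:
  assumes A: "(A :: complex mat) \<in> carrier_mat n n"
  shows "(c \<cdot>\<^sub>m A) ^\<^sub>m k = c ^ k \<cdot>\<^sub>m (A ^\<^sub>m k)"
proof (induction k)
  case (Suc k)
  have P: "A ^\<^sub>m k \<in> carrier_mat n n" using A by auto
  have "(c \<cdot>\<^sub>m A) ^\<^sub>m Suc k = (c ^ k \<cdot>\<^sub>m (A ^\<^sub>m k)) * (c \<cdot>\<^sub>m A)"
    using Suc by simp
  also have "\<dots> = c ^ Suc k \<cdot>\<^sub>m (A ^\<^sub>m k * A)"
    using A P by (auto simp: mult_entry intro!: eq_matI)
  finally show ?case by simp
qed (use A in auto)

lemma pow_add:
  assumes A: "(A :: complex mat) \<in> carrier_mat n n"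
  shows "A ^\<^sub>m (k + l) = A ^\<^sub>m k * A ^\<^sub>m l"
proof (induction l)
  case (Suc l)
  then show ?case using A by (simp add: assoc_mult_mat[of _ n n _ n _ n])
qed (use A in auto)

lemma mat_exp_power_series:
  assumes A: "A \<in> carrier_mat n n" and ij: "i < n" "j < n"
  shows "(\<lambda>k. ((A ^\<^sub>m k) $$ (i, j) / fact k) * z ^ k) sums (mat_exp (z \<cdot>\<^sub>m A) $$ (i, j))"
proof -
  have "(\<lambda>k. ((z \<cdot>\<^sub>m A) ^\<^sub>m k) $$ (i, j) / fact k) = (\<lambda>k. ((A ^\<^sub>m k) $$ (i, j) / fact k) * z ^ k)"
    using A ij by (auto simp: pow_smult[OF A])
  then show ?thesis
    using mat_exp_sums[of "z \<cdot>\<^sub>m A" n i j] A ij by simp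
qed

lemma mat_exp_add:
  assumes A: "A \<in> carrier_mat n n"
  shows "mat_exp (s \<cdot>\<^sub>m A) * mat_exp (t \<cdot>\<^sub>m A) = mat_exp ((s + t) \<cdot>\<^sub>m A)"
proof (rule eq_matI)
  fix i j assume "i < dim_row (mat_exp ((s + t) \<cdot>\<^sub>m A))" "j < dim_col (mat_exp ((s + t) \<cdot>\<^sub>m A))"
  then have ij: "i < n" "j < n" using A by (auto simp: mat_exp_def)
  have sA: "s \<cdot>\<^sub>m A \<in> carrier_mat n n" and tA: "t \<cdot>\<^sub>m A \<in> carrier_mat n n"
    and stA: "(s + t) \<cdot>\<^sub>m A \<in> carrier_mat n n" using A by auto
  define a where "a = (\<lambda>l k. ((s \<cdot>\<^sub>m A) ^\<^sub>m k) $$ (i, l) / fact k)"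
  define b where "b = (\<lambda>l k. ((t \<cdot>\<^sub>m A) ^\<^sub>m k) $$ (l, j) / fact k)"
  have "(\<lambda>k. \<Sum>p\<le>k. a l p * b l (k - p)) sums (mat_exp (s \<cdot>\<^sub>m A) $$ (i, l) * mat_exp (t \<cdot>\<^sub>m A) $$ (l, j))"
    if l: "l < n" for l
  proof -
    have "suminf (a l) = mat_exp (s \<cdot>\<^sub>m A) $$ (i, l)" "suminf (b l) = mat_exp (t \<cdot>\<^sub>m A) $$ (l, j)"
      using mat_exp_sums[OF sA ij(1) l] mat_exp_sums[OF tA l ij(2)]
      by (auto simp: a_def b_def sums_iff)
    then show ?thesis
      using Cauchy_product_sums[of "a l" "b l"] mat_exp_summable[OF sA ij(1) l] mat_exp_summable[OF tA l ij(2)]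
      by (simp add: a_def b_def)
  qed
  then have "(\<lambda>k. \<Sum>l<n. \<Sum>p\<le>k. a l p * b l (k - p)) sums
      (\<Sum>l<n. mat_exp (s \<cdot>\<^sub>m A) $$ (i, l) * mat_exp (t \<cdot>\<^sub>m A) $$ (l, j))"
    by (intro sums_sum) auto
  also have "(\<Sum>l<n. mat_exp (s \<cdot>\<^sub>m A) $$ (i, l) * mat_exp (t \<cdot>\<^sub>m A) $$ (l, j)) =
      (mat_exp (s \<cdot>\<^sub>m A) * mat_exp (t \<cdot>\<^sub>m A)) $$ (i, j)"
    by (rule mult_entry[symmetric]) (use sA tA ij in auto)
  also have "(\<lambda>k. \<Sum>l<n. \<Sum>p\<le>k. a l p * b l (k - p)) = (\<lambda>k. (((s + t) \<cdot>\<^sub>m A) ^\<^sub>m k) $$ (i, j) / fact k)"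
  proof
    fix k
    have "(\<Sum>l<n. \<Sum>p\<le>k. a l p * b l (k - p)) = (\<Sum>p\<le>k. \<Sum>l<n. a l p * b l (k - p))"
      by (rule sum.swap)
    also have "\<dots> = (\<Sum>p\<le>k. of_nat (k choose p) * s ^ p * t ^ (k - p) * (A ^\<^sub>m k) $$ (i, j) / fact k)"
    proof (rule sum.cong[OF refl])
      fix p assume p: "p \<in> {..k}"
      have P1: "A ^\<^sub>m p \<in> carrier_mat n n" and P2: "A ^\<^sub>m (k - p) \<in> carrier_mat n n" using A by auto
      have "(\<Sum>l<n. a l p * b l (k - p)) =
          (s ^ p * t ^ (k - p) / (fact p * fact (k - p))) * (\<Sum>l<n. (A ^\<^sub>m p) $$ (i, l) * (A ^\<^sub>m (k - p)) $$ (l, j))"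
        unfolding a_def b_def sum_distrib_left
        by (rule sum.cong) (use A ij P1 P2 in \<open>auto simp: pow_smult[OF A] field_simps\<close>)
      also have "(\<Sum>l<n. (A ^\<^sub>m p) $$ (i, l) * (A ^\<^sub>m (k - p)) $$ (l, j)) = (A ^\<^sub>m k) $$ (i, j)"
        using mult_entry[OF P1 P2 ij] pow_add[OF A, of p "k - p"] p by simp
      also have "1 / (fact p * fact (k - p)) = (of_nat (k choose p) / fact k :: complex)"
        using p binomial_fact[of p k, where 'a=complex] by (simp add: field_simps)
      then have "s ^ p * t ^ (k - p) / (fact p * fact (k - p)) = s ^ p * t ^ (k - p) * (of_nat (k choose p) / fact k)"
        by (metis divide_inverse inverse_eq_divide)
      finally show "(\<Sum>l<n. a l p * b l (k - p)) = of_nat (k choose p) * s ^ p * t ^ (k - p) * (A ^\<^sub>m k) $$ (i, j) / fact k"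
        by (simp add: field_simps)
    qed
    also have "\<dots> = (s + t) ^ k * (A ^\<^sub>m k) $$ (i, j) / fact k"
      by (simp add: binomial_ring sum_distrib_right sum_divide_distrib)
    also have "\<dots> = (((s + t) \<cdot>\<^sub>m A) ^\<^sub>m k) $$ (i, j) / fact k"
      using A ij by (simp add: pow_smult[OF A])
    finally show "(\<Sum>l<n. \<Sum>p\<le>k. a l p * b l (k - p)) = (((s + t) \<cdot>\<^sub>m A) ^\<^sub>m k) $$ (i, j) / fact k" .
  qed
  finally show "(mat_exp (s \<cdot>\<^sub>m A) * mat_exp (t \<cdot>\<^sub>m A)) $$ (i, j) = mat_exp ((s + t) \<cdot>\<^sub>m A) $$ (i, j)"
    using mat_exp_sums[OF stA ij] by (rule sums_unique2)
qed (use A in \<open>auto simp: mat_exp_def\<close>)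

lemma mat_exp_zero:
  assumes A: "A \<in> carrier_mat n n"
  shows "mat_exp (0 \<cdot>\<^sub>m A) = 1\<^sub>m n"
proof (rule eq_matI)
  fix i j assume "i < dim_row (1\<^sub>m n)" "j < dim_col (1\<^sub>m n)"
  then have ij: "i < n" "j < n" by auto
  have "mat_exp (0 \<cdot>\<^sub>m A) $$ (i, j) = (A ^\<^sub>m 0) $$ (i, j) / fact 0"
    by (rule sums_unique2[OF mat_exp_power_series[OF A ij] powser_sums_zero])
  then show "mat_exp (0 \<cdot>\<^sub>m A) $$ (i, j) = 1\<^sub>m n $$ (i, j)" using A by simp
qed (use A in \<open>auto simp: mat_exp_def\<close>)

lemma mat_exp_adjoint:
  assumes A: "A \<in> carrier_mat n n"
  shows "mat_adjoint (mat_exp A) = mat_exp (mat_adjoint A)"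
proof (rule eq_matI)
  fix i j assume "i < dim_row (mat_exp (mat_adjoint A))" "j < dim_col (mat_exp (mat_adjoint A))"
  then have ij: "i < n" "j < n" using A by (auto simp: mat_exp_def)
  have pow: "mat_adjoint (A ^\<^sub>m k) = (mat_adjoint A) ^\<^sub>m k" for k
  proof (induction k)
    case (Suc k)
    have P: "A ^\<^sub>m k \<in> carrier_mat n n" using A by auto
    have "mat_adjoint (A ^\<^sub>m Suc k) = mat_adjoint A * (mat_adjoint A) ^\<^sub>m k"
      using Suc mat_adjoint_mult[OF P A] by simp
    also have "\<dots> = (mat_adjoint A) ^\<^sub>m Suc k"
      using pow_add[OF mat_adjoint_carrier[OF A], of 1 k] A by simp
    finally show ?case .
  qed (use A in auto)
  have sums: "(\<lambda>k. cnj ((A ^\<^sub>m k) $$ (j, i) / fact k)) sums cnj (mat_exp A $$ (j, i))"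
    using mat_exp_sums[OF A ij(2,1)] by (simp only: sums_cnj)
  have "cnj ((A ^\<^sub>m k) $$ (j, i) / fact k) = ((mat_adjoint A) ^\<^sub>m k) $$ (i, j) / fact k" for k
    using mat_adjoint_entry[of "A ^\<^sub>m k" n i j] A ij by (simp flip: pow)
  from sums[unfolded this] have "cnj (mat_exp A $$ (j, i)) = mat_exp (mat_adjoint A) $$ (i, j)"
    by (rule sums_unique2[OF _ mat_exp_sums[OF mat_adjoint_carrier[OF A] ij]])
  then show "mat_adjoint (mat_exp A) $$ (i, j) = mat_exp (mat_adjoint A) $$ (i, j)"
    using mat_adjoint_entry[of "mat_exp A" n i j] A ij by simp
qed (use A in \<open>auto simp: mat_exp_def\<close>)

text \<open>This covers both conjugation by an invertible \<open>P\<close> and commutation with \<open>P\<close> (\<open>A = B\<close>).\<close>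

lemma mat_exp_intertwine:
  assumes A: "A \<in> carrier_mat n n" and B: "B \<in> carrier_mat n n" and P: "P \<in> carrier_mat n n"
    and PA: "P * A = B * P"
  shows "P * mat_exp A = mat_exp B * P"
proof (rule eq_matI)
  fix i j assume "i < dim_row (mat_exp B * P)" "j < dim_col (mat_exp B * P)"
  then have ij: "i < n" "j < n" using B P by (auto simp: mat_exp_def)
  have pow: "P * A ^\<^sub>m k = B ^\<^sub>m k * P" for k
  proof (induction k)
    case (Suc k)
    have Ak: "A ^\<^sub>m k \<in> carrier_mat n n" and Bk: "B ^\<^sub>m k \<in> carrier_mat n n" using A B by auto
    have "P * A ^\<^sub>m Suc k = (P * A ^\<^sub>m k) * A"
      using P Ak A by (simp add: assoc_mult_mat[of _ n n _ n _ n])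
    also have "\<dots> = B ^\<^sub>m k * (P * A)"
      unfolding Suc using P Bk A by (simp add: assoc_mult_mat[of _ n n _ n _ n])
    also have "\<dots> = B ^\<^sub>m Suc k * P"
      unfolding PA using P Bk B by (simp add: assoc_mult_mat[of _ n n _ n _ n])
    finally show ?case .
  qed (use A B P in auto)
  have "(\<lambda>k. \<Sum>l<n. P $$ (i, l) * ((A ^\<^sub>m k) $$ (l, j) / fact k)) sums (\<Sum>l<n. P $$ (i, l) * mat_exp A $$ (l, j))"
    using mat_exp_sums[OF A _ ij(2)] by (intro sums_sum sums_mult) auto
  moreover have "(\<lambda>k. \<Sum>l<n. ((B ^\<^sub>m k) $$ (i, l) / fact k) * P $$ (l, j)) sums (\<Sum>l<n. mat_exp B $$ (i, l) * P $$ (l, j))"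
    using mat_exp_sums[OF B ij(1)] by (intro sums_sum sums_mult2) auto
  moreover have "(\<Sum>l<n. P $$ (i, l) * ((A ^\<^sub>m k) $$ (l, j) / fact k)) =
      (\<Sum>l<n. ((B ^\<^sub>m k) $$ (i, l) / fact k) * P $$ (l, j))" for k
  proof -
    have "(\<Sum>l<n. P $$ (i, l) * (A ^\<^sub>m k) $$ (l, j)) = (\<Sum>l<n. (B ^\<^sub>m k) $$ (i, l) * P $$ (l, j))"
      using mult_entry[OF P _ ij, of "A ^\<^sub>m k"] mult_entry[OF _ P ij, of "B ^\<^sub>m k"] A B pow by simp
    then show ?thesis by (simp flip: sum_divide_distrib)
  qed
  ultimately have "(\<Sum>l<n. P $$ (i, l) * mat_exp A $$ (l, j)) = (\<Sum>l<n. mat_exp B $$ (i, l) * P $$ (l, j))"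
    using sums_unique2 by simp
  then show "(P * mat_exp A) $$ (i, j) = (mat_exp B * P) $$ (i, j)"
    using mult_entry[OF P _ ij, of "mat_exp A"] mult_entry[OF _ P ij, of "mat_exp B"] A B by simp
qed (use A B P in \<open>auto simp: mat_exp_def\<close>)

lemma upper_triangular_pow:
  assumes T: "T \<in> carrier_mat n n" "upper_triangular T"
  shows "i < n \<Longrightarrow> j < n \<Longrightarrow> (i = j \<longrightarrow> (T ^\<^sub>m k) $$ (i, j) = (T $$ (i, i) :: complex) ^ k) \<and>
      (j < i \<longrightarrow> (T ^\<^sub>m k) $$ (i, j) = 0)"
proof (induction k arbitrary: i j)
  case 0
  then show ?case using T by auto
next
  case (Suc k)
  have P: "T ^\<^sub>m k \<in> carrier_mat n n" using T by auto
  have e: "(T ^\<^sub>m Suc k) $$ (i, j) = (\<Sum>l<n. (T ^\<^sub>m k) $$ (i, l) * T $$ (l, j))"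
    using mult_entry[OF P T(1) Suc.prems] by simp
  have z: "(T ^\<^sub>m k) $$ (i, l) * T $$ (l, j) = 0" if "l < n" "l < i \<or> j < l" for l
    using that Suc.IH[of i l] Suc.prems upper_triangularD[OF T(2), of j l] T(1) by auto
  consider "i = j" | "j < i" | "i < j" by linarith
  then show ?case
  proof cases
    case 1
    have "(\<Sum>l<n. (T ^\<^sub>m k) $$ (i, l) * T $$ (l, j)) = (\<Sum>l\<in>{i}. (T ^\<^sub>m k) $$ (i, l) * T $$ (l, j))"
      by (rule sum.mono_neutral_right) (use z 1 Suc.prems in \<open>auto simp: neq_iff\<close>)
    then show ?thesis using e 1 Suc.IH[OF Suc.prems] by simp
  next
    case 2
    have "(\<Sum>l<n. (T ^\<^sub>m k) $$ (i, l) * T $$ (l, j)) = 0"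
      by (rule sum.neutral) (use z 2 in \<open>metis lessThan_iff less_trans not_less_iff_gr_or_eq\<close>)
    then show ?thesis using e 2 by simp
  qed simp
qed

lemma mat_exp_upper_triangular:
  assumes T: "T \<in> carrier_mat n n" "upper_triangular T"
  shows "upper_triangular (mat_exp T)" "i < n \<Longrightarrow> mat_exp T $$ (i, i) = exp (T $$ (i, i))"
proof -
  show "upper_triangular (mat_exp T)"
  proof (rule upper_triangularI)
    fix i j assume "j < i" "i < dim_row (mat_exp T)"
    then have ij: "i < n" "j < n" using T by (auto simp: mat_exp_def)
    have "(\<lambda>k. (T ^\<^sub>m k) $$ (i, j) / fact k) = (\<lambda>_. 0)"
      using upper_triangular_pow[OF T ij] \<open>j < i\<close> by auto
    from mat_exp_sums[OF T(1) ij, unfolded this] show "mat_exp T $$ (i, j) = 0"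
      by (rule sums_unique2[OF _ sums_zero])
  qed
  assume i: "i < n"
  have "(\<lambda>k. (T ^\<^sub>m k) $$ (i, i) / fact k) = (\<lambda>k. T $$ (i, i) ^ k /\<^sub>R fact k)"
    using upper_triangular_pow[OF T i i] by (auto simp: scaleR_conv_of_real field_simps)
  from mat_exp_sums[OF T(1) i i, unfolded this] show "mat_exp T $$ (i, i) = exp (T $$ (i, i))"
    by (rule sums_unique2[OF _ exp_converges])
qed

text \<open>Every complex square matrix is similar to an upper triangular one.\<close>

lemma triangularize:
  assumes A: "(A :: complex mat) \<in> carrier_mat n n"
  obtains T P P' where "T \<in> carrier_mat n n" "P \<in> carrier_mat n n" "P' \<in> carrier_mat n n"
    "upper_triangular T" "P * P' = 1\<^sub>m n" "P' * P = 1\<^sub>m n" "A = P * T * P'"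
proof -
  obtain as where "char_poly A = (\<Prod>a\<leftarrow>as. [:- a, 1:])" using char_poly_factorized[OF A] by blast
  from schur_decomposition_exists[OF A this] obtain T where
    T: "T \<in> carrier_mat n n" "upper_triangular T" "similar_mat A T" by blast
  then obtain P P' where "similar_mat_wit A T P P'" by (auto simp: similar_mat_def)
  from similar_mat_witD2[OF A this] T show ?thesis by (intro that[of T P P']) auto
qed

text \<open>Reduction to a triangular matrix, whose exponential is triangular with exponentials of the diagonal entries.\<close>

lemma det_mat_exp:
  assumes A: "A \<in> carrier_mat n n"
  shows "Determinant.det (mat_exp A) = exp (mtr n A)"
proof -
  obtain T P P' where T: "T \<in> carrier_mat n n" "upper_triangular T"
    and P: "P \<in> carrier_mat n n" "P' \<in> carrier_mat n n" "P * P' = 1\<^sub>m n" "P' * P = 1\<^sub>m n"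
    and APT: "A = P * T * P'"
    using triangularize[OF A] by metis
  have "P' * A = P' * P * (T * P')"
    unfolding APT using P(1,2) T(1) by (simp add: assoc_mult_mat[of _ n n _ n _ n])
  then have "P' * A = T * P'" using P T by simp
  then have "P' * mat_exp A = mat_exp T * P'"
    by (rule mat_exp_intertwine[OF A T(1) P(2)])
  then have "Determinant.det P' * Determinant.det (mat_exp A) = Determinant.det (mat_exp T) * Determinant.det P'"
    using P A T by (metis det_mult mat_exp_carrier)
  moreover have "Determinant.det P * Determinant.det P' = 1"
    using P by (metis det_mult det_one)
  ultimately have "Determinant.det (mat_exp A) = Determinant.det (mat_exp T)"
    by (metis mult.commute mult_cancel_left mult_zero_left zero_neq_one)
  also have "\<dots> = prod_list (diag_mat (mat_exp T))"
    by (rule det_upper_triangular[OF mat_exp_upper_triangular(1)[OF T]]) (use T in auto)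
  also have "\<dots> = (\<Prod>i<n. exp (T $$ (i, i)))"
    using T mat_exp_upper_triangular(2)[OF T] by (auto simp: prod_list_diag_prod mat_exp_def lessThan_atLeast0 intro!: prod.cong)
  also have "\<dots> = exp (mtr n T)" by (simp add: exp_sum mtr_def)
  also have "mtr n T = mtr n A" unfolding APT
    by (rule mtr_similar[OF P(1,2,4) T(1), symmetric])
  finally show ?thesis .
qed

section \<open>The group and the real vector space of generators\<close>

context even_size begin

lemma SU_simps [simp]:
  "carrier (SU n) = SU_carrier n" "mult (SU n) = (*)" "one (SU n) = 1\<^sub>m n"
  by (auto simp: SU_def)

lemma assoc_n:
  assumes "A \<in> carrier_mat n n" "B \<in> carrier_mat n n" "C \<in> carrier_mat n n"
  shows "A * B * C = A * (B * C :: complex mat)"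
  using assms by (rule assoc_mult_mat)

text \<open>Invertibility is redundant: \<open>Q M\<^sup>* Q\<close> is a left inverse.\<close>

lemma SU_carrier_iff:
  "M \<in> SU_carrier n \<longleftrightarrow> M \<in> carrier_mat n n \<and> mat_adjoint M * Q_mat n * M = Q_mat n \<and> Determinant.det M = 1"
proof -
  have "invertible_mat M" if M: "M \<in> carrier_mat n n" and MQ: "mat_adjoint M * Q_mat n * M = Q_mat n"
  proof -
    define K where "K = Q_mat n * mat_adjoint M * Q_mat n"
    have K: "K \<in> carrier_mat n n" using M by (auto simp: K_def intro!: mult_carrier_mat)
    have "K * M = Q_mat n * (mat_adjoint M * Q_mat n * M)"
      unfolding K_def using M mat_adjoint_carrier[OF M] by (simp add: assoc_n mult_carrier_mat[of _ n n _ n])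
    then have KM: "K * M = 1\<^sub>m n" by (simp add: MQ Q_Q)
    then have "M * K = 1\<^sub>m n" by (rule mat_mult_left_right_inverse[OF K M])
    with KM M K show ?thesis
      unfolding invertible_mat_def inverts_mat_def by (intro conjI exI[of _ K]) auto
  qed
  then show ?thesis by (auto simp: SU_carrier_def)
qed

lemma SU_carrier_mat: "M \<in> SU_carrier n \<Longrightarrow> M \<in> carrier_mat n n"
  by (simp add: SU_carrier_iff)

lemma SU_mult_closed:
  assumes "M \<in> SU_carrier n" "N \<in> SU_carrier n"
  shows "M * N \<in> SU_carrier n"
proof -
  have M: "M \<in> carrier_mat n n" "mat_adjoint M * Q_mat n * M = Q_mat n" "Determinant.det M = 1"
    and N: "N \<in> carrier_mat n n" "mat_adjoint N * Q_mat n * N = Q_mat n" "Determinant.det N = 1"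
    using assms by (auto simp: SU_carrier_iff)
  note c = M(1) N(1) mat_adjoint_carrier[OF M(1)] mat_adjoint_carrier[OF N(1)] Q_carrier
  have "mat_adjoint (M * N) * Q_mat n * (M * N) = mat_adjoint N * (mat_adjoint M * Q_mat n * M) * N"
    using c by (simp add: mat_adjoint_mult[of _ n] assoc_n mult_carrier_mat[of _ n n _ n])
  then show ?thesis
    using M N by (auto simp: SU_carrier_iff det_mult[of _ n])
qed

lemma SU_one_closed: "1\<^sub>m n \<in> SU_carrier n"
  by (simp add: SU_carrier_iff right_mult_one_mat[of _ n n] left_mult_one_mat[of _ n n])

lemma SU_inverse_closed:
  assumes M: "M \<in> SU_carrier n" and K: "K \<in> carrier_mat n n" and KM: "K * M = 1\<^sub>m n"
  shows "K \<in> SU_carrier n"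
proof -
  have Mc: "M \<in> carrier_mat n n" "mat_adjoint M * Q_mat n * M = Q_mat n" "Determinant.det M = 1"
    using M by (auto simp: SU_carrier_iff)
  have MK: "M * K = 1\<^sub>m n" using mat_mult_left_right_inverse[OF K Mc(1) KM] .
  note c = Mc(1) K mat_adjoint_carrier[OF Mc(1)] mat_adjoint_carrier[OF K] Q_carrier
  have "mat_adjoint K * Q_mat n * K = mat_adjoint K * (mat_adjoint M * Q_mat n * M) * K"
    by (simp add: Mc)
  also have "\<dots> = (mat_adjoint K * mat_adjoint M) * (Q_mat n * (M * K))"
    using c by (simp add: assoc_n mult_carrier_mat[of _ n n _ n])
  also have "mat_adjoint K * mat_adjoint M = 1\<^sub>m n"
    using mat_adjoint_mult[OF Mc(1) K] MK by simp
  finally have "mat_adjoint K * Q_mat n * K = Q_mat n"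
    by (simp add: MK right_mult_one_mat[OF Q_carrier] left_mult_one_mat[OF Q_carrier])
  moreover have "Determinant.det K = 1"
    using det_mult[OF K Mc(1)] KM Mc by simp
  ultimately show ?thesis using K by (simp add: SU_carrier_iff)
qed

lemma SU_ex_inverse:
  assumes "M \<in> SU_carrier n"
  obtains K where "K \<in> SU_carrier n" "K * M = 1\<^sub>m n"
proof -
  have "invertible_mat M" and M: "M \<in> carrier_mat n n" using assms by (auto simp: SU_carrier_def)
  then obtain K where K: "M * K = 1\<^sub>m n" "K * M = 1\<^sub>m (dim_row K)"
    by (auto simp: invertible_mat_def inverts_mat_def)
  have "K \<in> carrier_mat n n"
    using arg_cong[OF K(1), of dim_col] arg_cong[OF K(2), of dim_col] M by (auto intro!: carrier_matI)
  then show ?thesis using that[of K] SU_inverse_closed[OF assms, of K] K by auto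
qed

lemma group_SU: "group (SU n)"
proof (rule groupI)
  fix x y z assume "x \<in> carrier (SU n)" "y \<in> carrier (SU n)" "z \<in> carrier (SU n)"
  then show "x \<otimes>\<^bsub>SU n\<^esub> y \<otimes>\<^bsub>SU n\<^esub> z = x \<otimes>\<^bsub>SU n\<^esub> (y \<otimes>\<^bsub>SU n\<^esub> z)"
    using SU_carrier_mat by (simp add: assoc_n)
next
  fix x assume x: "x \<in> carrier (SU n)"
  then show "\<one>\<^bsub>SU n\<^esub> \<otimes>\<^bsub>SU n\<^esub> x = x" using SU_carrier_mat[of x] by simp
  obtain K where "K \<in> SU_carrier n" "K * x = 1\<^sub>m n" using SU_ex_inverse x by auto
  then show "\<exists>y\<in>carrier (SU n). y \<otimes>\<^bsub>SU n\<^esub> x = \<one>\<^bsub>SU n\<^esub>" by auto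
qed (auto simp: SU_mult_closed SU_one_closed)

sublocale SU: group "SU n"
  by (rule group_SU)

lemma inv_SU:
  assumes "M \<in> SU_carrier n" "K \<in> carrier_mat n n" "K * M = 1\<^sub>m n"
  shows "inv\<^bsub>SU n\<^esub> M = K"
  using SU.inv_equality[of K M] SU_inverse_closed[OF assms] assms by simp

lemma D_SU: "D_mat n \<in> SU_carrier n"
  using D_Q_D det_D by (simp add: SU_carrier_iff)

lemma D_inv_eq: "D_inv n = Dm"
  unfolding D_inv_def by (rule inv_SU[OF D_SU]) (auto simp: D_Dm)

lemma Dm_SU: "Dm \<in> SU_carrier n"
  using SU_inverse_closed[OF D_SU _ D_Dm(2)] by auto

text \<open>The position \<open>(i, j)\<close> lies in one of the two diagonal blocks.\<close>

definition same_block :: "nat \<Rightarrow> nat \<Rightarrow> bool" where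
  "same_block i j \<longleftrightarrow> (i < n div 2 \<longleftrightarrow> j < n div 2)"

lemma S_set_iff:
  "A \<in> S_set n \<longleftrightarrow> A \<in> carrier_mat n n \<and> (\<forall>i<n. \<forall>j<n. cnj (A $$ (j, i)) = - A $$ (i, j)) \<and>
     (\<forall>i<n. A $$ (i, i) = 0) \<and> (\<forall>i<n. \<forall>j<n. \<not> same_block i j \<longrightarrow> A $$ (i, j) = 0)"
  (is "?L \<longleftrightarrow> ?R")
proof -
  define h where "h = n div 2"
  have n: "n = h + h" using half by (simp add: h_def)
  have skew: "B \<in> skew_zero_diag h \<longleftrightarrow> B \<in> carrier_mat h h \<and> (\<forall>i<h. \<forall>j<h. cnj (B $$ (j, i)) = - B $$ (i, j)) \<and>
    (\<forall>i<h. B $$ (i, i) = 0)" for B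
  proof -
    have "mat_adjoint B = - B \<longleftrightarrow> (\<forall>i<h. \<forall>j<h. cnj (B $$ (j, i)) = - B $$ (i, j))" if "B \<in> carrier_mat h h"
      using that by (auto simp: mat_eq_iff mat_adjoint_entry[OF that])
    then show ?thesis by (auto simp: skew_zero_diag_def)
  qed
  show ?thesis
  proof
    assume ?L
    then obtain A0 A1 where A: "A = four_block_mat A0 (0\<^sub>m h h) (0\<^sub>m h h) A1"
      and S: "A0 \<in> skew_zero_diag h" "A1 \<in> skew_zero_diag h"
      by (auto simp: S_set_def Let_def h_def)
    have c: "A0 \<in> carrier_mat h h" "A1 \<in> carrier_mat h h" using S skew by auto
    have e: "A $$ (i, j) = (if i < h then if j < h then A0 $$ (i, j) else 0
        else if j < h then 0 else A1 $$ (i - h, j - h))" if "i < n" "j < n" for i j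
      using c that unfolding A n by auto
    have "i - h < h" if "i < n" "\<not> i < h" for i using that n by auto
    then show ?R
      using c S[unfolded skew] unfolding same_block_def h_def[symmetric]
      by (intro conjI allI impI) (auto simp: e, auto simp: A n)
  next
    assume R: ?R
    define A0 where "A0 = Matrix.mat h h (\<lambda>(i, j). A $$ (i, j))"
    define A1 where "A1 = Matrix.mat h h (\<lambda>(i, j). A $$ (h + i, h + j))"
    have "A = four_block_mat A0 (0\<^sub>m h h) (0\<^sub>m h h) A1"
    proof (rule eq_matI, goal_cases)
      case (1 i j)
      then have ij: "i < n" "j < n" by (auto simp: A0_def A1_def n)
      then show ?case
        using R n unfolding same_block_def h_def[symmetric]
        by (cases "i < h"; cases "j < h") (auto simp: A0_def A1_def)
    qed (use R in \<open>auto simp: A0_def A1_def n\<close>)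
    moreover have "A0 \<in> skew_zero_diag h" "A1 \<in> skew_zero_diag h"
      unfolding skew using R by (auto simp: A0_def A1_def n)
    ultimately show ?L by (auto simp: S_set_def Let_def h_def)
  qed
qed

lemma S_carrier [simp]: "A \<in> S_set n \<Longrightarrow> A \<in> carrier_mat n n"
  by (simp add: S_set_iff)

lemma S_setD:
  assumes "A \<in> S_set n" "i < n"
  shows "j < n \<Longrightarrow> cnj (A $$ (j, i)) = - A $$ (i, j)" "A $$ (i, i) = 0"
    "j < n \<Longrightarrow> \<not> same_block i j \<Longrightarrow> A $$ (i, j) = 0"
  using assms by (simp_all add: S_set_iff)

lemma S_setI:
  assumes "A \<in> carrier_mat n n" "\<And>i j. i < n \<Longrightarrow> j < n \<Longrightarrow> cnj (A $$ (j, i)) = - A $$ (i, j)"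
    "\<And>i. i < n \<Longrightarrow> A $$ (i, i) = 0" "\<And>i j. i < n \<Longrightarrow> j < n \<Longrightarrow> \<not> same_block i j \<Longrightarrow> A $$ (i, j) = 0"
  shows "A \<in> S_set n"
  using assms by (simp add: S_set_iff)

lemma S_uminus:
  assumes "A \<in> S_set n" shows "- A \<in> S_set n"
  using carrier_matD[OF S_carrier[OF assms]] by (intro S_setI) (simp_all add: S_setD[OF assms] assms)

lemma S_minus:
  assumes "A \<in> S_set n" "B \<in> S_set n" shows "A - B \<in> S_set n"
  using carrier_matD[OF S_carrier[OF assms(1)]] carrier_matD[OF S_carrier[OF assms(2)]]
  by (intro S_setI minus_carrier_mat) (simp_all add: S_setD[OF assms(1)] S_setD[OF assms(2)] assms)

lemma S_scale:
  assumes "A \<in> S_set n" shows "complex_of_real c \<cdot>\<^sub>m A \<in> S_set n"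
  using carrier_matD[OF S_carrier[OF assms]] by (intro S_setI) (simp_all add: S_setD[OF assms] assms)

lemma S_adjoint:
  assumes "A \<in> S_set n" shows "mat_adjoint A = - A"
  by (rule eq_matI)
     (use carrier_matD[OF S_carrier[OF assms]] in \<open>simp_all add: mat_adjoint_entry[OF S_carrier[OF assms]] S_setD[OF assms]\<close>)

lemma S_trace: "A \<in> S_set n \<Longrightarrow> mtr n A = 0"
  by (simp add: S_setD mtr_def)

lemma S_commute:
  assumes "A \<in> S_set n"
  shows "Q_mat n * A = A * Q_mat n"
proof (rule eq_matI)
  fix i j assume "i < dim_row (A * Q_mat n)" "j < dim_col (A * Q_mat n)"
  then have ij: "i < n" "j < n" using S_carrier[OF assms] Q_carrier by auto
  have "sgnQ i * A $$ (i, j) = A $$ (i, j) * sgnQ j"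
    using S_setD(3)[OF assms ij] by (cases "same_block i j") (auto simp: same_block_def sgnQ_def)
  then show "(Q_mat n * A) $$ (i, j) = (A * Q_mat n) $$ (i, j)"
    using ij S_carrier[OF assms] unfolding Q_mat_xmat
    by (simp add: xmat_mult_left_entry xmat_mult_right_entry del: index_mult_mat)
qed (use carrier_matD[OF S_carrier[OF assms]] carrier_matD[OF Q_carrier] in auto)

lemma mat_exp_inverse:
  assumes "A \<in> carrier_mat n n"
  shows "mat_exp (- A) * mat_exp A = 1\<^sub>m n" "mat_exp A * mat_exp (- A) = 1\<^sub>m n"
proof -
  have "- A = (- 1) \<cdot>\<^sub>m A" "1 \<cdot>\<^sub>m A = A" using assms by auto
  then show "mat_exp (- A) * mat_exp A = 1\<^sub>m n" "mat_exp A * mat_exp (- A) = 1\<^sub>m n"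
    using mat_exp_add[OF assms, of "-1" 1] mat_exp_add[OF assms, of 1 "-1"] mat_exp_zero[OF assms]
    by auto
qed

lemma mat_exp_S_commute:
  assumes "A \<in> S_set n"
  shows "Q_mat n * mat_exp A = mat_exp A * Q_mat n"
  using assms S_commute by (intro mat_exp_intertwine[of _ n]) auto

lemma mat_exp_S_SU:
  assumes "A \<in> S_set n"
  shows "mat_exp A \<in> SU_carrier n"
proof -
  have A: "A \<in> carrier_mat n n" "- A \<in> carrier_mat n n" using assms by auto
  note e = mat_exp_carrier[OF A(1)] mat_exp_carrier[OF A(2)]
  have "mat_adjoint (mat_exp A) * Q_mat n * mat_exp A = mat_exp (- A) * (Q_mat n * mat_exp A)"
    using e by (simp add: mat_exp_adjoint[OF A(1)] S_adjoint[OF assms] assoc_n)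
  also have "\<dots> = mat_exp (- A) * mat_exp A * Q_mat n"
    using e by (simp add: mat_exp_S_commute[OF assms] assoc_n)
  also have "\<dots> = Q_mat n" by (simp add: mat_exp_inverse[OF A(1)] left_mult_one_mat[OF Q_carrier])
  finally show ?thesis
    using det_mat_exp[OF A(1)] S_trace[OF assms] e by (simp add: SU_carrier_iff)
qed

lemma exp_fam_carrier [simp, intro]: "A \<in> carrier_mat n n \<Longrightarrow> exp_fam \<epsilon> A \<in> carrier_mat n n"
  by (rule exp_fam_square)

lemma exp_fam_SU: "A \<in> S_set n \<Longrightarrow> exp_fam \<epsilon> A \<in> SU_carrier n"
  unfolding exp_fam_def by (intro mat_exp_S_SU S_scale)

lemma exp_fam_inverse:
  assumes "A \<in> carrier_mat n n"
  shows "exp_fam \<epsilon> (- A) * exp_fam \<epsilon> A = 1\<^sub>m n" "exp_fam \<epsilon> A * exp_fam \<epsilon> (- A) = 1\<^sub>m n"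
proof -
  have "complex_of_real \<epsilon> \<cdot>\<^sub>m (- A) = - (complex_of_real \<epsilon> \<cdot>\<^sub>m A)" using assms by auto
  then show "exp_fam \<epsilon> (- A) * exp_fam \<epsilon> A = 1\<^sub>m n" "exp_fam \<epsilon> A * exp_fam \<epsilon> (- A) = 1\<^sub>m n"
    using mat_exp_inverse[of "complex_of_real \<epsilon> \<cdot>\<^sub>m A"] assms by (auto simp: exp_fam_def)
qed

lemma inv_exp_fam: "A \<in> S_set n \<Longrightarrow> inv\<^bsub>SU n\<^esub> (exp_fam \<epsilon> A) = exp_fam \<epsilon> (- A)"
  by (intro inv_SU exp_fam_SU) (auto simp: exp_fam_inverse)

text \<open>The elements of \<open>X_set n \<epsilon>\<close> and \<open>Z_set n \<epsilon>\<close> with a given generator.\<close>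

definition xf :: "real \<Rightarrow> complex mat \<Rightarrow> complex mat" where
  "xf \<epsilon> A = Dm * exp_fam \<epsilon> A * D_mat n"

definition zf :: "real \<Rightarrow> complex mat \<Rightarrow> complex mat" where
  "zf \<epsilon> A = D_mat n * exp_fam \<epsilon> A * Dm"

lemma xf_carrier [simp, intro]: "A \<in> carrier_mat n n \<Longrightarrow> xf \<epsilon> A \<in> carrier_mat n n"
  and zf_carrier [simp, intro]: "A \<in> carrier_mat n n \<Longrightarrow> zf \<epsilon> A \<in> carrier_mat n n"
  by (auto simp: xf_def zf_def intro!: mult_carrier_mat)

lemma xf_SU: "A \<in> S_set n \<Longrightarrow> xf \<epsilon> A \<in> SU_carrier n" and zf_SU: "A \<in> S_set n \<Longrightarrow> zf \<epsilon> A \<in> SU_carrier n"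
  by (auto simp: xf_def zf_def intro!: SU_mult_closed D_SU Dm_SU exp_fam_SU)

lemma zf_inverse:
  assumes "A \<in> carrier_mat n n"
  shows "zf \<epsilon> (- A) * zf \<epsilon> A = 1\<^sub>m n"
proof -
  note c = D_carrier exp_fam_carrier[OF assms, of \<epsilon>] exp_fam_carrier[of "- A" \<epsilon>] assms
  have "zf \<epsilon> (- A) * zf \<epsilon> A = D_mat n * exp_fam \<epsilon> (- A) * ((Dm * D_mat n) * (exp_fam \<epsilon> A * Dm))"
    unfolding zf_def using c by (simp add: assoc_n mult_carrier_mat[of _ n n _ n])
  also have "\<dots> = D_mat n * ((exp_fam \<epsilon> (- A) * exp_fam \<epsilon> A) * Dm)"
    unfolding D_Dm using c by (simp add: assoc_n mult_carrier_mat[of _ n n _ n] left_mult_one_mat[of _ n n])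
  finally show ?thesis by (simp add: exp_fam_inverse assms D_Dm left_mult_one_mat[OF D_carrier(2)])
qed

lemma inv_zf: "A \<in> S_set n \<Longrightarrow> inv\<^bsub>SU n\<^esub> (zf \<epsilon> A) = zf \<epsilon> (- A)"
  by (intro inv_SU zf_SU) (auto simp: zf_inverse)

text \<open>The positions above the diagonal in the two diagonal blocks; the entries there are free coordinates
  on the real vector space \<open>S_set n\<close>.\<close>

definition upos :: "(nat \<times> nat) set" where
  "upos = {(i, j). i < j \<and> j < n \<and> same_block i j}"

text \<open>The element of \<open>S_set n\<close> with prescribed entries at the positions \<open>upos\<close>.\<close>

definition skew_of :: "(nat \<times> nat \<Rightarrow> complex) \<Rightarrow> complex mat" where
  "skew_of w = Matrix.mat n n (\<lambda>(i, j). if (i, j) \<in> upos then w (i, j)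
     else if (j, i) \<in> upos then - cnj (w (j, i)) else 0)"

lemma upos_bounds: "(i, j) \<in> upos \<Longrightarrow> i < n" "(i, j) \<in> upos \<Longrightarrow> j < n" "(i, j) \<in> upos \<Longrightarrow> i \<noteq> j"
  "(i, j) \<in> upos \<Longrightarrow> same_block i j" "(i, j) \<in> upos \<Longrightarrow> (j, i) \<notin> upos"
  by (auto simp: upos_def)

lemma skew_of_S: "skew_of w \<in> S_set n"
  by (rule S_setI) (auto simp: skew_of_def upos_def same_block_def)

lemma skew_of_entry: "(i, j) \<in> upos \<Longrightarrow> skew_of w $$ (i, j) = w (i, j)"
  using upos_bounds[of i j] by (simp add: skew_of_def)

lemma S_eq_skew_of:
  assumes "A \<in> S_set n"
  shows "A = skew_of (\<lambda>e. A $$ e)"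
proof (rule eq_matI)
  fix i j assume "i < dim_row (skew_of (\<lambda>e. A $$ e))" "j < dim_col (skew_of (\<lambda>e. A $$ e))"
  then have ij: "i < n" "j < n" by (auto simp: skew_of_def)
  consider "i = j" | "i < j" "same_block i j" | "j < i" "same_block j i" | "\<not> same_block i j" "i \<noteq> j"
    unfolding same_block_def by linarith
  then show "A $$ (i, j) = skew_of (\<lambda>e. A $$ e) $$ (i, j)"
  proof cases
    case 3
    then have "cnj (A $$ (j, i)) = - A $$ (i, j)" using assms ij by (simp add: S_setD)
    then show ?thesis using 3 ij by (auto simp: skew_of_def upos_def)
  qed (use assms ij in \<open>auto simp: skew_of_def upos_def S_setD same_block_def\<close>)
qed (use carrier_matD[OF S_carrier[OF assms]] in \<open>auto simp: skew_of_def\<close>)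

lemma finite_upos [simp]: "finite upos"
  by (rule finite_subset[of _ "{..<n} \<times> {..<n}"]) (auto simp: upos_def)

lemma card_upos: "card upos = d_XZ n"
proof -
  define h where "h = n div 2"
  have n: "n = h + h" using half by (simp add: h_def)
  define T where "T = (SIGMA j:{..<h}. {..<j})"
  have "upos = (\<lambda>(j, i). (i, j)) ` T \<union> (\<lambda>(j, i). (h + i, h + j)) ` T"
  proof (rule Set.set_eqI)
    fix e :: "nat \<times> nat"
    obtain i j where e: "e = (i, j)" by (cases e)
    have "(i, j) \<in> upos \<longleftrightarrow> (i, j) \<in> (\<lambda>(j, i). (i, j)) ` T \<union> (\<lambda>(j, i). (h + i, h + j)) ` T"
    proof
      assume "(i, j) \<in> upos"
      then have ij: "i < j" "j < n" "i < h \<longleftrightarrow> j < h" by (auto simp: upos_def same_block_def h_def)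
      show "(i, j) \<in> (\<lambda>(j, i). (i, j)) ` T \<union> (\<lambda>(j, i). (h + i, h + j)) ` T"
      proof (cases "i < h")
        case True
        then have "(j, i) \<in> T" using ij by (auto simp: T_def)
        then show ?thesis by (intro UnI1 image_eqI[of _ _ "(j, i)"]) simp_all
      next
        case False
        then have "(j - h, i - h) \<in> T" "(i, j) = (h + (i - h), h + (j - h))"
          using ij False n by (auto simp: T_def)
        then show ?thesis by (intro UnI2 image_eqI[of _ _ "(j - h, i - h)"]) simp_all
      qed
    next
      assume "(i, j) \<in> (\<lambda>(j, i). (i, j)) ` T \<union> (\<lambda>(j, i). (h + i, h + j)) ` T"
      then have "i < j" "j < h + h" "i < h \<longleftrightarrow> j < h" by (auto simp: T_def)
      then have "i < j" "j < n" "i < h \<longleftrightarrow> j < h" by (simp_all only: n)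
      then show "(i, j) \<in> upos" by (simp add: upos_def same_block_def h_def)
    qed
    then show "e \<in> upos \<longleftrightarrow> e \<in> (\<lambda>(j, i). (i, j)) ` T \<union> (\<lambda>(j, i). (h + i, h + j)) ` T"
      by (simp only: e)
  qed
  moreover have "(\<lambda>(j, i). (i, j)) ` T \<inter> (\<lambda>(j, i). (h + i, h + j)) ` T = {}"
    by (auto simp: T_def)
  moreover have "finite T" by (auto simp: T_def)
  ultimately have "card upos = card ((\<lambda>(j, i). (i, j)) ` T) + card ((\<lambda>(j, i). (h + i, h + j)) ` T)"
    by (simp add: card_Un_disjoint)
  also have "card ((\<lambda>(j, i). (i, j)) ` T) = card T" by (rule card_image) (auto simp: inj_on_def)
  also have "card ((\<lambda>(j, i). (h + i, h + j)) ` T) = card T" by (rule card_image) (auto simp: inj_on_def)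
  also have "card T = (\<Sum>j<h. j)" by (simp add: T_def)
  also have "(\<Sum>j<h. j) + (\<Sum>j<h. j) = h * (h - 1)" for h :: nat
  proof (induction h)
    case (Suc h)
    then show ?case by (cases h) (auto simp: algebra_simps)
  qed simp
  also have "h * (h - 1) = d_XZ n"
  proof -
    have "n\<^sup>2 = 4 * (h * h)" by (simp add: n power2_eq_square algebra_simps)
    then show ?thesis by (simp add: d_XZ_def h_def[symmetric] diff_mult_distrib2)
  qed
  finally show ?thesis .
qed

end

section \<open>Families of polynomials with analytic coefficients\<close>

text \<open>Functions of a positive parameter that extend holomorphically to the right half plane.\<close>

definition hol_ext :: "(real \<Rightarrow> complex) \<Rightarrow> bool" where
  "hol_ext f \<longleftrightarrow> (\<exists>F. F holomorphic_on {z. Re z > 0} \<and> (\<forall>\<epsilon>>0. f \<epsilon> = F (complex_of_real \<epsilon>)))"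

lemma hol_ext_const [simp, intro]: "hol_ext (\<lambda>_. c)"
  unfolding hol_ext_def by (rule exI[of _ "\<lambda>_. c"]) auto

lemma hol_ext_add [intro]:
  assumes "hol_ext f" "hol_ext g" shows "hol_ext (\<lambda>\<epsilon>. f \<epsilon> + g \<epsilon>)"
proof -
  obtain F G where "F holomorphic_on {z. Re z > 0}" "\<forall>\<epsilon>>0. f \<epsilon> = F (complex_of_real \<epsilon>)"
    "G holomorphic_on {z. Re z > 0}" "\<forall>\<epsilon>>0. g \<epsilon> = G (complex_of_real \<epsilon>)"
    using assms unfolding hol_ext_def by blast
  then show ?thesis
    unfolding hol_ext_def by (intro exI[of _ "\<lambda>z. F z + G z"] conjI holomorphic_intros) auto
qed

lemma hol_ext_mult [intro]:
  assumes "hol_ext f" "hol_ext g" shows "hol_ext (\<lambda>\<epsilon>. f \<epsilon> * g \<epsilon>)"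
proof -
  obtain F G where "F holomorphic_on {z. Re z > 0}" "\<forall>\<epsilon>>0. f \<epsilon> = F (complex_of_real \<epsilon>)"
    "G holomorphic_on {z. Re z > 0}" "\<forall>\<epsilon>>0. g \<epsilon> = G (complex_of_real \<epsilon>)"
    using assms unfolding hol_ext_def by blast
  then show ?thesis
    unfolding hol_ext_def by (intro exI[of _ "\<lambda>z. F z * G z"] conjI holomorphic_intros) auto
qed

lemma hol_ext_inverse: "hol_ext (\<lambda>\<epsilon>. 1 / complex_of_real \<epsilon>)"
  unfolding hol_ext_def
  by (rule exI[of _ "\<lambda>z. 1 / z"]) (auto intro!: holomorphic_intros)

lemma hol_ext_sum: "(\<And>i. i \<in> I \<Longrightarrow> hol_ext (f i)) \<Longrightarrow> hol_ext (\<lambda>\<epsilon>. \<Sum>i\<in>I. f i \<epsilon>)"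
  by (induction I rule: infinite_finite_induct) auto

lemma hol_ext_real_analytic:
  assumes "hol_ext f" shows "real_analytic_on {0<..<\<alpha>} f"
  unfolding real_analytic_on_def
proof
  fix t :: real assume t: "t \<in> {0<..<\<alpha>}"
  obtain F where F: "F holomorphic_on {z. Re z > 0}" "\<And>\<epsilon>. \<epsilon> > 0 \<Longrightarrow> f \<epsilon> = F (complex_of_real \<epsilon>)"
    using assms unfolding hol_ext_def by blast
  have "ball (complex_of_real t) t \<subseteq> {z. Re z > 0}"
  proof
    fix z assume "z \<in> ball (complex_of_real t) t"
    then have "cmod (complex_of_real t - z) < t" by (simp add: dist_norm)
    then show "z \<in> {z. Re z > 0}" using abs_Re_le_cmod[of "complex_of_real t - z"] by simp
  qed
  then have hol: "F holomorphic_on ball (complex_of_real t) t" using F(1) holomorphic_on_subset by blast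
  show "\<exists>r>0. \<exists>a. \<forall>s\<in>{0<..<\<alpha>}. \<bar>s - t\<bar> < r \<longrightarrow> (\<lambda>k. a k * complex_of_real ((s - t) ^ k)) sums f s"
  proof (intro exI[of _ t] conjI exI[of _ "\<lambda>k. (deriv ^^ k) F (complex_of_real t) / fact k"] ballI impI)
    fix s assume s: "s \<in> {0<..<\<alpha>}" "\<bar>s - t\<bar> < t"
    have "complex_of_real s \<in> ball (complex_of_real t) t"
      using s by (simp add: dist_norm abs_minus_commute flip: of_real_diff)
    from holomorphic_power_series[OF hol this] F(2)[of s] s(1)
    show "(\<lambda>k. (deriv ^^ k) F (complex_of_real t) / fact k * complex_of_real ((s - t) ^ k)) sums f s"
      by simp
  qed (use t in auto)
qed

lemma real_analytic_on_cong:
  assumes "real_analytic_on I f" "\<And>t. t \<in> I \<Longrightarrow> f t = g t"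
  shows "real_analytic_on I g"
  using assms unfolding real_analytic_on_def by metis

lemma hol_ext_mat_exp:
  assumes A: "A \<in> carrier_mat n n" and ij: "i < n" "j < n"
  shows "hol_ext (\<lambda>\<epsilon>. exp_fam \<epsilon> A $$ (i, j))"
proof -
  define F where "F = (\<lambda>z. mat_exp (z \<cdot>\<^sub>m A) $$ (i, j))"
  have sums: "(\<lambda>k. ((A ^\<^sub>m k) $$ (i, j) / fact k) * (z - 0) ^ k) sums F z" for z
    using mat_exp_power_series[OF A ij, of z] by (simp add: F_def)
  have "F field_differentiable at z" for z
  proof -
    have "F holomorphic_on ball 0 (cmod z + 1)"
      by (rule power_series_holomorphic) (rule sums)
    then show ?thesis by (rule holomorphic_on_imp_differentiable_at) auto
  qed
  then have "F holomorphic_on {z. Re z > 0}"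
    by (simp add: field_differentiable_at_within holomorphic_on_def)
  then show ?thesis unfolding hol_ext_def by (intro exI[of _ F]) (simp add: F_def exp_fam_def)
qed

text \<open>Monomials in the matrix entries, their values and their total degrees.\<close>

type_synonym monom = "nat \<times> nat \<Rightarrow>\<^sub>0 nat"

definition mon :: "monom \<Rightarrow> complex mat \<Rightarrow> complex" where
  "mon \<mu> M = (\<Prod>e\<in>Poly_Mapping.keys \<mu>. (M $$ e) ^ Poly_Mapping.lookup \<mu> e)"

definition mdeg :: "monom \<Rightarrow> nat" where
  "mdeg \<mu> = (\<Sum>e\<in>Poly_Mapping.keys \<mu>. Poly_Mapping.lookup \<mu> e)"

lemma mon_superset:
  "finite U \<Longrightarrow> Poly_Mapping.keys \<mu> \<subseteq> U \<Longrightarrow> mon \<mu> M = (\<Prod>e\<in>U. (M $$ e) ^ Poly_Mapping.lookup \<mu> e)"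
  unfolding mon_def by (rule prod.mono_neutral_left) (auto simp: in_keys_iff)

lemma mdeg_superset:
  "finite U \<Longrightarrow> Poly_Mapping.keys \<mu> \<subseteq> U \<Longrightarrow> mdeg \<mu> = (\<Sum>e\<in>U. Poly_Mapping.lookup \<mu> e)"
  unfolding mdeg_def by (rule sum.mono_neutral_left) (auto simp: in_keys_iff)

lemma mon_add: "mon (\<mu> + \<nu>) M = mon \<mu> M * mon \<nu> M"
proof -
  define U where "U = Poly_Mapping.keys \<mu> \<union> Poly_Mapping.keys \<nu>"
  have U: "finite U" "Poly_Mapping.keys \<mu> \<subseteq> U" "Poly_Mapping.keys \<nu> \<subseteq> U" "Poly_Mapping.keys (\<mu> + \<nu>) \<subseteq> U"
    using Poly_Mapping.keys_add[of \<mu> \<nu>] by (auto simp: U_def)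
  show ?thesis
    using U by (simp add: mon_superset[OF U(1)] lookup_add power_add prod.distrib)
qed

lemma mdeg_add: "mdeg (\<mu> + \<nu>) = mdeg \<mu> + mdeg \<nu>"
proof -
  define U where "U = Poly_Mapping.keys \<mu> \<union> Poly_Mapping.keys \<nu>"
  have U: "finite U" "Poly_Mapping.keys \<mu> \<subseteq> U" "Poly_Mapping.keys \<nu> \<subseteq> U" "Poly_Mapping.keys (\<mu> + \<nu>) \<subseteq> U"
    using Poly_Mapping.keys_add[of \<mu> \<nu>] by (auto simp: U_def)
  show ?thesis
    using U by (simp add: mdeg_superset[OF U(1)] lookup_add sum.distrib)
qed

text \<open>A one-parameter family of polynomials is given by a list of monomials with coefficient functions.
  \<open>fam_terms\<close> bounds the degree and constrains the coefficients; \<open>fam_eval\<close> is the value.\<close>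

definition fam_terms :: "nat \<Rightarrow> nat \<Rightarrow> (monom \<times> (real \<Rightarrow> complex)) list \<Rightarrow> bool" where
  "fam_terms n k L \<longleftrightarrow> (\<forall>(\<mu>, a)\<in>set L. Poly_Mapping.keys \<mu> \<subseteq> {..<n} \<times> {..<n} \<and> mdeg \<mu> \<le> k \<and> hol_ext a)"

definition fam_eval :: "(monom \<times> (real \<Rightarrow> complex)) list \<Rightarrow> real \<Rightarrow> complex mat \<Rightarrow> complex" where
  "fam_eval L \<epsilon> M = (\<Sum>(\<mu>, a)\<leftarrow>L. a \<epsilon> * mon \<mu> M)"

text \<open>Functions of \<open>(\<epsilon>, M)\<close> that agree, for \<open>\<epsilon> > 0\<close> and square \<open>M\<close>, with a family of polynomials in the
  entries of \<open>M\<close> of degree at most \<open>k\<close>. Unlike the families themselves, this class is visibly closed under ring operations.\<close>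

definition pfam :: "nat \<Rightarrow> nat \<Rightarrow> (real \<Rightarrow> complex mat \<Rightarrow> complex) \<Rightarrow> bool" where
  "pfam n k F \<longleftrightarrow> (\<exists>L. fam_terms n k L \<and> (\<forall>\<epsilon>>0. \<forall>M\<in>carrier_mat n n. F \<epsilon> M = fam_eval L \<epsilon> M))"

lemma pfamI:
  assumes "fam_terms n k L" "\<And>\<epsilon> M. \<epsilon> > 0 \<Longrightarrow> M \<in> carrier_mat n n \<Longrightarrow> F \<epsilon> M = fam_eval L \<epsilon> M"
  shows "pfam n k F"
  using assms unfolding pfam_def by blast

lemma pfam_cong:
  assumes "pfam n k F" "\<And>\<epsilon> M. \<epsilon> > 0 \<Longrightarrow> M \<in> carrier_mat n n \<Longrightarrow> G \<epsilon> M = F \<epsilon> M"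
  shows "pfam n k G"
  using assms unfolding pfam_def by metis

lemma fam_terms_mono:
  assumes "fam_terms n k L" "k \<le> l" shows "fam_terms n l L"
  unfolding fam_terms_def
proof (rule ballI, clarify)
  fix \<mu> a assume "(\<mu>, a) \<in> set L"
  then have "Poly_Mapping.keys \<mu> \<subseteq> {..<n} \<times> {..<n} \<and> mdeg \<mu> \<le> k \<and> hol_ext a"
    using assms(1) unfolding fam_terms_def by blast
  then show "Poly_Mapping.keys \<mu> \<subseteq> {..<n} \<times> {..<n} \<and> mdeg \<mu> \<le> l \<and> hol_ext a"
    using assms(2) order_trans by blast
qed

lemma pfam_mono: "pfam n k F \<Longrightarrow> k \<le> l \<Longrightarrow> pfam n l F"
  unfolding pfam_def using fam_terms_mono by blast

lemma pfam_const: "hol_ext a \<Longrightarrow> pfam n k (\<lambda>\<epsilon> M. a \<epsilon>)"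
  by (rule pfamI[of _ _ "[(0, a)]"]) (auto simp: fam_terms_def fam_eval_def mon_def mdeg_def)

lemma pfam_entry: "i < n \<Longrightarrow> j < n \<Longrightarrow> k \<ge> 1 \<Longrightarrow> pfam n k (\<lambda>\<epsilon> M. M $$ (i, j))"
  by (rule pfamI[of _ _ "[(Poly_Mapping.single (i, j) 1, \<lambda>_. 1)]"])
     (auto simp: fam_terms_def fam_eval_def mon_def mdeg_def)

lemma pfam_add:
  assumes "pfam n k F" "pfam n k G"
  shows "pfam n k (\<lambda>\<epsilon> M. F \<epsilon> M + G \<epsilon> M)"
proof -
  obtain L1 L2 where "fam_terms n k L1" "\<And>\<epsilon> M. \<epsilon> > 0 \<Longrightarrow> M \<in> carrier_mat n n \<Longrightarrow> F \<epsilon> M = fam_eval L1 \<epsilon> M"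
    "fam_terms n k L2" "\<And>\<epsilon> M. \<epsilon> > 0 \<Longrightarrow> M \<in> carrier_mat n n \<Longrightarrow> G \<epsilon> M = fam_eval L2 \<epsilon> M"
    using assms unfolding pfam_def by metis
  then show ?thesis
    by (intro pfamI[of _ _ "L1 @ L2"]) (auto simp: fam_terms_def fam_eval_def)
qed

lemma fam_eval_mult:
  "fam_eval (concat (map (\<lambda>(\<mu>, a). map (\<lambda>(\<nu>, b). (\<mu> + \<nu>, \<lambda>\<epsilon>. a \<epsilon> * b \<epsilon>)) L2) L1)) \<epsilon> M =
     fam_eval L1 \<epsilon> M * fam_eval L2 \<epsilon> M"
proof (induction L1)
  case (Cons x L1)
  obtain \<mu> a where x: "x = (\<mu>, a)" by (cases x)
  have "fam_eval (map (\<lambda>(\<nu>, b). (\<mu> + \<nu>, \<lambda>\<epsilon>. a \<epsilon> * b \<epsilon>)) L2) \<epsilon> M = a \<epsilon> * mon \<mu> M * fam_eval L2 \<epsilon> M"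
    by (induction L2) (auto simp: fam_eval_def mon_add algebra_simps)
  then show ?case using Cons by (simp add: x fam_eval_def algebra_simps)
qed (simp add: fam_eval_def)

lemma pfam_mult:
  assumes "pfam n k F" "pfam n l G"
  shows "pfam n (k + l) (\<lambda>\<epsilon> M. F \<epsilon> M * G \<epsilon> M)"
proof -
  obtain L1 L2 where L: "fam_terms n k L1" "\<And>\<epsilon> M. \<epsilon> > 0 \<Longrightarrow> M \<in> carrier_mat n n \<Longrightarrow> F \<epsilon> M = fam_eval L1 \<epsilon> M"
    "fam_terms n l L2" "\<And>\<epsilon> M. \<epsilon> > 0 \<Longrightarrow> M \<in> carrier_mat n n \<Longrightarrow> G \<epsilon> M = fam_eval L2 \<epsilon> M"
    using assms unfolding pfam_def by metis
  show ?thesis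
  proof (rule pfamI[of _ _ "concat (map (\<lambda>(\<mu>, a). map (\<lambda>(\<nu>, b). (\<mu> + \<nu>, \<lambda>\<epsilon>. a \<epsilon> * b \<epsilon>)) L2) L1)"])
    show "fam_terms n (k + l) (concat (map (\<lambda>(\<mu>, a). map (\<lambda>(\<nu>, b). (\<mu> + \<nu>, \<lambda>\<epsilon>. a \<epsilon> * b \<epsilon>)) L2) L1))"
      unfolding fam_terms_def
    proof clarify
      fix \<kappa> c assume "(\<kappa>, c) \<in> set (concat (map (\<lambda>(\<mu>, a). map (\<lambda>(\<nu>, b). (\<mu> + \<nu>, \<lambda>\<epsilon>. a \<epsilon> * b \<epsilon>)) L2) L1))"
      then obtain \<mu> a \<nu> b where 1: "(\<mu>, a) \<in> set L1" "(\<nu>, b) \<in> set L2" "\<kappa> = \<mu> + \<nu>" "c = (\<lambda>\<epsilon>. a \<epsilon> * b \<epsilon>)"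
        by auto
      then have "Poly_Mapping.keys \<mu> \<subseteq> {..<n} \<times> {..<n}" "mdeg \<mu> \<le> k" "hol_ext a"
        "Poly_Mapping.keys \<nu> \<subseteq> {..<n} \<times> {..<n}" "mdeg \<nu> \<le> l" "hol_ext b"
        using L(1,3) by (auto simp: fam_terms_def)
      then show "Poly_Mapping.keys \<kappa> \<subseteq> {..<n} \<times> {..<n} \<and> mdeg \<kappa> \<le> k + l \<and> hol_ext c"
        using 1 Poly_Mapping.keys_add[of \<mu> \<nu>] by (auto simp: mdeg_add)
    qed
  qed (simp add: fam_eval_mult L)
qed

lemma pfam_cmult: "hol_ext a \<Longrightarrow> pfam n k F \<Longrightarrow> pfam n k (\<lambda>\<epsilon> M. a \<epsilon> * F \<epsilon> M)"
  using pfam_mult[OF pfam_const[of a n 0], of k F] by simp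

lemma pfam_minus: "pfam n k F \<Longrightarrow> pfam n k G \<Longrightarrow> pfam n k (\<lambda>\<epsilon> M. F \<epsilon> M - G \<epsilon> M)"
  using pfam_add[of n k F "\<lambda>\<epsilon> M. (-1) * G \<epsilon> M"] pfam_cmult[of "\<lambda>_. -1" n k G] by simp

lemma pfam_sum: "(\<And>i. i \<in> I \<Longrightarrow> pfam n k (F i)) \<Longrightarrow> pfam n k (\<lambda>\<epsilon> M. \<Sum>i\<in>I. F i \<epsilon> M)"
proof (induction I rule: infinite_finite_induct)
  case (insert x I)
  then show ?case using pfam_add[of n k "F x" "\<lambda>\<epsilon> M. \<Sum>i\<in>I. F i \<epsilon> M"] by simp
qed (auto intro: pfam_const[of "\<lambda>_. 0"])

lemma pfam_prod: "(\<And>i. i \<in> I \<Longrightarrow> pfam n k (F i)) \<Longrightarrow> pfam n (card I * k) (\<lambda>\<epsilon> M. \<Prod>i\<in>I. F i \<epsilon> M)"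
proof (induction I rule: infinite_finite_induct)
  case (insert x I)
  then show ?case using pfam_mult[of n k "F x" "card I * k" "\<lambda>\<epsilon> M. \<Prod>i\<in>I. F i \<epsilon> M"] by simp
qed (auto intro: pfam_const[of "\<lambda>_. 1"])

lemma pfam_mat_mult:
  assumes "A \<in> carrier_mat n n" "B \<in> carrier_mat n n" "i < n" "j < n"
    and G: "\<And>k l. k < n \<Longrightarrow> l < n \<Longrightarrow> pfam n d (\<lambda>\<epsilon> M. G \<epsilon> M $$ (k, l))"
    "\<And>\<epsilon> M. M \<in> carrier_mat n n \<Longrightarrow> G \<epsilon> M \<in> carrier_mat n n"
  shows "pfam n d (\<lambda>\<epsilon> M. (A * G \<epsilon> M * B) $$ (i, j))"
proof (rule pfam_cong)
  show "pfam n d (\<lambda>\<epsilon> M. \<Sum>l<n. B $$ (l, j) * (\<Sum>k<n. A $$ (i, k) * G \<epsilon> M $$ (k, l)))"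
    using assms by (intro pfam_sum pfam_cmult[of "\<lambda>_. c" for c] hol_ext_const) auto
  show "(A * G \<epsilon> M * B) $$ (i, j) = (\<Sum>l<n. B $$ (l, j) * (\<Sum>k<n. A $$ (i, k) * G \<epsilon> M $$ (k, l)))"
    if "M \<in> carrier_mat n n" for \<epsilon> M
    by (rule mult_entry3) (use assms that in auto)
qed

lemma pfam_entry_mult:
  assumes "A \<in> carrier_mat n n" "B \<in> carrier_mat n n" "i < n" "j < n"
  shows "pfam n 1 (\<lambda>\<epsilon> M. (A * M * B) $$ (i, j))"
  by (rule pfam_mat_mult[where G = "\<lambda>\<epsilon> M. M"]) (use assms in \<open>auto intro: pfam_entry\<close>)

lemma eval_superset:
  assumes "finite B" "Poly_Mapping.keys p \<subseteq> B"
  shows "eval_mat_poly p M = (\<Sum>\<mu>\<in>B. Poly_Mapping.lookup p \<mu> * mon \<mu> M)"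
proof -
  have "eval_mat_poly p M = (\<Sum>\<mu>\<in>Poly_Mapping.keys p. Poly_Mapping.lookup p \<mu> * mon \<mu> M)"
    by (simp add: eval_mat_poly_def mon_def)
  also have "\<dots> = (\<Sum>\<mu>\<in>B. Poly_Mapping.lookup p \<mu> * mon \<mu> M)"
    using assms by (intro sum.mono_neutral_left) (auto simp: in_keys_iff)
  finally show ?thesis .
qed

lemma eval_add: "eval_mat_poly (p + q) M = eval_mat_poly p M + eval_mat_poly q M"
proof -
  define U where "U = Poly_Mapping.keys p \<union> Poly_Mapping.keys q"
  have U: "finite U" "Poly_Mapping.keys p \<subseteq> U" "Poly_Mapping.keys q \<subseteq> U" "Poly_Mapping.keys (p + q) \<subseteq> U"
    using Poly_Mapping.keys_add[of p q] by (auto simp: U_def)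
  show ?thesis
    using U by (simp add: eval_superset[OF U(1)] lookup_add sum.distrib algebra_simps)
qed

lemma eval_single: "eval_mat_poly (Poly_Mapping.single \<mu> c) M = c * mon \<mu> M"
  using eval_superset[of "{\<mu>}" "Poly_Mapping.single \<mu> c" M] by auto

text \<open>Every function in the class is the evaluation of a family of polynomials in the sense of
  \<open>poly_family\<close>, on every parameter interval.\<close>

lemma pfam_poly_family:
  assumes "pfam n k F"
  shows "\<exists>p. (\<forall>\<alpha>. poly_family n k \<alpha> p) \<and> (\<forall>\<epsilon>. p \<epsilon> \<in> mat_polys n) \<and>
    (\<forall>\<epsilon>>0. \<forall>M\<in>carrier_mat n n. eval_mat_poly (p \<epsilon>) M = F \<epsilon> M)"
proof -
  obtain L where L: "fam_terms n k L" "\<And>\<epsilon> M. \<epsilon> > 0 \<Longrightarrow> M \<in> carrier_mat n n \<Longrightarrow> F \<epsilon> M = fam_eval L \<epsilon> M"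
    using assms unfolding pfam_def by blast
  define P :: "(monom \<times> (real \<Rightarrow> complex)) list \<Rightarrow> real \<Rightarrow> mat_poly"
    where "P = (\<lambda>L \<epsilon>. \<Sum>(\<mu>, a)\<leftarrow>L. Poly_Mapping.single \<mu> (a \<epsilon>))"
  have P_Cons: "P (x # L) \<epsilon> = Poly_Mapping.single (fst x) (snd x \<epsilon>) + P L \<epsilon>" for x L \<epsilon>
    by (simp add: P_def case_prod_beta)
  have ev: "eval_mat_poly (P L \<epsilon>) M = fam_eval L \<epsilon> M" for L \<epsilon> M
  proof (induction L)
    case (Cons x L)
    then show ?case unfolding P_Cons by (simp add: eval_add eval_single fam_eval_def case_prod_beta)
  qed (simp add: P_def fam_eval_def eval_mat_poly_def)
  have keys: "Poly_Mapping.keys (P L \<epsilon>) \<subseteq> fst ` set L" for L \<epsilon>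
  proof (induction L)
    case (Cons x L)
    have "Poly_Mapping.keys (P (x # L) \<epsilon>) \<subseteq> {fst x} \<union> Poly_Mapping.keys (P L \<epsilon>)"
      unfolding P_Cons using Poly_Mapping.keys_add[of "Poly_Mapping.single (fst x) (snd x \<epsilon>)" "P L \<epsilon>"]
      by (auto split: if_splits)
    then show ?case using Cons by auto
  qed (simp add: P_def)
  have hol: "hol_ext (\<lambda>\<epsilon>. Poly_Mapping.lookup (P L \<epsilon>) \<mu>)" if "fam_terms n k L" for L \<mu>
    using that
  proof (induction L)
    case (Cons x L)
    have "hol_ext (\<lambda>\<epsilon>. Poly_Mapping.lookup (Poly_Mapping.single (fst x) (snd x \<epsilon>)) \<mu>)"
      using Cons.prems by (cases "\<mu> = fst x") (auto simp: fam_terms_def lookup_single)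
    moreover have "hol_ext (\<lambda>\<epsilon>. Poly_Mapping.lookup (P L \<epsilon>) \<mu>)"
      using Cons by (auto simp: fam_terms_def)
    ultimately show ?case unfolding P_Cons lookup_add by (rule hol_ext_add)
  qed (simp add: P_def)
  have mp: "P L \<epsilon> \<in> mat_polys n" for \<epsilon>
    using keys[of L \<epsilon>] L(1) by (fastforce simp: mat_polys_def fam_terms_def)
  have "poly_degree_le (P L \<epsilon>) k" for \<epsilon>
    using keys[of L \<epsilon>] L(1) by (fastforce simp: poly_degree_le_def fam_terms_def simp flip: mdeg_def)
  then have "poly_family n k \<alpha> (P L)" for \<alpha>
    using mp hol[OF L(1)] hol_ext_real_analytic by (simp add: poly_family_def)
  then show ?thesis using mp ev L(2) by (intro exI[of _ "P L"]) simp
qed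

text \<open>Functions with values in univariate polynomials, coefficientwise.\<close>

definition cfam :: "nat \<Rightarrow> nat \<Rightarrow> (complex mat \<Rightarrow> complex poly) \<Rightarrow> bool" where
  "cfam n k F \<longleftrightarrow> (\<forall>r. pfam n k (\<lambda>\<epsilon> M. coeff (F M) r))"

lemma cfam_const: "cfam n k (\<lambda>_. c)"
  by (auto simp: cfam_def intro: pfam_const)

lemma cfam_mult:
  assumes "cfam n k F" "cfam n l G"
  shows "cfam n (k + l) (\<lambda>M. F M * G M)"
  unfolding cfam_def coeff_mult
  using assms by (auto simp: cfam_def intro!: pfam_sum pfam_mult)

lemma cfam_sum: "(\<And>i. i \<in> I \<Longrightarrow> cfam n k (F i)) \<Longrightarrow> cfam n k (\<lambda>M. \<Sum>i\<in>I. F i M)"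
  unfolding cfam_def coeff_sum by (auto intro!: pfam_sum)

lemma cfam_prod: "(\<And>i. i \<in> I \<Longrightarrow> cfam n k (F i)) \<Longrightarrow> cfam n (card I * k) (\<lambda>M. \<Prod>i\<in>I. F i M)"
proof (induction I rule: infinite_finite_induct)
  case (insert x I)
  then show ?case using cfam_mult[of n k "F x" "card I * k" "\<lambda>M. \<Prod>i\<in>I. F i M"] by simp
qed (auto intro: cfam_const)

lemma cfam_det:
  assumes "\<And>i j. i < n \<Longrightarrow> j < n \<Longrightarrow> cfam n 1 (\<lambda>M. P M $$ (i, j))"
    and P: "\<And>M. P M \<in> carrier_mat n n"
  shows "cfam n n (\<lambda>M. Determinant.det (P M))"
proof -
  have "cfam n n (\<lambda>M. \<Sum>p\<in>{p. p permutes {0..<n}}. signof p * (\<Prod>i\<in>{0..<n}. P M $$ (i, p i)))"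
  proof (rule cfam_sum)
    fix p assume "p \<in> {p. p permutes {0..<n}}"
    then have p: "p i < n" if "i < n" for i using permutes_in_image[of p "{0..<n}" i] that by auto
    have "cfam n (card {0..<n} * 1) (\<lambda>M. \<Prod>i\<in>{0..<n}. P M $$ (i, p i))"
      by (rule cfam_prod) (use p assms(1) in auto)
    then show "cfam n n (\<lambda>M. signof p * (\<Prod>i\<in>{0..<n}. P M $$ (i, p i)))"
      using cfam_mult[OF cfam_const[of n 0 "signof p"], of n "\<lambda>M. \<Prod>i\<in>{0..<n}. P M $$ (i, p i)"] by simp
  qed
  then show ?thesis by (simp add: det_def'[OF P])
qed

section \<open>An invariant polynomial\<close>

text \<open>The two leading coefficients of a product of monic linear factors.\<close>

lemma coeff_prod_linear:
  fixes as :: "complex list"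
  shows "coeff (\<Prod>a\<leftarrow>as. [:- a, 1:]) (length as) = 1 \<and> (\<forall>r>length as. coeff (\<Prod>a\<leftarrow>as. [:- a, 1:]) r = 0) \<and>
     (as \<noteq> [] \<longrightarrow> coeff (\<Prod>a\<leftarrow>as. [:- a, 1:]) (length as - 1) = - sum_list as)"
proof (induction as)
  case (Cons a as)
  define p where "p = (\<Prod>a\<leftarrow>as. [:- a, 1:])"
  have IH: "coeff p (length as) = 1" "\<And>r. r > length as \<Longrightarrow> coeff p r = 0"
    "as \<noteq> [] \<Longrightarrow> coeff p (length as - 1) = - sum_list as"
    using Cons by (auto simp: p_def)
  have c: "coeff ([:- a, 1:] * p) r = - a * coeff p r + (if r = 0 then 0 else coeff p (r - 1))" for r
    by (cases r) auto
  have P: "(\<Prod>a\<leftarrow>a # as. [:- a, 1:]) = [:- a, 1:] * p" by (simp add: p_def)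
  show ?case
    unfolding P c using IH by (cases "as = []") auto
qed simp

lemma char_poly_trace:
  assumes A: "A \<in> carrier_mat n n" and n: "n > 0"
  shows "coeff (char_poly A) (n - 1) = - mtr n A"
proof -
  obtain T P P' where T: "T \<in> carrier_mat n n" "upper_triangular T"
    and P: "P \<in> carrier_mat n n" "P' \<in> carrier_mat n n" "P * P' = 1\<^sub>m n" "P' * P = 1\<^sub>m n"
    and APT: "A = P * T * P'"
    using triangularize[OF A] by metis
  have "similar_mat A T"
    using similar_mat_witI[OF P(3,4) APT A T(1) P(1,2)] by (auto simp: similar_mat_def)
  then have cp: "char_poly A = (\<Prod>a\<leftarrow>diag_mat T. [:- a, 1:])"
    using char_poly_similar char_poly_upper_triangular[OF T] by metis
  have len: "length (diag_mat T) = n" using T by (simp add: diag_mat_def)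
  then have "coeff (char_poly A) (n - 1) = - sum_list (diag_mat T)"
    unfolding cp using coeff_prod_linear[of "diag_mat T"] n by auto
  also have "sum_list (diag_mat T) = mtr n T"
    using T by (simp add: diag_mat_def mtr_def lessThan_atLeast0 interv_sum_list_conv_sum_set_nat)
  also have "mtr n T = mtr n A" unfolding APT
    by (rule mtr_similar[OF P(1,2,4) T(1), symmetric])
  finally show ?thesis .
qed

text \<open>A matrix of constants, seen as a matrix of polynomials.\<close>

abbreviation Cm :: "complex mat \<Rightarrow> complex poly mat" where
  "Cm \<equiv> map_mat (\<lambda>a. [:a:])"

lemma det_Cm: "Determinant.det (Cm A) = [:Determinant.det A:]"
proof -
  interpret comm_ring_hom "\<lambda>a :: complex. [:a:]" by unfold_locales auto
  show ?thesis by (rule hom_det)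
qed

lemma sum_pCons2: "(\<Sum>k\<in>I. [:f k, g k:]) = [:\<Sum>k\<in>I. f k, \<Sum>k\<in>I. g k:]"
  by (induction I rule: infinite_finite_induct) auto

context even_size begin

lemma closed_n [intro]: "A \<in> carrier_mat n n \<Longrightarrow> B \<in> carrier_mat n n \<Longrightarrow> A * B \<in> carrier_mat n n"
  by (rule mult_carrier_mat)

lemma one_left_n [simp]: "(A :: complex mat) \<in> carrier_mat n n \<Longrightarrow> 1\<^sub>m n * A = A"
  and one_right_n [simp]: "(A :: complex mat) \<in> carrier_mat n n \<Longrightarrow> A * 1\<^sub>m n = A"
  by auto

text \<open>The matrix \<open>t N - Q N Q\<close>, with entries in the polynomials in \<open>t\<close>.\<close>

definition pencil :: "complex mat \<Rightarrow> complex poly mat" where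
  "pencil N = Matrix.mat n n (\<lambda>(i, j). [:- (Q_mat n * N * Q_mat n) $$ (i, j), N $$ (i, j):])"

lemma pencil_carrier [simp, intro]: "pencil N \<in> carrier_mat n n"
  by (simp add: pencil_def)

lemma pencil_left:
  assumes k: "k \<in> carrier_mat n n" and N: "N \<in> carrier_mat n n" and kQ: "Q_mat n * k = k * Q_mat n"
  shows "pencil (k * N) = Cm k * pencil N"
proof (rule eq_matI)
  fix i j assume "i < dim_row (Cm k * pencil N)" "j < dim_col (Cm k * pencil N)"
  then have ij: "i < n" "j < n" using k by (auto simp: pencil_def)
  define B where "B = Q_mat n * N * Q_mat n"
  have B: "B \<in> carrier_mat n n" using N by (auto simp: B_def)
  have "Q_mat n * (k * N) * Q_mat n = (Q_mat n * k) * (N * Q_mat n)"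
    using k N by (simp add: assoc_n closed_n)
  also have "\<dots> = k * B" unfolding kQ B_def using k N by (simp add: assoc_n closed_n)
  finally have QQ: "Q_mat n * (k * N) * Q_mat n = k * B" .
  have "(Cm k * pencil N) $$ (i, j) = (\<Sum>l<n. Cm k $$ (i, l) * pencil N $$ (l, j))"
    by (rule mult_entry) (use k ij in auto)
  also have "\<dots> = (\<Sum>l<n. [:- (k $$ (i, l) * B $$ (l, j)), k $$ (i, l) * N $$ (l, j):])"
    using k ij by (intro sum.cong) (auto simp: pencil_def B_def)
  also have "\<dots> = [:- (k * B) $$ (i, j), (k * N) $$ (i, j):]"
    using mult_entry[OF k B ij] mult_entry[OF k N ij] by (simp add: sum_pCons2 sum_negf)
  also have "\<dots> = pencil (k * N) $$ (i, j)"
    using ij unfolding pencil_def QQ by simp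
  finally show "pencil (k * N) $$ (i, j) = (Cm k * pencil N) $$ (i, j)" by simp
qed (use k in \<open>auto simp: pencil_def\<close>)

lemma pencil_right:
  assumes k: "k \<in> carrier_mat n n" and N: "N \<in> carrier_mat n n" and kQ: "Q_mat n * k = k * Q_mat n"
  shows "pencil (N * k) = pencil N * Cm k"
proof (rule eq_matI)
  fix i j assume "i < dim_row (pencil N * Cm k)" "j < dim_col (pencil N * Cm k)"
  then have ij: "i < n" "j < n" using k by (auto simp: pencil_def)
  define B where "B = Q_mat n * N * Q_mat n"
  have B: "B \<in> carrier_mat n n" using N by (auto simp: B_def)
  have "Q_mat n * (N * k) * Q_mat n = (Q_mat n * N) * (k * Q_mat n)"
    using k N by (simp add: assoc_n closed_n)
  also have "\<dots> = B * k" unfolding kQ[symmetric] B_def using k N by (simp add: assoc_n closed_n)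
  finally have QQ: "Q_mat n * (N * k) * Q_mat n = B * k" .
  have "(pencil N * Cm k) $$ (i, j) = (\<Sum>l<n. pencil N $$ (i, l) * Cm k $$ (l, j))"
    by (rule mult_entry) (use k ij in auto)
  also have "\<dots> = (\<Sum>l<n. [:- (B $$ (i, l) * k $$ (l, j)), N $$ (i, l) * k $$ (l, j):])"
    using k ij by (intro sum.cong) (auto simp: pencil_def B_def)
  also have "\<dots> = [:- (B * k) $$ (i, j), (N * k) $$ (i, j):]"
    using mult_entry[OF B k ij] mult_entry[OF N k ij] by (simp add: sum_pCons2 sum_negf)
  also have "\<dots> = pencil (N * k) $$ (i, j)"
    using ij unfolding pencil_def QQ by simp
  finally show "pencil (N * k) $$ (i, j) = (pencil N * Cm k) $$ (i, j)" by simp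
qed (use k in \<open>auto simp: pencil_def\<close>)

text \<open>Up to sign, the coefficient of degree \<open>n - 1\<close> of \<open>det (t N - Q N Q)\<close>.\<close>

definition pencil_coeff :: "complex mat \<Rightarrow> complex" where
  "pencil_coeff N = - coeff (Determinant.det (pencil N)) (n - 1)"

lemma pencil_coeff_invariant:
  assumes k: "k \<in> carrier_mat n n" "Q_mat n * k = k * Q_mat n" "Determinant.det k = 1"
    and k': "k' \<in> carrier_mat n n" "Q_mat n * k' = k' * Q_mat n" "Determinant.det k' = 1"
    and N: "N \<in> carrier_mat n n"
  shows "pencil_coeff (k * N * k') = pencil_coeff N"
proof -
  have "pencil (k * N * k') = Cm k * pencil N * Cm k'"
    by (simp only: pencil_right[OF k'(1) closed_n[OF k(1) N] k'(2)] pencil_left[OF k(1) N k(2)])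
  moreover have "Cm k \<in> carrier_mat n n" "Cm k' \<in> carrier_mat n n" using k k' by auto
  ultimately have "Determinant.det (pencil (k * N * k')) = Determinant.det (pencil N)"
    using k k' by (simp add: det_mult[of _ n] mult_carrier_mat[of _ n n _ n] det_Cm one_pCons[symmetric])
  then show ?thesis by (simp add: pencil_coeff_def)
qed

text \<open>When \<open>det N = 1\<close>, the determinant is the characteristic polynomial of \<open>Q N Q N\<^sup>-\<^sup>1\<close>.\<close>

lemma pencil_coeff_group:
  assumes N: "N \<in> carrier_mat n n" "Determinant.det N = 1" and K: "K \<in> carrier_mat n n" "K * N = 1\<^sub>m n"
  shows "pencil_coeff N = mtr n (Q_mat n * N * Q_mat n * K)"
proof -
  define B where "B = Q_mat n * N * Q_mat n"
  define W where "W = B * K"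
  have B: "B \<in> carrier_mat n n" using N by (auto simp: B_def)
  have W: "W \<in> carrier_mat n n" using B K by (auto simp: W_def)
  have WN: "W * N = B" unfolding W_def using B K N by (simp add: assoc_n)
  have CN: "Cm N \<in> carrier_mat n n" using N by auto
  have "pencil N = char_poly_matrix W * Cm N"
  proof (rule eq_matI)
    fix i j assume "i < dim_row (char_poly_matrix W * Cm N)" "j < dim_col (char_poly_matrix W * Cm N)"
    then have ij: "i < n" "j < n" using N W char_poly_matrix_closed[OF W] by auto
    have "(char_poly_matrix W * Cm N) $$ (i, j) = (\<Sum>l<n. char_poly_matrix W $$ (i, l) * Cm N $$ (l, j))"
      by (rule mult_entry) (use W CN ij in auto)
    also have "\<dots> = (\<Sum>l<n. [:- (W $$ (i, l) * N $$ (l, j)), (if l = i then N $$ (l, j) else 0):])"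
      using W N ij by (intro sum.cong) (auto simp: char_poly_matrix_def)
    also have "\<dots> = [:- B $$ (i, j), N $$ (i, j):]"
      using mult_entry[OF W N(1) ij] ij unfolding WN by (simp add: sum_pCons2 sum_negf)
    also have "\<dots> = pencil N $$ (i, j)" using ij by (simp add: pencil_def B_def)
    finally show "pencil N $$ (i, j) = (char_poly_matrix W * Cm N) $$ (i, j)" by simp
  qed (use N carrier_matD[OF char_poly_matrix_closed[OF W]] in \<open>auto simp: pencil_def\<close>)
  then have "Determinant.det (pencil N) = char_poly W"
    using N det_mult[OF char_poly_matrix_closed[OF W] CN] by (simp add: char_poly_def det_Cm one_pCons[symmetric])
  then show ?thesis
    using char_poly_trace[OF W] n_ge_2 by (simp add: pencil_coeff_def W_def B_def)
qed

text \<open>The invariant polynomial of degree \<open>n\<close> underlying the construction.\<close>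

definition invar :: "complex mat \<Rightarrow> complex" where
  "invar M = pencil_coeff (D_mat n * M * D_mat n)"

lemma invar_pfam: "pfam n n (\<lambda>\<epsilon>. invar)"
proof -
  define E where "E = (\<lambda>M. Matrix.mat n n (\<lambda>(i, j).
      [:- (Q_mat n * D_mat n * M * (D_mat n * Q_mat n)) $$ (i, j), (D_mat n * M * D_mat n) $$ (i, j):]))"
  have c: "Q_mat n * D_mat n \<in> carrier_mat n n" "D_mat n * Q_mat n \<in> carrier_mat n n" by auto
  have "cfam n n (\<lambda>M. Determinant.det (E M))"
  proof (rule cfam_det)
    fix i j assume ij: "i < n" "j < n"
    have 1: "pfam n 1 (\<lambda>\<epsilon> M. (D_mat n * M * D_mat n) $$ (i, j))"
      by (rule pfam_entry_mult) (use ij in auto)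
    have 2: "pfam n 1 (\<lambda>\<epsilon> M. (-1) * (Q_mat n * D_mat n * M * (D_mat n * Q_mat n)) $$ (i, j))"
      by (intro pfam_cmult[of "\<lambda>_. -1"] pfam_entry_mult) (use ij c in auto)
    show "cfam n 1 (\<lambda>M. E M $$ (i, j))"
      unfolding cfam_def
    proof
      fix r :: nat
      consider "r = 0" | "r = 1" | s where "r = Suc (Suc s)" by (metis One_nat_def not0_implies_Suc)
      then show "pfam n 1 (\<lambda>\<epsilon> M. coeff (E M $$ (i, j)) r)"
        by cases (use 1 2 ij in \<open>auto simp: E_def intro: pfam_const[of "\<lambda>_. 0"]\<close>)
    qed
  qed (simp add: E_def)
  then have "pfam n n (\<lambda>\<epsilon> M. (-1) * coeff (Determinant.det (E M)) (n - 1))"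
    by (intro pfam_cmult[of "\<lambda>_. -1"]) (auto simp: cfam_def)
  then show ?thesis
  proof (rule pfam_cong)
    fix M :: "complex mat" assume M: "M \<in> carrier_mat n n"
    have "Q_mat n * (D_mat n * M * D_mat n) * Q_mat n = Q_mat n * D_mat n * M * (D_mat n * Q_mat n)"
      using M by (simp add: assoc_n closed_n)
    then show "invar M = (-1) * coeff (Determinant.det (E M)) (n - 1)"
      by (simp add: invar_def pencil_coeff_def pencil_def E_def)
  qed
qed

lemma invar_invariant:
  assumes A: "A \<in> S_set n" "B \<in> S_set n" and M: "M \<in> carrier_mat n n"
  shows "invar (xf \<epsilon> A * M * zf \<epsilon> B) = invar M"
proof -
  define a b where "a = exp_fam \<epsilon> A" and "b = exp_fam \<epsilon> B"
  have ab: "a \<in> carrier_mat n n" "b \<in> carrier_mat n n" "Determinant.det a = 1" "Determinant.det b = 1"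
    using exp_fam_SU[of A \<epsilon>] exp_fam_SU[of B \<epsilon>] A by (auto simp: a_def b_def SU_carrier_iff)
  have Q: "Q_mat n * a = a * Q_mat n" "Q_mat n * b = b * Q_mat n"
    using A by (auto simp: a_def b_def exp_fam_def intro!: mat_exp_S_commute S_scale)
  have "D_mat n * (xf \<epsilon> A * M * zf \<epsilon> B) * D_mat n =
      (D_mat n * Dm) * (a * (D_mat n * M * D_mat n) * b) * (Dm * D_mat n)"
    unfolding xf_def zf_def a_def[symmetric] b_def[symmetric] using ab(1,2) M by (simp add: assoc_n closed_n)
  also have "\<dots> = a * (D_mat n * M * D_mat n) * b"
    using ab(1,2) M by (simp add: D_Dm closed_n)
  finally show ?thesis
    unfolding invar_def using pencil_coeff_invariant[OF ab(1) Q(1) ab(3) ab(2) Q(2) ab(4)] M by (simp add: closed_n)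
qed

text \<open>The matrix \<open>H = D\<^sup>-\<^sup>2\<close>.\<close>

definition Hm :: "complex mat" where "Hm = Dm * Dm"

lemma Hm_carrier [simp, intro]: "Hm \<in> carrier_mat n n"
  by (auto simp: Hm_def)

lemma invar_block:
  assumes y: "y \<in> carrier_mat n n" "Determinant.det y = 1" "Q_mat n * y = y * Q_mat n"
    and y': "y' \<in> carrier_mat n n" "y' * y = 1\<^sub>m n"
  shows "invar y = mtr n (Hm * y * (Hm * y'))"
proof -
  define N where "N = D_mat n * y * D_mat n"
  define K where "K = Dm * y' * Dm"
  have N: "N \<in> carrier_mat n n" "Determinant.det N = 1"
    using y by (auto simp: N_def det_mult[of _ n] closed_n det_D)
  have K: "K \<in> carrier_mat n n" using y' by (auto simp: K_def)
  have "K * N = Dm * (y' * ((Dm * D_mat n) * (y * D_mat n)))"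
    unfolding K_def N_def using y(1) y'(1) by (simp add: assoc_n closed_n)
  also have "\<dots> = Dm * ((y' * y) * D_mat n)" using y(1) y'(1) by (simp add: assoc_n closed_n D_Dm)
  finally have KN: "K * N = 1\<^sub>m n" by (simp add: y' D_Dm)
  have "Q_mat n * N * Q_mat n = Q_mat n * D_mat n * (Q_mat n * Q_mat n) * y * (D_mat n * Q_mat n)"
    unfolding N_def Q_Q using y(1) by (simp add: assoc_n closed_n)
  also have "\<dots> = (Q_mat n * D_mat n * Q_mat n) * (Q_mat n * y) * (D_mat n * Q_mat n)"
    using y(1) by (simp add: assoc_n closed_n)
  also have "\<dots> = (Q_mat n * D_mat n * Q_mat n) * y * (Q_mat n * D_mat n * Q_mat n)"
    unfolding y(3) using y(1) by (simp add: assoc_n closed_n)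
  finally have QNQ: "Q_mat n * N * Q_mat n = Dm * y * Dm" by (simp add: QDQ)
  have "invar y = mtr n (Dm * y * Dm * K)"
    unfolding invar_def N_def[symmetric] using pencil_coeff_group[OF N K KN] by (simp add: QNQ)
  also have "Dm * y * Dm * K = (Dm * y * (Hm * y')) * Dm"
    unfolding K_def Hm_def using y(1) y'(1) by (simp add: assoc_n closed_n)
  also have "mtr n \<dots> = mtr n (Dm * (Dm * y * (Hm * y')))"
    by (rule mtr_comm) (use y y' in auto)
  also have "Dm * (Dm * y * (Hm * y')) = Hm * y * (Hm * y')"
    unfolding Hm_def using y(1) y'(1) by (simp add: assoc_n closed_n)
  finally show ?thesis .
qed

end

section \<open>Expansions at zero\<close>

text \<open>\<open>F = O(\<epsilon>\<^sup>k)\<close> as \<open>\<epsilon>\<close> tends to 0 from above.\<close>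

definition bO :: "nat \<Rightarrow> (real \<Rightarrow> complex) \<Rightarrow> bool" where
  "bO k F \<longleftrightarrow> (\<exists>K. \<forall>\<^sub>F \<epsilon> in at_right 0. cmod (F \<epsilon>) \<le> K * \<epsilon> ^ k)"

lemma bO_iff_bigo: "bO k F \<longleftrightarrow> F \<in> O[at_right 0](\<lambda>\<epsilon>. of_real \<epsilon> ^ k)"
proof -
  have ev: "\<forall>\<^sub>F \<epsilon> in at_right 0. (0 :: real) < \<epsilon>" by (rule eventually_at_right_less)
  show ?thesis
  proof
    assume "bO k F"
    then obtain K where K: "\<forall>\<^sub>F \<epsilon> in at_right 0. cmod (F \<epsilon>) \<le> K * \<epsilon> ^ k" by (auto simp: bO_def)
    have "\<forall>\<^sub>F \<epsilon> in at_right 0. cmod (F \<epsilon>) \<le> K * cmod (of_real \<epsilon> ^ k)"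
      using K ev by eventually_elim (simp add: norm_power)
    then show "F \<in> O[at_right 0](\<lambda>\<epsilon>. of_real \<epsilon> ^ k)" by (rule bigoI)
  next
    assume "F \<in> O[at_right 0](\<lambda>\<epsilon>. of_real \<epsilon> ^ k)"
    then obtain K where K: "\<forall>\<^sub>F \<epsilon> in at_right 0. cmod (F \<epsilon>) \<le> K * cmod (of_real \<epsilon> ^ k)"
      by (elim landau_o.bigE)
    have "\<forall>\<^sub>F \<epsilon> in at_right 0. cmod (F \<epsilon>) \<le> K * \<epsilon> ^ k"
      using K ev by eventually_elim (simp add: norm_power)
    then show "bO k F" by (auto simp: bO_def)
  qed
qed

lemma bO_add: "bO k F \<Longrightarrow> bO k G \<Longrightarrow> bO k (\<lambda>\<epsilon>. F \<epsilon> + G \<epsilon>)"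
  unfolding bO_iff_bigo by (rule sum_in_bigo)

lemma bO_diff: "bO k F \<Longrightarrow> bO k G \<Longrightarrow> bO k (\<lambda>\<epsilon>. F \<epsilon> - G \<epsilon>)"
  unfolding bO_iff_bigo by (rule sum_in_bigo)

lemma bO_mult: "bO k F \<Longrightarrow> bO l G \<Longrightarrow> bO (k + l) (\<lambda>\<epsilon>. F \<epsilon> * G \<epsilon>)"
  unfolding bO_iff_bigo power_add by (rule landau_o.big.mult)

lemma bO_const [simp]: "bO 0 (\<lambda>_. c)"
  by (auto simp: bO_iff_bigo)

lemma bO_cmult: "bO k F \<Longrightarrow> bO k (\<lambda>\<epsilon>. c * F \<epsilon>)"
  using bO_mult[OF bO_const, of k F c] by simp

lemma bO_sum: "(\<And>i. i \<in> I \<Longrightarrow> bO k (F i)) \<Longrightarrow> bO k (\<lambda>\<epsilon>. \<Sum>i\<in>I. F i \<epsilon>)"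
  unfolding bO_iff_bigo by (rule big_sum_in_bigo)

lemma bO_eps_power: "bO k (\<lambda>\<epsilon>. of_real \<epsilon> ^ k)"
  by (simp add: bO_iff_bigo)

lemma bO_zero [simp]: "bO k (\<lambda>_. 0)"
  by (simp add: bO_iff_bigo)

lemma bO_mono:
  assumes "bO k F" "l \<le> k" shows "bO l F"
proof -
  obtain K where K: "\<forall>\<^sub>F \<epsilon> in at_right 0. cmod (F \<epsilon>) \<le> K * \<epsilon> ^ k" using assms(1) by (auto simp: bO_def)
  have "\<forall>\<^sub>F \<epsilon> in at_right (0 :: real). 0 < \<epsilon> \<and> \<epsilon> < 1"
    using eventually_at_right_real[of 0 1] by simp
  with K have "\<forall>\<^sub>F \<epsilon> in at_right 0. cmod (F \<epsilon>) \<le> \<bar>K\<bar> * \<epsilon> ^ l"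
  proof eventually_elim
    case (elim \<epsilon>)
    have "K * \<epsilon> ^ k \<le> \<bar>K\<bar> * \<epsilon> ^ k" using elim by (intro mult_right_mono) auto
    also have "\<dots> \<le> \<bar>K\<bar> * \<epsilon> ^ l" using elim assms(2) by (intro mult_left_mono power_decreasing) auto
    finally show ?case using elim by simp
  qed
  then show ?thesis by (auto simp: bO_def)
qed

lemma bO_cong:
  assumes "bO k F" "\<And>\<epsilon>. \<epsilon> > 0 \<Longrightarrow> G \<epsilon> = F \<epsilon>" shows "bO k G"
proof -
  obtain K where K: "\<forall>\<^sub>F \<epsilon> in at_right 0. cmod (F \<epsilon>) \<le> K * \<epsilon> ^ k" using assms(1) by (auto simp: bO_def)
  have "\<forall>\<^sub>F \<epsilon> in at_right 0. (0 :: real) < \<epsilon>" by (rule eventually_at_right_less)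
  with K have "\<forall>\<^sub>F \<epsilon> in at_right 0. cmod (G \<epsilon>) \<le> K * \<epsilon> ^ k"
    by eventually_elim (use assms(2) in auto)
  then show ?thesis by (auto simp: bO_def)
qed

lemma bO_divide:
  assumes "bO (k + j) F" shows "bO k (\<lambda>\<epsilon>. F \<epsilon> / of_real \<epsilon> ^ j)"
proof -
  obtain K where K: "\<forall>\<^sub>F \<epsilon> in at_right 0. cmod (F \<epsilon>) \<le> K * \<epsilon> ^ (k + j)" using assms by (auto simp: bO_def)
  have "\<forall>\<^sub>F \<epsilon> in at_right 0. (0 :: real) < \<epsilon>" by (rule eventually_at_right_less)
  with K have "\<forall>\<^sub>F \<epsilon> in at_right 0. cmod (F \<epsilon> / of_real \<epsilon> ^ j) \<le> K * \<epsilon> ^ k"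
    by eventually_elim (auto simp: norm_divide norm_power power_add field_simps)
  then show ?thesis by (auto simp: bO_def)
qed

text \<open>\<open>F = a + O(\<epsilon>)\<close>.\<close>

definition t1 :: "(real \<Rightarrow> complex) \<Rightarrow> complex \<Rightarrow> bool" where
  "t1 F a \<longleftrightarrow> bO 1 (\<lambda>\<epsilon>. F \<epsilon> - a)"

lemma t1_const [simp]: "t1 (\<lambda>_. a) a"
  by (simp add: t1_def)

lemma t1_bO: "t1 F a \<Longrightarrow> bO 0 F"
  using bO_add[OF bO_mono[of 1 "\<lambda>\<epsilon>. F \<epsilon> - a" 0] bO_const[of a]] by (simp add: t1_def)

lemma t1_add: "t1 F a \<Longrightarrow> t1 G b \<Longrightarrow> t1 (\<lambda>\<epsilon>. F \<epsilon> + G \<epsilon>) (a + b)"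
  unfolding t1_def by (drule (1) bO_add) (simp add: algebra_simps)

lemma t1_diff: "t1 F a \<Longrightarrow> t1 G b \<Longrightarrow> t1 (\<lambda>\<epsilon>. F \<epsilon> - G \<epsilon>) (a - b)"
  unfolding t1_def by (drule (1) bO_diff) (simp add: algebra_simps)

lemma t1_mult:
  assumes "t1 F a" "t1 G b" shows "t1 (\<lambda>\<epsilon>. F \<epsilon> * G \<epsilon>) (a * b)"
proof -
  have "bO 1 (\<lambda>\<epsilon>. (F \<epsilon> - a) * G \<epsilon> + a * (G \<epsilon> - b))"
    using assms bO_mult[of 1 "\<lambda>\<epsilon>. F \<epsilon> - a" 0 G] t1_bO[OF assms(2)]
    by (intro bO_add bO_cmult) (auto simp: t1_def)
  then show ?thesis by (simp add: t1_def algebra_simps)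
qed

lemma t1_cmult: "t1 F a \<Longrightarrow> t1 (\<lambda>\<epsilon>. c * F \<epsilon>) (c * a)"
  using t1_mult[OF t1_const] .

lemma t1_sum: "(\<And>i. i \<in> I \<Longrightarrow> t1 (F i) (a i)) \<Longrightarrow> t1 (\<lambda>\<epsilon>. \<Sum>i\<in>I. F i \<epsilon>) (\<Sum>i\<in>I. a i)"
  unfolding t1_def by (simp flip: sum_subtractf add: bO_sum)

lemma t1_prod: "(\<And>i. i \<in> I \<Longrightarrow> t1 (F i) (a i)) \<Longrightarrow> t1 (\<lambda>\<epsilon>. \<Prod>i\<in>I. F i \<epsilon>) (\<Prod>i\<in>I. a i)"
  by (induction I rule: infinite_finite_induct) (auto intro: t1_mult)

text \<open>\<open>F = a + b \<epsilon> + c \<epsilon>\<^sup>2 + O(\<epsilon>\<^sup>3)\<close>.\<close>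

definition t3 :: "(real \<Rightarrow> complex) \<Rightarrow> complex \<Rightarrow> complex \<Rightarrow> complex \<Rightarrow> bool" where
  "t3 F a b c \<longleftrightarrow> bO 3 (\<lambda>\<epsilon>. F \<epsilon> - (a + of_real \<epsilon> * b + of_real \<epsilon> ^ 2 * c))"

lemma t3_const: "t3 (\<lambda>_. a) a 0 0"
  by (simp add: t3_def)

lemma t3_add: "t3 F a b c \<Longrightarrow> t3 G a' b' c' \<Longrightarrow> t3 (\<lambda>\<epsilon>. F \<epsilon> + G \<epsilon>) (a + a') (b + b') (c + c')"
  unfolding t3_def by (drule (1) bO_add) (simp add: algebra_simps)

lemma bO_poly2: "bO 0 (\<lambda>\<epsilon>. a + of_real \<epsilon> * b + of_real \<epsilon> ^ 2 * c)"
proof -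
  have "bO 0 (\<lambda>\<epsilon>. of_real \<epsilon> ^ 1)" "bO 0 (\<lambda>\<epsilon>. of_real \<epsilon> ^ 2)"
    using bO_mono[OF bO_eps_power] by blast+
  then show ?thesis
    using bO_add[OF bO_add[OF bO_const[of a] bO_cmult[of 0 _ b]] bO_cmult[of 0 _ c]] by (simp add: mult.commute)
qed

lemma t3_bO: "t3 F a b c \<Longrightarrow> bO 0 F"
  using bO_add[OF bO_mono[of 3 _ 0] bO_poly2[of a b c]] by (fastforce simp: t3_def)

lemma t3_mult:
  assumes "t3 F a b c" "t3 G a' b' c'"
  shows "t3 (\<lambda>\<epsilon>. F \<epsilon> * G \<epsilon>) (a * a') (a * b' + b * a') (a * c' + b * b' + c * a')"
proof -
  define P where "P = (\<lambda>\<epsilon>. a + of_real \<epsilon> * b + of_real \<epsilon> ^ 2 * c)"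
  define P' where "P' = (\<lambda>\<epsilon>. a' + of_real \<epsilon> * b' + of_real \<epsilon> ^ 2 * c')"
  \<comment> \<open>\<open>F G - P P' = (F - P) G + P (G - P')\<close>, and the terms of \<open>P P'\<close> of degree 3 and 4 are dropped.\<close>
  have "bO (3 + 0) (\<lambda>\<epsilon>. (F \<epsilon> - P \<epsilon>) * G \<epsilon>)"
    using assms(1) t3_bO[OF assms(2)] by (intro bO_mult) (auto simp: t3_def P_def)
  moreover have "bO (0 + 3) (\<lambda>\<epsilon>. P \<epsilon> * (G \<epsilon> - P' \<epsilon>))"
    using assms(2) bO_poly2[of a b c] by (intro bO_mult) (auto simp: t3_def P_def P'_def)
  moreover have "bO 3 (\<lambda>\<epsilon>. (b * c' + c * b') * of_real \<epsilon> ^ 3)" by (intro bO_cmult bO_eps_power)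
  moreover have "bO 3 (\<lambda>\<epsilon>. (c * c') * of_real \<epsilon> ^ 4)"
    by (intro bO_cmult bO_mono[OF bO_eps_power]) auto
  ultimately have "bO 3 (\<lambda>\<epsilon>. (F \<epsilon> - P \<epsilon>) * G \<epsilon> + P \<epsilon> * (G \<epsilon> - P' \<epsilon>) +
      ((b * c' + c * b') * of_real \<epsilon> ^ 3 + (c * c') * of_real \<epsilon> ^ 4))"
    by (intro bO_add) simp_all
  then show ?thesis
    unfolding t3_def
    by (rule bO_cong) (simp add: P_def P'_def algebra_simps power2_eq_square power3_eq_cube power4_eq_xxxx)
qed

lemma t3_sum:
  "(\<And>i. i \<in> I \<Longrightarrow> t3 (F i) (a i) (b i) (c i)) \<Longrightarrow>
   t3 (\<lambda>\<epsilon>. \<Sum>i\<in>I. F i \<epsilon>) (\<Sum>i\<in>I. a i) (\<Sum>i\<in>I. b i) (\<Sum>i\<in>I. c i)"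
proof (induction I rule: infinite_finite_induct)
  case (insert x I)
  then show ?case using t3_add[of "F x" "a x" "b x" "c x"] by simp
qed (auto simp: t3_const)

text \<open>The value at each real \<open>\<epsilon>\<close> is needed: convergence at \<open>\<epsilon> = 2\<close> gives absolute summability of the
  coefficients, hence a uniform bound on the tail for \<open>\<epsilon> < 1\<close>.\<close>

lemma t3_power_series:
  assumes sums: "\<And>\<epsilon>. (\<lambda>k. a k * of_real \<epsilon> ^ k) sums F \<epsilon>"
  shows "t3 F (a 0) (a 1) (a 2)"
proof -
  have "summable (\<lambda>k. a k * (2 :: complex) ^ k)" using sums[of 2] by (simp add: sums_iff)
  then have "summable (\<lambda>k. norm (a k * (1 :: complex) ^ k))"
    by (rule powser_insidea) simp
  then have "summable (\<lambda>k. cmod (a (k + 3)))"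
    using summable_iff_shift[of "\<lambda>k. cmod (a k)" 3] by simp
  note S = this
  have bound: "cmod (F \<epsilon> - (a 0 + of_real \<epsilon> * a 1 + of_real \<epsilon> ^ 2 * a 2)) \<le> suminf (\<lambda>k. cmod (a (k + 3))) * \<epsilon> ^ 3"
    if "0 < \<epsilon> \<and> \<epsilon> < 1" for \<epsilon>
  proof -
    have s: "(\<lambda>k. a (k + 3) * of_real \<epsilon> ^ (k + 3)) sums (F \<epsilon> - (\<Sum>k<3. a k * of_real \<epsilon> ^ k))"
      by (rule sums_split_initial_segment[OF sums])
    have s2: "summable (\<lambda>k. cmod (a (k + 3)) * \<epsilon> ^ 3)" using S by (rule summable_mult2)
    have "cmod (suminf (\<lambda>k. a (k + 3) * of_real \<epsilon> ^ (k + 3))) \<le> suminf (\<lambda>k. cmod (a (k + 3)) * \<epsilon> ^ 3)"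
    proof (rule norm_suminf_le[OF _ s2])
      fix k
      have "\<epsilon> ^ (k + 3) \<le> \<epsilon> ^ 3" using that by (intro power_decreasing) auto
      then show "cmod (a (k + 3) * of_real \<epsilon> ^ (k + 3)) \<le> cmod (a (k + 3)) * \<epsilon> ^ 3"
        using that by (simp add: norm_mult norm_power mult_left_mono)
    qed
    also have "\<dots> = suminf (\<lambda>k. cmod (a (k + 3))) * \<epsilon> ^ 3" using suminf_mult2[OF S] by simp
    also have "suminf (\<lambda>k. a (k + 3) * of_real \<epsilon> ^ (k + 3)) = F \<epsilon> - (\<Sum>k<3. a k * of_real \<epsilon> ^ k)"
      using sums_unique[OF s] by simp
    also have "(\<Sum>k<3. a k * of_real \<epsilon> ^ k) = a 0 + of_real \<epsilon> * a 1 + of_real \<epsilon> ^ 2 * a 2"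
      by (simp add: eval_nat_numeral)
    finally show ?thesis .
  qed
  have "\<forall>\<^sub>F \<epsilon> in at_right (0 :: real). 0 < \<epsilon> \<and> \<epsilon> < 1"
    using eventually_at_right_real[of 0 1] by simp
  then have "\<forall>\<^sub>F \<epsilon> in at_right 0. cmod (F \<epsilon> - (a 0 + of_real \<epsilon> * a 1 + of_real \<epsilon> ^ 2 * a 2)) \<le>
      suminf (\<lambda>k. cmod (a (k + 3))) * \<epsilon> ^ 3"
    by eventually_elim (rule bound)
  then show ?thesis by (auto simp: t3_def bO_def)
qed

text \<open>\<open>F = A + B \<epsilon> + C \<epsilon>\<^sup>2 + O(\<epsilon>\<^sup>3)\<close> for matrices, entry by entry.\<close>

definition m3 :: "nat \<Rightarrow> (real \<Rightarrow> complex mat) \<Rightarrow> complex mat \<Rightarrow> complex mat \<Rightarrow> complex mat \<Rightarrow> bool" where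
  "m3 n F A B C \<longleftrightarrow> (\<forall>\<epsilon>. F \<epsilon> \<in> carrier_mat n n) \<and> A \<in> carrier_mat n n \<and> B \<in> carrier_mat n n \<and> C \<in> carrier_mat n n \<and>
     (\<forall>i<n. \<forall>j<n. t3 (\<lambda>\<epsilon>. F \<epsilon> $$ (i, j)) (A $$ (i, j)) (B $$ (i, j)) (C $$ (i, j)))"

lemma m3_carrier:
  assumes "m3 n F A B C"
  shows "F \<epsilon> \<in> carrier_mat n n" "A \<in> carrier_mat n n" "B \<in> carrier_mat n n" "C \<in> carrier_mat n n"
  using assms by (auto simp: m3_def)

lemma m3_entry: "m3 n F A B C \<Longrightarrow> i < n \<Longrightarrow> j < n \<Longrightarrow>
    t3 (\<lambda>\<epsilon>. F \<epsilon> $$ (i, j)) (A $$ (i, j)) (B $$ (i, j)) (C $$ (i, j))"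
  by (auto simp: m3_def)

lemma m3_const: "A \<in> carrier_mat n n \<Longrightarrow> m3 n (\<lambda>_. A) A (0\<^sub>m n n) (0\<^sub>m n n)"
  by (auto simp: m3_def t3_const)

lemma m3_mult:
  assumes F: "m3 n F A B C" and G: "m3 n G A' B' C'"
  shows "m3 n (\<lambda>\<epsilon>. F \<epsilon> * G \<epsilon>) (A * A') (A * B' + B * A') (A * C' + B * B' + C * A')"
proof -
  note f = m3_carrier[OF F] and g = m3_carrier[OF G]
  have "t3 (\<lambda>\<epsilon>. (F \<epsilon> * G \<epsilon>) $$ (i, j)) ((A * A') $$ (i, j)) ((A * B' + B * A') $$ (i, j))
      ((A * C' + B * B' + C * A') $$ (i, j))" if ij: "i < n" "j < n" for i j
  proof -
    have "t3 (\<lambda>\<epsilon>. \<Sum>k<n. F \<epsilon> $$ (i, k) * G \<epsilon> $$ (k, j)) (\<Sum>k<n. A $$ (i, k) * A' $$ (k, j))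
      (\<Sum>k<n. A $$ (i, k) * B' $$ (k, j) + B $$ (i, k) * A' $$ (k, j))
      (\<Sum>k<n. A $$ (i, k) * C' $$ (k, j) + B $$ (i, k) * B' $$ (k, j) + C $$ (i, k) * A' $$ (k, j))"
      using ij by (intro t3_sum t3_mult m3_entry[OF F] m3_entry[OF G]) auto
    moreover have "(F \<epsilon> * G \<epsilon>) $$ (i, j) = (\<Sum>k<n. F \<epsilon> $$ (i, k) * G \<epsilon> $$ (k, j))" for \<epsilon>
      by (rule mult_entry) (use f g ij in auto)
    moreover have "(A * A') $$ (i, j) = (\<Sum>k<n. A $$ (i, k) * A' $$ (k, j))"
      by (rule mult_entry) (use f g ij in auto)
    moreover have "(A * B' + B * A') $$ (i, j) = (\<Sum>k<n. A $$ (i, k) * B' $$ (k, j) + B $$ (i, k) * A' $$ (k, j))"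
    proof -
      have "(A * B' + B * A') $$ (i, j) = (A * B') $$ (i, j) + (B * A') $$ (i, j)"
        using f g ij by auto
      then show ?thesis
        using mult_entry[OF f(2) g(3) ij] mult_entry[OF f(3) g(2) ij] by (simp add: sum.distrib)
    qed
    moreover have "(A * C' + B * B' + C * A') $$ (i, j) =
        (\<Sum>k<n. A $$ (i, k) * C' $$ (k, j) + B $$ (i, k) * B' $$ (k, j) + C $$ (i, k) * A' $$ (k, j))"
    proof -
      have "(A * C' + B * B' + C * A') $$ (i, j) = (A * C') $$ (i, j) + (B * B') $$ (i, j) + (C * A') $$ (i, j)"
        using f g ij by auto
      then show ?thesis
        using mult_entry[OF f(2) g(4) ij] mult_entry[OF f(3) g(3) ij] mult_entry[OF f(4) g(2) ij]
        by (simp add: sum.distrib)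
    qed
    ultimately show ?thesis by simp
  qed
  then show ?thesis using f g by (auto simp: m3_def intro!: mult_carrier_mat[of _ n n] add_carrier_mat)
qed

lemma m3_exp:
  assumes A: "A \<in> carrier_mat n n"
  shows "m3 n (\<lambda>\<epsilon>. exp_fam \<epsilon> A) (1\<^sub>m n) A ((1/2) \<cdot>\<^sub>m (A * A))"
proof -
  have "t3 (\<lambda>\<epsilon>. exp_fam \<epsilon> A $$ (i, j)) (1\<^sub>m n $$ (i, j)) (A $$ (i, j)) (((1/2) \<cdot>\<^sub>m (A * A)) $$ (i, j))"
    if ij: "i < n" "j < n" for i j
  proof -
    define a where "a = (\<lambda>k. (A ^\<^sub>m k) $$ (i, j) / fact k)"
    have "t3 (\<lambda>\<epsilon>. exp_fam \<epsilon> A $$ (i, j)) (a 0) (a 1) (a 2)"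
    proof (rule t3_power_series)
      show "(\<lambda>k. a k * of_real \<epsilon> ^ k) sums (exp_fam \<epsilon> A $$ (i, j))" for \<epsilon>
        unfolding a_def exp_fam_def by (rule mat_exp_power_series[OF A ij])
    qed
    then show ?thesis using A ij by (simp add: a_def numeral_2_eq_2 left_mult_one_mat[OF A])
  qed
  moreover have "exp_fam \<epsilon> A \<in> carrier_mat n n" for \<epsilon>
    using A by (rule exp_fam_square)
  ultimately show ?thesis using A by (auto simp: m3_def intro!: smult_carrier_mat mult_carrier_mat[of _ n n])
qed

lemma m3_trace: "m3 n F A B C \<Longrightarrow> t3 (\<lambda>\<epsilon>. mtr n (F \<epsilon>)) (mtr n A) (mtr n B) (mtr n C)"
  unfolding mtr_def by (intro t3_sum) (auto simp: m3_def)

section \<open>The quadratic form of the invariant\<close>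

text \<open>Gaussian integers.\<close>

definition gint :: "complex \<Rightarrow> bool" where "gint z \<longleftrightarrow> Re z \<in> \<int> \<and> Im z \<in> \<int>"

lemma gint_add: "gint z \<Longrightarrow> gint w \<Longrightarrow> gint (z + w)"
  and gint_diff: "gint z \<Longrightarrow> gint w \<Longrightarrow> gint (z - w)"
  and gint_mult: "gint z \<Longrightarrow> gint w \<Longrightarrow> gint (z * w)"
  by (auto simp: gint_def)

lemma gint_norm_sq: "gint z \<Longrightarrow> (cmod z)\<^sup>2 \<in> \<int>"
  by (auto simp: gint_def cmod_power2)

lemma cnj_swap: "cnj x = - y \<Longrightarrow> cnj y = - x"
  by (simp add: complex_eq_iff)

context even_size begin

lemma m3_cmult:
  assumes "m3 n F A B C" "H \<in> carrier_mat n n"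
  shows "m3 n (\<lambda>\<epsilon>. H * F \<epsilon>) (H * A) (H * B) (H * C)"
proof -
  note f = m3_carrier[OF assms(1)]
  have "0\<^sub>m n n * A = 0\<^sub>m n n" "0\<^sub>m n n * B = 0\<^sub>m n n" using f by auto
  moreover have "H * B + 0\<^sub>m n n = H * B" "H * C + 0\<^sub>m n n = H * C" using f assms(2) by auto
  ultimately show ?thesis using m3_mult[OF m3_const[OF assms(2)] assms(1)] by simp
qed

lemma Hm_mult_uminus: "B \<in> carrier_mat n n \<Longrightarrow> Hm * - B = - (Hm * B)"
  using carrier_matD[OF Hm_carrier] by auto

text \<open>The hyperbolic cosine and sine of \<open>2 ln (av i)\<close>, which are the entries of \<open>D\<^sup>2\<close>, and up to sign of \<open>D\<^sup>-\<^sup>2\<close>.\<close>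

definition cc :: "nat \<Rightarrow> real" where "cc i = ((av i)\<^sup>2 + 1 / (av i)\<^sup>2) / 2"
definition tt :: "nat \<Rightarrow> real" where "tt i = ((av i)\<^sup>2 - 1 / (av i)\<^sup>2) / 2"

lemma cc_opp [simp]: "i < n \<Longrightarrow> cc (opp i) = cc i" and tt_opp [simp]: "i < n \<Longrightarrow> tt (opp i) = tt i"
  by (auto simp: cc_def tt_def)

lemma ch_sh_cc: "ch i * ch i + sh i * sh i = of_real (cc i)" "2 * (ch i * sh i) = of_real (tt i)"
proof -
  have "((av i + 1 / av i) / 2) * ((av i + 1 / av i) / 2) + ((av i - 1 / av i) / 2) * ((av i - 1 / av i) / 2) = cc i"
    "2 * (((av i + 1 / av i) / 2) * ((av i - 1 / av i) / 2)) = tt i"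
    by (simp_all add: cc_def tt_def field_simps power2_eq_square)
  then show "ch i * ch i + sh i * sh i = of_real (cc i)" "2 * (ch i * sh i) = of_real (tt i)"
    unfolding ch_def sh_def by (metis of_real_add of_real_mult, metis of_real_mult of_real_numeral)
qed

lemma Hm_xmat: "Hm = xmat n (\<lambda>i. of_real (cc i)) (\<lambda>i. - of_real (tt i))"
  unfolding Hm_def Dm_def xmat_mult
  by (rule xmat_cong) (simp_all add: flip: ch_sh_cc)

lemma Hm_adjoint: "mat_adjoint Hm = Hm"
  unfolding Hm_xmat xmat_adjoint by (rule xmat_cong) auto

text \<open>The commutator with \<open>Hm\<close>, and its squared Frobenius norm.\<close>

definition comH :: "complex mat \<Rightarrow> complex mat" where "comH B = B * Hm - Hm * B"

definition qform :: "complex mat \<Rightarrow> real" where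
  "qform B = (\<Sum>i<n. \<Sum>j<n. (cmod (comH B $$ (i, j)))\<^sup>2)"

lemma comH_carrier [simp, intro]: "B \<in> carrier_mat n n \<Longrightarrow> comH B \<in> carrier_mat n n"
  by (auto simp: comH_def intro!: minus_carrier_mat)

text \<open>The commutator of a skew-Hermitian with a Hermitian matrix is Hermitian, so its squared norm is the
  trace of its square.\<close>

lemma qform_trace:
  assumes B: "B \<in> S_set n"
  shows "of_real (qform B) = 2 * (mtr n ((Hm * B) * (Hm * B)) - mtr n (Hm * (Hm * (B * B))))"
proof -
  have Bc: "B \<in> carrier_mat n n" using B by simp
  define K where "K = comH B"
  have K: "K \<in> carrier_mat n n" using Bc by (auto simp: K_def)
  have adj: "mat_adjoint (B * Hm) = - (Hm * B)"
    using Bc by (simp add: mat_adjoint_mult[of _ n] Hm_adjoint S_adjoint[OF B] Hm_mult_uminus)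
  have "cnj ((B * Hm) $$ (i, j)) = - (Hm * B) $$ (j, i)" if "i < n" "j < n" for i j
  proof -
    have "cnj ((B * Hm) $$ (i, j)) = mat_adjoint (B * Hm) $$ (j, i)"
      using mat_adjoint_entry[OF closed_n[OF Bc Hm_carrier] that(2,1)] by simp
    also have "\<dots> = (- (Hm * B)) $$ (j, i)" by (simp only: adj)
    also have "\<dots> = - (Hm * B) $$ (j, i)"
      using that carrier_matD[OF closed_n[OF Hm_carrier Bc]] by (intro index_uminus_mat) simp_all
    finally show ?thesis .
  qed
  note e1 = this
  have e2: "cnj ((Hm * B) $$ (i, j)) = - (B * Hm) $$ (j, i)" if "i < n" "j < n" for i j
    by (rule cnj_swap[OF e1[OF that(2,1)]])
  have sym: "K $$ (j, i) = cnj (K $$ (i, j))" if "i < n" "j < n" for i j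
  proof -
    have "K $$ (i, j) = (B * Hm) $$ (i, j) - (Hm * B) $$ (i, j)" "K $$ (j, i) = (B * Hm) $$ (j, i) - (Hm * B) $$ (j, i)"
      unfolding K_def comH_def using that carrier_matD[OF closed_n[OF Hm_carrier Bc]]
      by (auto intro!: index_minus_mat)
    then show ?thesis by (simp only: complex_cnj_diff e1[OF that] e2[OF that]) simp
  qed
  have "mtr n (K * K) = (\<Sum>i<n. \<Sum>j<n. K $$ (i, j) * K $$ (j, i))"
    unfolding mtr_def using K by (intro sum.cong) (auto simp: mult_entry simp del: index_mult_mat)
  also have "\<dots> = (\<Sum>i<n. \<Sum>j<n. of_real ((cmod (K $$ (i, j)))\<^sup>2))"
  proof (intro sum.cong refl)
    fix i j assume "i \<in> {..<n}" "j \<in> {..<n}"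
    then have "K $$ (i, j) * K $$ (j, i) = K $$ (i, j) * cnj (K $$ (i, j))"
      using sym[of i j] by simp
    then show "K $$ (i, j) * K $$ (j, i) = of_real ((cmod (K $$ (i, j)))\<^sup>2)"
      by (simp only: complex_norm_square)
  qed
  also have "\<dots> = of_real (qform B)" by (simp add: qform_def K_def)
  finally have q: "of_real (qform B) = mtr n (K * K)" ..
  define X Y where "X = B * Hm" and "Y = Hm * B"
  have XY: "X \<in> carrier_mat n n" "Y \<in> carrier_mat n n" using Bc by (auto simp: X_def Y_def)
  have "K * K = (X * X - Y * X) - (X * Y - Y * Y)"
    unfolding K_def comH_def X_def[symmetric] Y_def[symmetric] using XY
    by (subst mult_minus_distrib_mat[of _ n n _ n], auto simp: minus_mult_distrib_mat[of _ n n _ _ n] intro!: minus_carrier_mat)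
  then have "mtr n (K * K) = mtr n (X * X) - mtr n (Y * X) - (mtr n (X * Y) - mtr n (Y * Y))"
    using XY carrier_matD[OF closed_n[OF XY]] carrier_matD[OF closed_n[OF XY(2,1)]] carrier_matD[OF closed_n[OF XY(1,1)]] carrier_matD[OF closed_n[OF XY(2,2)]]
    by (simp add: mtr_def sum_subtractf del: index_mult_mat(1))
  also have "mtr n (X * X) = mtr n ((Hm * B) * (Hm * B))"
  proof -
    have "X * X = B * (Hm * B * Hm)" unfolding X_def using Bc by (simp add: assoc_n closed_n)
    then have "mtr n (X * X) = mtr n ((Hm * B * Hm) * B)" using Bc by (simp add: mtr_comm[of B n] closed_n)
    then show ?thesis using Bc by (simp add: assoc_n closed_n)
  qed
  also have "mtr n (X * Y) = mtr n (Hm * (Hm * (B * B)))"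
  proof -
    have "X * Y = B * (Hm * Hm * B)" unfolding X_def Y_def using Bc by (simp add: assoc_n closed_n)
    then have "mtr n (X * Y) = mtr n ((Hm * Hm * B) * B)" using Bc by (simp add: mtr_comm[of B n] closed_n)
    then show ?thesis using Bc by (simp add: assoc_n closed_n)
  qed
  also have "mtr n (Y * X) = mtr n (Hm * (Hm * (B * B)))"
  proof -
    have "Y * X = (Hm * (B * B)) * Hm" unfolding X_def Y_def using Bc by (simp add: assoc_n closed_n)
    then show ?thesis using Bc by (simp add: mtr_comm[of _ n Hm] closed_n)
  qed
  finally show ?thesis unfolding q Y_def by simp
qed

text \<open>Along \<open>exp (- \<epsilon> A) exp (\<epsilon> A')\<close> the invariant has no linear term, and its quadratic term only
  sees the difference \<open>A' - A\<close>.\<close>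

lemma invar_expansion:
  assumes A: "A \<in> S_set n" and A': "A' \<in> S_set n"
  shows "t3 (\<lambda>\<epsilon>. invar (exp_fam \<epsilon> (- A) * exp_fam \<epsilon> A')) (mtr n (Hm * Hm)) 0 (- of_real (qform (A' - A)) / 2)"
proof -
  \<comment> \<open>\<open>Y2\<close> and \<open>Z2\<close> below are the quadratic coefficients of \<open>y\<close> and \<open>y\<^sup>-\<^sup>1\<close>; only their sum \<open>B\<^sup>2\<close> matters.\<close>
  define B where "B = A' - A"
  have c: "A \<in> carrier_mat n n" "A' \<in> carrier_mat n n" "- A \<in> carrier_mat n n" "- A' \<in> carrier_mat n n"
    using A A' by auto
  have B: "B \<in> S_set n" using S_minus[OF A' A] by (simp add: B_def)
  then have Bc: "B \<in> carrier_mat n n" by simp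
  define Y2 where "Y2 = 1\<^sub>m n * ((1/2) \<cdot>\<^sub>m (A' * A')) + (- A) * A' + ((1/2) \<cdot>\<^sub>m (- A * - A)) * 1\<^sub>m n"
  define Z2 where "Z2 = 1\<^sub>m n * ((1/2) \<cdot>\<^sub>m (A * A)) + (- A') * A + ((1/2) \<cdot>\<^sub>m (- A' * - A')) * 1\<^sub>m n"
  have YZc: "Y2 \<in> carrier_mat n n" "Z2 \<in> carrier_mat n n"
    using c by (auto simp: Y2_def Z2_def)
  have "1\<^sub>m n * A' + (- A) * 1\<^sub>m n = B" "1\<^sub>m n * A + (- A') * 1\<^sub>m n = - B"
    using c by (auto simp: B_def intro!: eq_matI)
  then have y: "m3 n (\<lambda>\<epsilon>. exp_fam \<epsilon> (- A) * exp_fam \<epsilon> A') (1\<^sub>m n) B Y2"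
    and z: "m3 n (\<lambda>\<epsilon>. exp_fam \<epsilon> (- A') * exp_fam \<epsilon> A) (1\<^sub>m n) (- B) Z2"
    using m3_mult[OF m3_exp[OF c(3)] m3_exp[OF c(2)]] m3_mult[OF m3_exp[OF c(4)] m3_exp[OF c(1)]]
    by (simp_all add: Y2_def Z2_def)
  have YZ: "Z2 + Y2 = B * B"
  proof -
    have "B * B = (A' * A' - A * A') - (A' * A - A * A)"
      unfolding B_def using c
      by (subst mult_minus_distrib_mat[of _ n n _ n], auto simp: minus_mult_distrib_mat[of _ n n _ _ n] intro!: minus_carrier_mat)
    moreover have m: "(- A) * A' = - (A * A')" "(- A') * A = - (A' * A)" "- A * - A = A * A" "- A' * - A' = A' * A'"
      using c by auto
    moreover have "A' * A' \<in> carrier_mat n n" "A * A' \<in> carrier_mat n n" "A' * A \<in> carrier_mat n n" "A * A \<in> carrier_mat n n"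
      using c by auto
    note carr = this carrier_matD[OF this(1)] carrier_matD[OF this(2)] carrier_matD[OF this(3)] carrier_matD[OF this(4)]
    ultimately show ?thesis
      unfolding Y2_def Z2_def m using carr
      by (intro eq_matI) (simp_all add: smult_carrier_mat left_mult_one_mat[of _ n n] right_mult_one_mat[of _ n n] del: index_mult_mat(1))
  qed
  have eq: "invar (exp_fam \<epsilon> (- A) * exp_fam \<epsilon> A') =
      mtr n ((Hm * (exp_fam \<epsilon> (- A) * exp_fam \<epsilon> A')) * (Hm * (exp_fam \<epsilon> (- A') * exp_fam \<epsilon> A)))" for \<epsilon>
  proof (rule invar_block)
    have e: "exp_fam \<epsilon> (- A) \<in> SU_carrier n" "exp_fam \<epsilon> A' \<in> SU_carrier n"
      using A A' by (auto intro: exp_fam_SU S_uminus)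
    then show "exp_fam \<epsilon> (- A) * exp_fam \<epsilon> A' \<in> carrier_mat n n"
      "Determinant.det (exp_fam \<epsilon> (- A) * exp_fam \<epsilon> A') = 1"
      using SU_mult_closed[of "exp_fam \<epsilon> (- A)" "exp_fam \<epsilon> A'"] by (simp_all add: SU_carrier_iff)
    note ec = exp_fam_carrier[OF c(1), of \<epsilon>] exp_fam_carrier[OF c(2), of \<epsilon>] exp_fam_carrier[OF c(3), of \<epsilon>]
      exp_fam_carrier[OF c(4), of \<epsilon>]
    have Q: "Q_mat n * exp_fam \<epsilon> (- A) = exp_fam \<epsilon> (- A) * Q_mat n" "Q_mat n * exp_fam \<epsilon> A' = exp_fam \<epsilon> A' * Q_mat n"
      using A A' by (auto simp: exp_fam_def intro!: mat_exp_S_commute S_scale S_uminus)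
    have "Q_mat n * (exp_fam \<epsilon> (- A) * exp_fam \<epsilon> A') = (Q_mat n * exp_fam \<epsilon> (- A)) * exp_fam \<epsilon> A'"
      using ec by (simp add: assoc_n)
    also have "\<dots> = exp_fam \<epsilon> (- A) * (Q_mat n * exp_fam \<epsilon> A')" unfolding Q(1) using ec by (simp add: assoc_n)
    also have "\<dots> = (exp_fam \<epsilon> (- A) * exp_fam \<epsilon> A') * Q_mat n" unfolding Q(2) using ec by (simp add: assoc_n)
    finally show "Q_mat n * (exp_fam \<epsilon> (- A) * exp_fam \<epsilon> A') = (exp_fam \<epsilon> (- A) * exp_fam \<epsilon> A') * Q_mat n" .
    show "exp_fam \<epsilon> (- A') * exp_fam \<epsilon> A \<in> carrier_mat n n" using ec by auto
    have "exp_fam \<epsilon> (- A') * exp_fam \<epsilon> A * (exp_fam \<epsilon> (- A) * exp_fam \<epsilon> A') =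
        exp_fam \<epsilon> (- A') * ((exp_fam \<epsilon> A * exp_fam \<epsilon> (- A)) * exp_fam \<epsilon> A')"
      using ec by (simp add: assoc_n closed_n)
    then show "exp_fam \<epsilon> (- A') * exp_fam \<epsilon> A * (exp_fam \<epsilon> (- A) * exp_fam \<epsilon> A') = 1\<^sub>m n"
      using ec by (simp add: exp_fam_inverse c)
  qed
  define T1 T2 where "T1 = mtr n ((Hm * B) * (Hm * B))" and "T2 = mtr n (Hm * (Hm * (B * B)))"
  have a: "(Hm * 1\<^sub>m n) * (Hm * 1\<^sub>m n) = Hm * Hm" by simp
  have mB: "Hm * - B = - (Hm * B)" using Bc by (rule Hm_mult_uminus)
  have b: "mtr n ((Hm * 1\<^sub>m n) * (Hm * - B) + (Hm * B) * (Hm * 1\<^sub>m n)) = 0"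
  proof -
    have "Hm * - (Hm * B) = - (Hm * (Hm * B))" using closed_n[OF Hm_carrier Bc] by (rule Hm_mult_uminus)
    then show ?thesis
      using Bc mtr_comm[of "Hm * B" n Hm] by (simp add: mB mtr_add[of _ n] mtr_uminus closed_n)
  qed
  have cT: "mtr n ((Hm * 1\<^sub>m n) * (Hm * Z2) + (Hm * B) * (Hm * - B) + (Hm * Y2) * (Hm * 1\<^sub>m n)) = T2 - T1"
  proof -
    have 1: "(Hm * B) * - (Hm * B) = - ((Hm * B) * (Hm * B))"
      using carrier_matD[OF closed_n[OF Hm_carrier Bc]] by (intro uminus_mult_right_mat) simp
    have 2: "mtr n ((Hm * Y2) * Hm) = mtr n (Hm * (Hm * Y2))" using YZc by (intro mtr_comm) auto
    have "Hm * (Hm * (Z2 + Y2)) = Hm * (Hm * Z2) + Hm * (Hm * Y2)"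
      using YZc by (simp add: mult_add_distrib_mat[of _ n n _ n] closed_n)
    then have "T2 = mtr n (Hm * (Hm * Z2)) + mtr n (Hm * (Hm * Y2))"
      unfolding T2_def YZ[symmetric] using YZc by (simp add: mtr_add[of _ n] closed_n)
    moreover have "mtr n (Hm * (Hm * Z2) + - ((Hm * B) * (Hm * B)) + (Hm * Y2) * Hm) =
        mtr n (Hm * (Hm * Z2)) + - T1 + mtr n ((Hm * Y2) * Hm)"
      unfolding T1_def using YZc Bc by (subst mtr_add[of _ n], auto simp: mtr_add[of _ n] mtr_uminus[of _ n] closed_n)
    ultimately show ?thesis unfolding mB 1 using 2 by simp
  qed
  have q: "- of_real (qform (A' - A)) / 2 = T2 - T1"
    using qform_trace[OF B] by (simp add: B_def[symmetric] T1_def T2_def)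
  show ?thesis
    using m3_trace[OF m3_mult[OF m3_cmult[OF y Hm_carrier] m3_cmult[OF z Hm_carrier]]]
    unfolding a b cT eq[symmetric] q .
qed

lemma comH_entry:
  assumes "B \<in> carrier_mat n n" "i < n" "j < n"
  shows "comH B $$ (i, j) = B $$ (i, j) * of_real (cc j) - B $$ (i, opp j) * of_real (tt j) -
     (of_real (cc i) * B $$ (i, j) - of_real (tt i) * B $$ (opp i, j))"
proof -
  have "comH B $$ (i, j) = (B * Hm) $$ (i, j) - (Hm * B) $$ (i, j)"
    using assms carrier_matD[OF closed_n[OF Hm_carrier assms(1)]] by (simp add: comH_def del: index_mult_mat(1))
  also have "(B * Hm) $$ (i, j) = B $$ (i, j) * of_real (cc j) - B $$ (i, opp j) * of_real (tt j)"
    unfolding Hm_xmat using assms by (subst xmat_mult_right_entry) auto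
  also have "(Hm * B) $$ (i, j) = of_real (cc i) * B $$ (i, j) - of_real (tt i) * B $$ (opp i, j)"
    unfolding Hm_xmat using assms by (subst xmat_mult_left_entry) auto
  finally show ?thesis .
qed

lemma same_block_opp: "i < n \<Longrightarrow> j < n \<Longrightarrow> same_block i (opp j) \<longleftrightarrow> \<not> same_block i j"
  "i < n \<Longrightarrow> j < n \<Longrightarrow> same_block (opp i) j \<longleftrightarrow> \<not> same_block i j"
  using opp_low by (auto simp: same_block_def)

lemma cc_inj:
  assumes "i < n" "j < n" "same_block i j" "cc i = cc j" shows "i = j"
proof -
  define x y where "x = (av i)\<^sup>2" and "y = (av j)\<^sup>2"
  have xy: "x > 1" "y > 1" using av_gt_1 by (auto simp: x_def y_def one_less_power)
  have "x + 1 / x = y + 1 / y" using assms(4) by (simp add: cc_def x_def y_def)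
  then have "(x - y) * (x * y - 1) = 0" using xy by (simp add: field_simps)
  moreover have "x * y > 1" using xy by (rule less_1_mult)
  ultimately have "x = y" by auto
  then have "av i = av j" using av_pos(1)[of i] av_pos(1)[of j] by (simp add: x_def y_def)
  then show ?thesis using av_inj assms by (auto simp: same_block_def)
qed

text \<open>At a nonzero entry \<open>(i, j)\<close> of \<open>B\<close>, which lies inside a block, the commutator has the entry
  \<open>B\<^sub>i\<^sub>j (cc j - cc i)\<close>: the antidiagonal part of \<open>Hm\<close> only contributes entries of \<open>B\<close> outside the blocks.\<close>

lemma qform_pos:
  assumes B: "B \<in> S_set n" and nz: "B \<noteq> 0\<^sub>m n n"
  shows "qform B > 0"
proof -
  have Bc: "B \<in> carrier_mat n n" using B by simp
  obtain i j where ij: "i < n" "j < n" "B $$ (i, j) \<noteq> 0"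
  proof (rule ccontr)
    assume "\<not> thesis"
    then have "B = 0\<^sub>m n n" using that Bc by (intro eq_matI) auto
    with nz show False by simp
  qed
  have sb: "same_block i j" using S_setD(3)[OF B ij(1,2)] ij(3) by blast
  have neq: "i \<noteq> j" using S_setD(2)[OF B ij(1)] ij(3) by auto
  have "B $$ (i, opp j) = 0" "B $$ (opp i, j) = 0"
    using S_setD(3)[OF B ij(1), of "opp j"] S_setD(3)[OF B, of "opp i" j] ij sb by (auto simp: same_block_opp)
  then have "comH B $$ (i, j) = B $$ (i, j) * of_real (cc j - cc i)"
    using comH_entry[OF Bc ij(1,2)] by (simp add: algebra_simps)
  then have "comH B $$ (i, j) \<noteq> 0" using ij neq cc_inj[OF ij(1,2) sb] by auto
  then have "0 < (cmod (comH B $$ (i, j)))\<^sup>2" by simp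
  also have "\<dots> \<le> (\<Sum>j<n. (cmod (comH B $$ (i, j)))\<^sup>2)"
    by (rule member_le_sum[of j]) (use ij in auto)
  also have "\<dots> \<le> qform B"
    unfolding qform_def by (rule member_le_sum[of i _ "\<lambda>i. \<Sum>j<n. (cmod (comH B $$ (i, j)))\<^sup>2"]) (use ij in \<open>auto intro: sum_nonneg\<close>)
  finally show ?thesis .
qed

text \<open>A common denominator of the entries of \<open>Hm\<close>: each \<open>av i\<close> is an integer between 1 and \<open>n\<close>, hence
  divides \<open>n!\<close>.\<close>

definition denom :: nat where "denom = 2 * (fact n)\<^sup>2"

lemma denom_cc: "real denom * cc i \<in> \<int>" "real denom * tt i \<in> \<int>" if "i < n"
proof -
  define a where "a = max (n - i) (i + 1)"
  have a: "av i = real a" "1 \<le> a" "a \<le> n" using that by (auto simp: av_def a_def)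
  then obtain k where k: "fact n = a * k" using dvd_fact[of a n] by (auto elim: dvdE)
  have "real denom * cc i = real ((fact n)\<^sup>2 * a\<^sup>2 + k\<^sup>2)" "real denom * tt i = real ((fact n)\<^sup>2 * a\<^sup>2) - real (k\<^sup>2)"
    using a by (auto simp: denom_def cc_def tt_def a(1) k field_simps simp del: of_nat_fact)
  then show "real denom * cc i \<in> \<int>" "real denom * tt i \<in> \<int>" by (metis Ints_of_nat, metis Ints_diff Ints_of_nat)
qed

lemma cc_tt_bound: "i < n \<Longrightarrow> \<bar>cc i\<bar> \<le> (real n)\<^sup>2" "i < n \<Longrightarrow> \<bar>tt i\<bar> \<le> (real n)\<^sup>2"
proof -
  assume i: "i < n"
  have a: "av i > 1" "av i \<le> real n" using av_gt_1 i by (auto simp: av_def)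
  then have "1 / (av i)\<^sup>2 \<le> 1" "1 \<le> (av i)\<^sup>2" "(av i)\<^sup>2 \<le> (real n)\<^sup>2" "0 \<le> 1 / (av i)\<^sup>2"
    by (auto simp: power_mono one_le_power)
  moreover define u y where "u = 1 / (av i)\<^sup>2" and "y = (av i)\<^sup>2"
  moreover define N where "N = (real n)\<^sup>2"
  ultimately have b: "u \<le> 1" "1 \<le> y" "y \<le> N" "0 \<le> u" by simp_all
  have "cc i = (y + u) / 2" "tt i = (y - u) / 2" by (simp_all add: cc_def tt_def u_def y_def)
  with b have "\<bar>cc i\<bar> \<le> N" "\<bar>tt i\<bar> \<le> N" by auto
  then show "\<bar>cc i\<bar> \<le> (real n)\<^sup>2" "\<bar>tt i\<bar> \<le> (real n)\<^sup>2" by (simp_all add: N_def)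
qed

lemma I_set_props:
  assumes "z \<in> I_set q" "q \<ge> 1"
  shows "gint z" "cmod z \<le> 3 * sqrt (real q)"
proof -
  obtain a b where z: "z = Complex (of_int a) (of_int b)" and
    ab: "\<bar>a\<bar> \<le> \<lceil>sqrt (real q) / 2\<rceil>" "\<bar>b\<bar> \<le> \<lceil>sqrt (real q) / 2\<rceil>"
    using assms(1) by (auto simp: I_set_def)
  show "gint z" by (simp add: z gint_def)
  \<comment> \<open>For \<open>x \<ge> 1 / 2\<close> the ceiling of \<open>x\<close> is at most \<open>x + 1 \<le> 3 x\<close>.\<close>
  have "sqrt (real q) \<ge> 1" using assms(2) by simp
  then have "real_of_int \<lceil>sqrt (real q) / 2\<rceil> \<le> 3 / 2 * sqrt (real q)" by linarith
  moreover have "\<bar>real_of_int a\<bar> \<le> real_of_int \<lceil>sqrt (real q) / 2\<rceil>" "\<bar>real_of_int b\<bar> \<le> real_of_int \<lceil>sqrt (real q) / 2\<rceil>"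
    using ab by linarith+
  ultimately show "cmod z \<le> 3 * sqrt (real q)" using cmod_le[of z] by (simp add: z)
qed

text \<open>The factor in the bound on the integer values of the scaled form. Entries of the difference of two
  lattice points are at most \<open>6 \<surd>q\<close>, and entries of \<open>Hm\<close> at most \<open>n\<^sup>2\<close>. So each entry of the commutator, a sum of four
  products, is at most \<open>24 n\<^sup>2 \<surd>q\<close>, and \<open>24\<^sup>2 = 576\<close>.\<close>

definition form_bound :: nat where "form_bound = denom\<^sup>2 * (576 * n ^ 6)"

text \<open>On differences of lattice points the scaled form takes integer values of size \<open>O(q)\<close>, and
  vanishes only for equal points.\<close>

lemma qform_lattice:
  assumes A: "A \<in> S_set n" "\<And>i j. i < n \<Longrightarrow> j < n \<Longrightarrow> A $$ (i, j) \<in> I_set q"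
    and A': "A' \<in> S_set n" "\<And>i j. i < n \<Longrightarrow> j < n \<Longrightarrow> A' $$ (i, j) \<in> I_set q"
    and q: "q \<ge> 1" and neq: "A \<noteq> A'"
  obtains k where "real (denom\<^sup>2) * qform (A' - A) = real k" "1 \<le> k" "k \<le> form_bound * q"
proof -
  define B where "B = A' - A"
  have c: "A \<in> carrier_mat n n" "A' \<in> carrier_mat n n" using A A' by auto
  have B: "B \<in> S_set n" using S_minus A A' by (simp add: B_def)
  then have Bc: "B \<in> carrier_mat n n" by simp
  have nz: "B \<noteq> 0\<^sub>m n n"
  proof
    assume B0: "B = 0\<^sub>m n n"
    have "A' $$ (i, j) - A $$ (i, j) = B $$ (i, j)" if "i < n" "j < n" for i j
      using that c by (simp add: B_def)
    then have "A = A'" using c B0 by (intro eq_matI) auto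
    with neq show False by simp
  qed
  have Bg: "gint (B $$ (i, j))" and Bb: "cmod (B $$ (i, j)) \<le> 6 * sqrt (real q)" if "i < n" "j < n" for i j
  proof -
    have e: "B $$ (i, j) = A' $$ (i, j) - A $$ (i, j)" using that c by (simp add: B_def)
    show "gint (B $$ (i, j))" unfolding e by (intro gint_diff I_set_props(1)[OF _ q] A(2) A'(2) that)
    show "cmod (B $$ (i, j)) \<le> 6 * sqrt (real q)"
      unfolding e using norm_triangle_ineq4[of "A' $$ (i, j)" "A $$ (i, j)"]
        I_set_props(2)[OF A(2)[OF that] q] I_set_props(2)[OF A'(2)[OF that] q] by linarith
  qed
  have Kg: "gint (of_nat denom * comH B $$ (i, j))" if ij: "i < n" "j < n" for i j
  proof -
    have g: "gint (complex_of_real (real denom * cc i))" "gint (complex_of_real (real denom * cc j))"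
      "gint (complex_of_real (real denom * tt i))" "gint (complex_of_real (real denom * tt j))"
      using denom_cc ij by (auto simp: gint_def)
    have "of_nat denom * comH B $$ (i, j) = B $$ (i, j) * complex_of_real (real denom * cc j) - B $$ (i, opp j) * complex_of_real (real denom * tt j) -
     (complex_of_real (real denom * cc i) * B $$ (i, j) - complex_of_real (real denom * tt i) * B $$ (opp i, j))"
      unfolding comH_entry[OF Bc ij] by (simp add: algebra_simps)
    then show ?thesis using g Bg ij by (auto intro!: gint_diff gint_mult simp del: of_real_mult)
  qed
  have Kb: "(cmod (comH B $$ (i, j)))\<^sup>2 \<le> 576 * real n ^ 4 * real q" if ij: "i < n" "j < n" for i j
  proof -
    define b where "b = 6 * sqrt (real q) * (real n)\<^sup>2"
    have m: "cmod (z * complex_of_real r) \<le> b" if "cmod z \<le> 6 * sqrt (real q)" "\<bar>r\<bar> \<le> (real n)\<^sup>2" for z r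
      unfolding norm_mult b_def using that by (intro mult_mono) auto
    have "cmod (comH B $$ (i, j)) \<le> 4 * b"
    proof -
      let ?p = "B $$ (i, j) * complex_of_real (cc j)" and ?q = "B $$ (i, opp j) * complex_of_real (tt j)"
      let ?r = "B $$ (i, j) * complex_of_real (cc i)" and ?s = "B $$ (opp i, j) * complex_of_real (tt i)"
      have E: "comH B $$ (i, j) = ?p - ?q - (?r - ?s)"
        unfolding comH_entry[OF Bc ij] by (simp add: mult.commute)
      have "cmod (?p - ?q - (?r - ?s)) \<le> cmod (?p - ?q) + cmod (?r - ?s)"
        "cmod (?p - ?q) \<le> cmod ?p + cmod ?q" "cmod (?r - ?s) \<le> cmod ?r + cmod ?s"
        by (rule norm_triangle_ineq4)+
      moreover have "cmod ?p \<le> b" "cmod ?q \<le> b" "cmod ?r \<le> b" "cmod ?s \<le> b"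
        using Bb ij cc_tt_bound by (auto intro!: m simp del: norm_mult)
      ultimately show ?thesis unfolding E by linarith
    qed
    then have "(cmod (comH B $$ (i, j)))\<^sup>2 \<le> (4 * b)\<^sup>2" by (intro power_mono) auto
    also have "(4 * b)\<^sup>2 = 576 * real n ^ 4 * real q"
      by (simp add: b_def power_mult_distrib flip: power_mult)
    finally show ?thesis .
  qed
  have "real (denom\<^sup>2) * qform B = (\<Sum>i<n. \<Sum>j<n. (cmod (of_nat denom * comH B $$ (i, j)))\<^sup>2)"
    by (simp add: qform_def sum_distrib_left norm_mult power_mult_distrib)
  also have "\<dots> \<in> \<int>"
    by (intro Ints_sum gint_norm_sq Kg) auto
  finally obtain z where z: "real (denom\<^sup>2) * qform B = real_of_int z" by (auto elim: Ints_cases)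
  have denom: "denom > 0" by (simp add: denom_def)
  then have "real (denom\<^sup>2) * qform B > 0" using qform_pos[OF B nz] by simp
  then have zp: "z > 0" using z by linarith
  have "qform B \<le> (\<Sum>i<n. \<Sum>j<n. 576 * real n ^ 4 * real q)"
    unfolding qform_def using Kb by (intro sum_mono) auto
  also have "\<dots> = 576 * real n ^ 6 * real q"
    by (simp add: eval_nat_numeral)
  finally have "real (denom\<^sup>2) * qform B \<le> real (denom\<^sup>2) * (576 * real n ^ 6 * real q)"
    by (intro mult_left_mono) auto
  also have "\<dots> = real (form_bound * q)" by (simp add: form_bound_def)
  finally have "z \<le> int (form_bound * q)" using z by linarith
  then have "nat z \<le> form_bound * q" "1 \<le> nat z" using zp by linarith+
  moreover have "real (denom\<^sup>2) * qform B = real (nat z)" using z zp by simp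
  ultimately show ?thesis using that[of "nat z"] by (simp add: B_def)
qed

text \<open>The rescaled invariant. The factor \<open>kap\<close> clears the denominator of the quadratic form and its factor \<open>1 / 2\<close>;
  division by \<open>\<epsilon>\<^sup>2\<close> isolates the quadratic term.\<close>

definition kap :: complex where "kap = of_nat (2 * denom\<^sup>2)"

definition scaled :: "real \<Rightarrow> complex mat \<Rightarrow> complex" where
  "scaled \<epsilon> M = kap * (1 / of_real \<epsilon> * (1 / of_real \<epsilon>)) * (mtr n (Hm * Hm) - invar M)"

text \<open>The invariant family \<open>p\<^sub>0\<close>: it is 1 where \<open>scaled\<close> vanishes, and 0 where \<open>scaled\<close> is one of the
  integers that occur at nontrivial lattice differences.\<close>

definition inv_poly :: "nat \<Rightarrow> real \<Rightarrow> complex mat \<Rightarrow> complex" where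
  "inv_poly q \<epsilon> M = (\<Prod>k\<in>{1..form_bound * q}. 1 - 1 / of_nat k * scaled \<epsilon> M)"

lemma inv_poly_pfam: "pfam n (form_bound * n * q) (inv_poly q)"
proof -
  have "pfam n n scaled"
    unfolding scaled_def
    by (intro pfam_cmult pfam_minus invar_pfam pfam_const hol_ext_mult hol_ext_const hol_ext_inverse)
  then have "pfam n (card {1..form_bound * q} * n) (\<lambda>\<epsilon> M. \<Prod>k\<in>{1..form_bound * q}. 1 - 1 / of_nat k * scaled \<epsilon> M)"
    by (intro pfam_prod pfam_minus pfam_cmult[of "\<lambda>_. c" for c] pfam_const[of "\<lambda>_. c" for c] hol_ext_const)
  then show ?thesis unfolding inv_poly_def by (simp add: mult_ac)
qed

lemma inv_poly_invariant:
  "A \<in> S_set n \<Longrightarrow> B \<in> S_set n \<Longrightarrow> M \<in> carrier_mat n n \<Longrightarrow> inv_poly q \<epsilon> (xf \<epsilon>' A * M * zf \<epsilon>' B) = inv_poly q \<epsilon> M"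
  by (simp add: inv_poly_def scaled_def invar_invariant)

lemma inv_poly_one: "inv_poly q \<epsilon> (1\<^sub>m n) = 1"
proof -
  have "invar (1\<^sub>m n) = mtr n (Hm * Hm)"
    using invar_block[of "1\<^sub>m n" "1\<^sub>m n"] by simp
  then show ?thesis by (simp add: inv_poly_def scaled_def)
qed

lemma inv_poly_lattice:
  assumes A: "A \<in> S_set n" "\<And>i j. i < n \<Longrightarrow> j < n \<Longrightarrow> A $$ (i, j) \<in> I_set q"
    and A': "A' \<in> S_set n" "\<And>i j. i < n \<Longrightarrow> j < n \<Longrightarrow> A' $$ (i, j) \<in> I_set q"
    and q: "q \<ge> 1" and neq: "A \<noteq> A'"
  shows "t1 (\<lambda>\<epsilon>. inv_poly q \<epsilon> (exp_fam \<epsilon> (- A) * exp_fam \<epsilon> A')) 0"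
proof -
  obtain k0 where k0: "real (denom\<^sup>2) * qform (A' - A) = real k0" "1 \<le> k0" "k0 \<le> form_bound * q"
    using qform_lattice[OF A A' q neq] by blast
  define F where "F = (\<lambda>\<epsilon>. invar (exp_fam \<epsilon> (- A) * exp_fam \<epsilon> A'))"
  have three: "1 + 2 = (3 :: nat)" by simp
  have "bO (1 + 2) (\<lambda>\<epsilon>. F \<epsilon> - (mtr n (Hm * Hm) + of_real \<epsilon> * 0 + of_real \<epsilon> ^ 2 * (- of_real (qform (A' - A)) / 2)))"
    using invar_expansion[OF A(1) A'(1)] unfolding t3_def F_def by (simp only: three)
  from bO_cmult[OF bO_divide[OF this], of "- kap"]
  have "t1 (\<lambda>\<epsilon>. scaled \<epsilon> (exp_fam \<epsilon> (- A) * exp_fam \<epsilon> A')) (kap * of_real (qform (A' - A)) / 2)"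
    unfolding t1_def
    by (rule bO_cong) (simp add: scaled_def F_def field_simps power2_eq_square)
  also have "kap * of_real (qform (A' - A)) / 2 = complex_of_real (real (denom\<^sup>2) * qform (A' - A))"
    by (simp add: kap_def)
  also have "\<dots> = of_nat k0" by (simp only: k0 of_real_of_nat_eq)
  finally have s: "t1 (\<lambda>\<epsilon>. scaled \<epsilon> (exp_fam \<epsilon> (- A) * exp_fam \<epsilon> A')) (of_nat k0)" .
  have "t1 (\<lambda>\<epsilon>. inv_poly q \<epsilon> (exp_fam \<epsilon> (- A) * exp_fam \<epsilon> A')) (\<Prod>k\<in>{1..form_bound * q}. 1 - 1 / of_nat k * of_nat k0)"
    unfolding inv_poly_def by (intro t1_prod t1_diff t1_cmult t1_const s)
  also have "(\<Prod>k\<in>{1..form_bound * q}. 1 - 1 / of_nat k * of_nat k0) = (0 :: complex)"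
    using k0 by (intro prod_zero bexI[of _ k0]) auto
  finally show ?thesis .
qed

end

section \<open>Linear coordinates\<close>

context even_size begin

text \<open>The square of \<open>D\<close>.\<close>

definition DD :: "complex mat" where "DD = D_mat n * D_mat n"

lemma DD_xmat: "DD = xmat n (\<lambda>i. of_real (cc i)) (\<lambda>i. of_real (tt i))"
  unfolding DD_def D_mat_xmat xmat_mult
  by (rule xmat_cong) (simp_all add: flip: ch_sh_cc)

text \<open>The product in whose entries the coordinates are linear.\<close>

definition Rm :: "complex mat \<Rightarrow> complex mat" where "Rm M = D_mat n * M * D_mat n"

lemma Rm_carrier [simp, intro]: "M \<in> carrier_mat n n \<Longrightarrow> Rm M \<in> carrier_mat n n"
  by (auto simp: Rm_def)

text \<open>The determinant of the linear system for the entries of \<open>s\<close> and \<open>s'\<close>.\<close>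

definition cdet :: "nat \<Rightarrow> nat \<Rightarrow> real" where
  "cdet i j = (cc j * tt i)\<^sup>2 - (tt j * cc i)\<^sup>2"

text \<open>The entries \<open>(i, j)\<close> of \<open>s\<close> and of \<open>s'\<close>, as linear functions of \<open>D\<^sup>-\<^sup>1 s D - D s' D\<^sup>-\<^sup>1\<close>; see \<open>coordinates\<close>.\<close>

definition coordX :: "nat \<Rightarrow> nat \<Rightarrow> complex mat \<Rightarrow> complex" where
  "coordX i j M = of_real (1 / cdet i j) *
     (of_real (cc j * tt i) * (of_real (tt i) * Rm M $$ (i, j) - of_real (cc i) * Rm M $$ (opp i, j)) +
      of_real (tt j * cc i) * (of_real (tt i) * Rm M $$ (opp i, opp j) - of_real (cc i) * Rm M $$ (i, opp j)))"

definition coordZ :: "nat \<Rightarrow> nat \<Rightarrow> complex mat \<Rightarrow> complex" where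
  "coordZ i j M = of_real (1 / cc i) * (of_real (cc j) * coordX i j M - Rm M $$ (i, j))"

lemma cc_tt_pos: "cc i > 0" "tt i > 0"
proof -
  have "(av i)\<^sup>2 > 1" using av_gt_1[of i] by (simp add: one_less_power)
  moreover define y where "y = (av i)\<^sup>2"
  ultimately have "y > 1" by simp
  then have "y + 1 / y > 0" "y - 1 / y > 0" by (simp_all add: field_simps add_pos_pos less_1_mult)
  then show "cc i > 0" "tt i > 0" by (simp_all add: cc_def tt_def y_def)
qed

text \<open>A vanishing determinant means \<open>tt i / cc i = tt j / cc j\<close>, that is, equal hyperbolic tangents.\<close>

lemma cdet_nonzero:
  assumes ij: "i < n" "j < n" "same_block i j" "i \<noteq> j"
  shows "cdet i j \<noteq> 0"
proof
  assume "cdet i j = 0"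
  then have "(cc j * tt i)\<^sup>2 = (tt j * cc i)\<^sup>2" by (simp add: cdet_def)
  then have e: "cc j * tt i = tt j * cc i"
    using cc_tt_pos[of i] cc_tt_pos[of j] by (simp add: power2_eq_iff_nonneg)
  define x y where "x = (av i)\<^sup>2" and "y = (av j)\<^sup>2"
  have xy: "x > 0" "y > 0" by (simp_all add: x_def y_def)
  have "(y + 1 / y) * (x - 1 / x) = (y - 1 / y) * (x + 1 / x)"
    using e by (simp add: cc_def tt_def x_def y_def)
  then have "(x - y) * (x + y) = 0" using xy by (simp add: field_simps)
  then have "av i = av j" using xy av_pos(1)[of i] av_pos(1)[of j] by (simp add: x_def y_def)
  then show False using av_inj ij by (auto simp: same_block_def)
qed

text \<open>The tangent vector \<open>D\<^sup>-\<^sup>1 s D - D s' D\<^sup>-\<^sup>1\<close>.\<close>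

definition tangent :: "complex mat \<Rightarrow> complex mat \<Rightarrow> complex mat" where
  "tangent s s' = Dm * s * D_mat n - D_mat n * s' * Dm"

lemma tangent_carrier [simp, intro]: "s \<in> carrier_mat n n \<Longrightarrow> s' \<in> carrier_mat n n \<Longrightarrow> tangent s s' \<in> carrier_mat n n"
  by (auto simp: tangent_def intro!: minus_carrier_mat)

lemma Rm_tangent:
  assumes "s \<in> carrier_mat n n" "s' \<in> carrier_mat n n"
  shows "Rm (tangent s s') = s * DD - DD * s'"
proof -
  note c = assms D_carrier
  have "Rm (tangent s s') = D_mat n * (Dm * s * D_mat n) * D_mat n - D_mat n * (D_mat n * s' * Dm) * D_mat n"
    unfolding Rm_def tangent_def using c
    by (simp add: mult_minus_distrib_mat[of _ n n _ n] minus_mult_distrib_mat[of _ n n _ _ n] closed_n)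
  also have "D_mat n * (Dm * s * D_mat n) * D_mat n = (D_mat n * Dm) * s * DD"
    unfolding DD_def using c by (simp add: assoc_n closed_n)
  also have "D_mat n * (D_mat n * s' * Dm) * D_mat n = DD * s' * (Dm * D_mat n)"
    unfolding DD_def using c by (simp add: assoc_n closed_n)
  finally show ?thesis using c by (simp add: D_Dm DD_def closed_n assoc_n)
qed

lemma Rm_tangent_entry:
  assumes s: "s \<in> S_set n" "s' \<in> S_set n" and ij: "i < n" "j < n"
  shows "Rm (tangent s s') $$ (i, j) = s $$ (i, j) * of_real (cc j) + s $$ (i, opp j) * of_real (tt j)
     - (of_real (cc i) * s' $$ (i, j) + of_real (tt i) * s' $$ (opp i, j))"
proof -
  have c: "s \<in> carrier_mat n n" "s' \<in> carrier_mat n n" using s by auto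
  have DDc: "DD \<in> carrier_mat n n" by (auto simp: DD_def)
  have "Rm (tangent s s') $$ (i, j) = (s * DD) $$ (i, j) - (DD * s') $$ (i, j)"
    unfolding Rm_tangent[OF c] using ij carrier_matD[OF closed_n[OF DDc c(2)]] by (intro index_minus_mat) auto
  also have "(s * DD) $$ (i, j) = s $$ (i, j) * of_real (cc j) + s $$ (i, opp j) * of_real (tt j)"
    unfolding DD_xmat using ij c by (subst xmat_mult_right_entry) auto
  also have "(DD * s') $$ (i, j) = of_real (cc i) * s' $$ (i, j) + of_real (tt i) * s' $$ (opp i, j)"
    unfolding DD_xmat using ij c by (subst xmat_mult_left_entry) auto
  finally show ?thesis .
qed

lemma coordinates:
  assumes s: "s \<in> S_set n" "s' \<in> S_set n" and ij: "i < n" "j < n" "same_block i j" "i \<noteq> j"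
  shows "coordX i j (tangent s s') = s $$ (i, j)" "coordZ i j (tangent s s') = s' $$ (i, j)"
proof -
  have sbo: "same_block (opp i) (opp j)" using ij by (simp add: same_block_opp)
  have z: "r $$ (i, opp j) = 0" "r $$ (opp i, j) = 0" if "r \<in> S_set n" for r
    using S_setD(3)[OF that] ij by (auto simp: same_block_opp)
  define a b a' b' where "a = s $$ (i, j)" and "b = s $$ (opp i, opp j)" and "a' = s' $$ (i, j)" and "b' = s' $$ (opp i, opp j)"
  define ci cj ti tj where "ci = complex_of_real (cc i)" and "cj = complex_of_real (cc j)"
    and "ti = complex_of_real (tt i)" and "tj = complex_of_real (tt j)"
  have R: "Rm (tangent s s') $$ (i, j) = a * cj - ci * a'" "Rm (tangent s s') $$ (opp i, j) = b * tj - ti * a'"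
    "Rm (tangent s s') $$ (opp i, opp j) = b * cj - ci * b'" "Rm (tangent s s') $$ (i, opp j) = a * tj - ti * b'"
    using ij z[OF s(1)] z[OF s(2)]
    by (simp_all add: Rm_tangent_entry[OF s] a_def b_def a'_def b'_def ci_def cj_def ti_def tj_def)
  define d where "d = complex_of_real (cdet i j)"
  have d: "d \<noteq> 0" using cdet_nonzero[OF ij] by (simp add: d_def)
  have d2: "d = (cj * ti) * (cj * ti) - (tj * ci) * (tj * ci)"
    by (simp add: d_def cdet_def ci_def cj_def ti_def tj_def power2_eq_square)
  have "coordX i j (tangent s s') = 1 / d * (cj * ti * (ti * (a * cj - ci * a') - ci * (b * tj - ti * a')) +
      tj * ci * (ti * (b * cj - ci * b') - ci * (a * tj - ti * b')))"
    unfolding coordX_def R by (simp add: d_def ci_def cj_def ti_def tj_def)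
  also have "cj * ti * (ti * (a * cj - ci * a') - ci * (b * tj - ti * a')) +
      tj * ci * (ti * (b * cj - ci * b') - ci * (a * tj - ti * b')) = a * d"
    unfolding d2 by (simp add: algebra_simps)
  finally have coordX: "coordX i j (tangent s s') = a" using d by simp
  then show "coordX i j (tangent s s') = s $$ (i, j)" by (simp add: a_def)
  have "ci \<noteq> 0" using cc_tt_pos[of i] by (simp add: ci_def)
  moreover have "coordZ i j (tangent s s') = 1 / ci * (cj * a - (a * cj - ci * a'))"
    unfolding coordZ_def coordX R by (simp add: ci_def cj_def)
  ultimately show "coordZ i j (tangent s s') = s' $$ (i, j)" by (simp add: a'_def)
qed

text \<open>The rescaled displacement from the identity.\<close>

definition displ :: "real \<Rightarrow> complex mat \<Rightarrow> complex mat" where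
  "displ \<epsilon> M = (1 / complex_of_real \<epsilon>) \<cdot>\<^sub>m (M - 1\<^sub>m n)"

lemma displ_carrier [simp, intro]: "M \<in> carrier_mat n n \<Longrightarrow> displ \<epsilon> M \<in> carrier_mat n n"
  by (auto simp: displ_def)

lemma displ_entry: "i < n \<Longrightarrow> j < n \<Longrightarrow> displ \<epsilon> M $$ (i, j) = 1 / complex_of_real \<epsilon> * (M $$ (i, j) - 1\<^sub>m n $$ (i, j))"
  by (simp add: displ_def)

lemma coord_pfam:
  assumes ij: "i < n" "j < n"
    and G: "\<And>k l. k < n \<Longrightarrow> l < n \<Longrightarrow> pfam n 1 (\<lambda>\<epsilon> M. G \<epsilon> M $$ (k, l))"
    "\<And>\<epsilon> M. M \<in> carrier_mat n n \<Longrightarrow> G \<epsilon> M \<in> carrier_mat n n"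
  shows "pfam n 1 (\<lambda>\<epsilon> M. coordX i j (G \<epsilon> M))" "pfam n 1 (\<lambda>\<epsilon> M. coordZ i j (G \<epsilon> M))"
proof -
  have R: "pfam n 1 (\<lambda>\<epsilon> M. Rm (G \<epsilon> M) $$ (k, l))" if "k < n" "l < n" for k l
    unfolding Rm_def by (rule pfam_mat_mult) (use that G in auto)
  note c = pfam_cmult[of "\<lambda>_. c" for c, OF hol_ext_const]
  show X: "pfam n 1 (\<lambda>\<epsilon> M. coordX i j (G \<epsilon> M))"
    unfolding coordX_def using ij by (intro c pfam_add pfam_minus R) auto
  show "pfam n 1 (\<lambda>\<epsilon> M. coordZ i j (G \<epsilon> M))"
    unfolding coordZ_def using ij by (intro c pfam_minus R X) auto
qed

lemma displ_pfam: "k < n \<Longrightarrow> l < n \<Longrightarrow> pfam n 1 (\<lambda>\<epsilon> M. displ \<epsilon> M $$ (k, l))"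
  by (simp only: displ_entry)
     (intro pfam_cmult[of "\<lambda>\<epsilon>. 1 / complex_of_real \<epsilon>"] hol_ext_inverse pfam_minus pfam_entry pfam_const[of "\<lambda>_. c" for c] hol_ext_const, auto)

lemma t1_mat_mult:
  assumes A: "A \<in> carrier_mat n n" "B \<in> carrier_mat n n" and ij: "i < n" "j < n"
    and G: "\<And>\<epsilon>. G \<epsilon> \<in> carrier_mat n n" "L \<in> carrier_mat n n"
    "\<And>k l. k < n \<Longrightarrow> l < n \<Longrightarrow> t1 (\<lambda>\<epsilon>. G \<epsilon> $$ (k, l)) (L $$ (k, l))"
  shows "t1 (\<lambda>\<epsilon>. (A * G \<epsilon> * B) $$ (i, j)) ((A * L * B) $$ (i, j))"
proof -
  have e: "(A * M * B) $$ (i, j) = (\<Sum>l<n. B $$ (l, j) * (\<Sum>k<n. A $$ (i, k) * M $$ (k, l)))"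
    if "M \<in> carrier_mat n n" for M
    by (rule mult_entry3) (use A ij that in auto)
  show ?thesis
    unfolding e[OF G(1)] e[OF G(2)] by (intro t1_sum t1_cmult G(3)) auto
qed

lemma coord_t1:
  assumes ij: "i < n" "j < n"
    and G: "\<And>\<epsilon>. G \<epsilon> \<in> carrier_mat n n" "L \<in> carrier_mat n n"
    "\<And>k l. k < n \<Longrightarrow> l < n \<Longrightarrow> t1 (\<lambda>\<epsilon>. G \<epsilon> $$ (k, l)) (L $$ (k, l))"
  shows "t1 (\<lambda>\<epsilon>. coordX i j (G \<epsilon>)) (coordX i j L)" "t1 (\<lambda>\<epsilon>. coordZ i j (G \<epsilon>)) (coordZ i j L)"
proof -
  have R: "t1 (\<lambda>\<epsilon>. Rm (G \<epsilon>) $$ (k, l)) (Rm L $$ (k, l))" if "k < n" "l < n" for k l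
    unfolding Rm_def by (rule t1_mat_mult) (use that G in auto)
  show X: "t1 (\<lambda>\<epsilon>. coordX i j (G \<epsilon>)) (coordX i j L)"
    unfolding coordX_def using ij by (intro t1_cmult t1_add t1_diff R) auto
  show "t1 (\<lambda>\<epsilon>. coordZ i j (G \<epsilon>)) (coordZ i j L)"
    unfolding coordZ_def using ij by (intro t1_cmult t1_diff R X) auto
qed

lemma displ_t1:
  assumes F: "m3 n F (1\<^sub>m n) L C" and kl: "k < n" "l < n"
  shows "t1 (\<lambda>\<epsilon>. displ \<epsilon> (F \<epsilon>) $$ (k, l)) (L $$ (k, l))"
proof -
  have "bO 3 (\<lambda>\<epsilon>. F \<epsilon> $$ (k, l) - (1\<^sub>m n $$ (k, l) + of_real \<epsilon> * L $$ (k, l) + of_real \<epsilon> ^ 2 * C $$ (k, l)))"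
    using m3_entry[OF F kl] by (simp add: t3_def)
  then have "bO 2 (\<lambda>\<epsilon>. F \<epsilon> $$ (k, l) - (1\<^sub>m n $$ (k, l) + of_real \<epsilon> * L $$ (k, l) + of_real \<epsilon> ^ 2 * C $$ (k, l)))"
    by (rule bO_mono) simp
  from bO_add[OF this bO_cmult[OF bO_eps_power[of 2], of "C $$ (k, l)"]]
  have "bO (1 + 1) (\<lambda>\<epsilon>. F \<epsilon> $$ (k, l) - (1\<^sub>m n $$ (k, l) + of_real \<epsilon> * L $$ (k, l)))"
    by (simp add: algebra_simps numeral_2_eq_2)
  from bO_divide[OF this]
  show ?thesis
    unfolding t1_def by (rule bO_cong) (simp add: displ_entry kl field_simps)
qed

text \<open>The product \<open>x y\<^sup>-\<^sup>1 y' z\<^sup>-\<^sup>1\<close>, where \<open>x\<close>, \<open>y\<close>, \<open>y'\<close>, \<open>z\<close> have the generators \<open>s\<close>, \<open>A\<close>, \<open>A'\<close>, \<open>s'\<close>.\<close>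

definition xyz :: "real \<Rightarrow> complex mat \<Rightarrow> complex mat \<Rightarrow> complex mat \<Rightarrow> complex mat \<Rightarrow> complex mat" where
  "xyz \<epsilon> s A A' s' = xf \<epsilon> s * (exp_fam \<epsilon> (- A) * exp_fam \<epsilon> A') * zf \<epsilon> (- s')"

lemma m3_conj:
  assumes F: "m3 n F (1\<^sub>m n) L C" and P: "P \<in> carrier_mat n n" "P' \<in> carrier_mat n n" "P * P' = 1\<^sub>m n"
  shows "\<exists>C. m3 n (\<lambda>\<epsilon>. P * F \<epsilon> * P') (1\<^sub>m n) (P * L * P') C"
proof -
  have L: "L \<in> carrier_mat n n" using m3_carrier[OF F] by blast
  have "(P * 1\<^sub>m n) * P' = 1\<^sub>m n" using P by simp
  moreover have "(P * 1\<^sub>m n) * 0\<^sub>m n n + (P * L) * P' = P * L * P'" using P L by (simp add: closed_n)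
  ultimately show ?thesis
    using m3_mult[OF m3_cmult[OF F P(1)] m3_const[OF P(2)]] by auto
qed

lemma m3_unit_mult:
  assumes F: "m3 n F (1\<^sub>m n) L C" and G: "m3 n G (1\<^sub>m n) L' C'"
  shows "\<exists>C. m3 n (\<lambda>\<epsilon>. F \<epsilon> * G \<epsilon>) (1\<^sub>m n) (L' + L) C"
proof -
  have "L \<in> carrier_mat n n" "L' \<in> carrier_mat n n" using m3_carrier[OF F] m3_carrier[OF G] by blast+
  then show ?thesis using m3_mult[OF F G] by auto
qed

lemma xyz_expansion:
  assumes "s \<in> carrier_mat n n" "A \<in> carrier_mat n n" "A' \<in> carrier_mat n n" "s' \<in> carrier_mat n n"
  shows "\<exists>L C. m3 n (\<lambda>\<epsilon>. xyz \<epsilon> s A A' s') (1\<^sub>m n) L C \<and> (A = A' \<longrightarrow> L = tangent s s')"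
proof -
  obtain K1 where 1: "m3 n (\<lambda>\<epsilon>. xf \<epsilon> s) (1\<^sub>m n) (Dm * s * D_mat n) K1"
    using m3_conj[OF m3_exp[OF assms(1)] D_carrier(2,1) D_Dm(2)] by (auto simp: xf_def)
  obtain C2 where 2: "m3 n (\<lambda>\<epsilon>. zf \<epsilon> (- s')) (1\<^sub>m n) (D_mat n * (- s') * Dm) C2"
    using m3_conj[OF m3_exp[of "- s'"] D_carrier(1,2) D_Dm(1)] assms(4) by (auto simp: zf_def)
  obtain C3 where 3: "m3 n (\<lambda>\<epsilon>. exp_fam \<epsilon> (- A) * exp_fam \<epsilon> A') (1\<^sub>m n) (A' + - A) C3"
    using m3_unit_mult[OF m3_exp[of "- A"] m3_exp[OF assms(3)]] assms(2) by auto
  obtain C4 where 4: "m3 n (\<lambda>\<epsilon>. xf \<epsilon> s * (exp_fam \<epsilon> (- A) * exp_fam \<epsilon> A')) (1\<^sub>m n) (A' + - A + Dm * s * D_mat n) C4"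
    using m3_unit_mult[OF 1 3] by auto
  obtain C5 where 5: "m3 n (\<lambda>\<epsilon>. xyz \<epsilon> s A A' s') (1\<^sub>m n) (D_mat n * (- s') * Dm + (A' + - A + Dm * s * D_mat n)) C5"
    using m3_unit_mult[OF 4 2] by (auto simp: xyz_def)
  have "D_mat n * (- s') * Dm + (A + - A + Dm * s * D_mat n) = tangent s s'"
  proof -
    have e: "D_mat n * (- s') * Dm = - (D_mat n * s' * Dm)"
      using assms(4) carrier_matD[OF D_carrier(1)] carrier_matD[OF D_carrier(2)] by simp
    define X where "X = Dm * s * D_mat n"
    define Z where "Z = D_mat n * s' * Dm"
    have "X \<in> carrier_mat n n" "Z \<in> carrier_mat n n" using assms by (auto simp: X_def Z_def)
    then show ?thesis
      unfolding e tangent_def X_def[symmetric] Z_def[symmetric] using assms(2) by (intro eq_matI) auto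
  qed
  then show ?thesis using 5 by blast
qed

end

section \<open>Tangent vectors\<close>

text \<open>The curve \<open>F\<close> of matrices has the velocity \<open>L\<close> at 0, entry by entry.\<close>

definition md :: "nat \<Rightarrow> (real \<Rightarrow> complex mat) \<Rightarrow> complex mat \<Rightarrow> bool" where
  "md n F L \<longleftrightarrow> (\<forall>t. F t \<in> carrier_mat n n) \<and> L \<in> carrier_mat n n \<and>
     (\<forall>i<n. \<forall>j<n. ((\<lambda>t. F t $$ (i, j)) has_vector_derivative L $$ (i, j)) (at 0))"

lemma md_mult:
  assumes F: "md n F L" and G: "md n G L'"
  shows "md n (\<lambda>t. F t * G t) (F 0 * L' + L * G 0)"
proof -
  have c: "F t \<in> carrier_mat n n" "G t \<in> carrier_mat n n" "L \<in> carrier_mat n n" "L' \<in> carrier_mat n n" for t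
    using F G by (auto simp: md_def)
  have "((\<lambda>t. (F t * G t) $$ (i, j)) has_vector_derivative (F 0 * L' + L * G 0) $$ (i, j)) (at 0)"
    if ij: "i < n" "j < n" for i j
  proof -
    have "((\<lambda>t. \<Sum>k<n. F t $$ (i, k) * G t $$ (k, j)) has_vector_derivative
        (\<Sum>k<n. F 0 $$ (i, k) * L' $$ (k, j) + L $$ (i, k) * G 0 $$ (k, j))) (at 0)"
      using F G ij by (intro has_vector_derivative_sum has_vector_derivative_mult) (auto simp: md_def)
    moreover have "(F t * G t) $$ (i, j) = (\<Sum>k<n. F t $$ (i, k) * G t $$ (k, j))" for t
      by (rule mult_entry) (use c ij in auto)
    moreover have "(F 0 * L' + L * G 0) $$ (i, j) = (\<Sum>k<n. F 0 $$ (i, k) * L' $$ (k, j) + L $$ (i, k) * G 0 $$ (k, j))"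
    proof -
      have "(F 0 * L' + L * G 0) $$ (i, j) = (F 0 * L') $$ (i, j) + (L * G 0) $$ (i, j)"
        using c(1)[of 0] c(2)[of 0] c(3,4) ij by auto
      then show ?thesis
        using mult_entry[OF c(1,4) ij] mult_entry[OF c(3,2) ij] by (simp add: sum.distrib)
    qed
    ultimately show ?thesis by simp
  qed
  then show ?thesis using c by (auto simp: md_def intro!: mult_carrier_mat[of _ n n] add_carrier_mat)
qed

lemma md_const: "A \<in> carrier_mat n n \<Longrightarrow> md n (\<lambda>_. A) (0\<^sub>m n n)"
  by (auto simp: md_def)

lemma md_exp:
  assumes A: "A \<in> carrier_mat n n"
  shows "md n (\<lambda>t. exp_fam t A) A"
proof -
  have "((\<lambda>t. exp_fam t A $$ (i, j)) has_vector_derivative A $$ (i, j)) (at 0)" if ij: "i < n" "j < n" for i j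
  proof -
    define c where "c = (\<lambda>k. (A ^\<^sub>m k) $$ (i, j) / fact k)"
    define F where "F = (\<lambda>z. mat_exp (z \<cdot>\<^sub>m A) $$ (i, j))"
    have sums: "(\<lambda>k. c k * z ^ k) sums F z" for z
      unfolding c_def F_def by (rule mat_exp_power_series[OF A ij])
    have "((\<lambda>z. suminf (\<lambda>k. c k * z ^ k)) has_field_derivative suminf (\<lambda>k. diffs c k * 0 ^ k)) (at 0)"
      by (rule termdiffs_strong_converges_everywhere) (use sums in \<open>auto simp: sums_iff\<close>)
    moreover have "(\<lambda>z. suminf (\<lambda>k. c k * z ^ k)) = F" using sums by (auto simp: sums_iff)
    moreover have "suminf (\<lambda>k. diffs c k * 0 ^ k) = diffs c 0"
      by (rule sums_unique[symmetric]) (rule powser_sums_zero)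
    moreover have "diffs c 0 = A $$ (i, j)" using A ij by (simp add: diffs_def c_def)
    ultimately have "(F has_field_derivative A $$ (i, j)) (at (of_real 0))" by simp
    from has_vector_derivative_real_field[OF this]
    show ?thesis by (simp add: F_def exp_fam_def)
  qed
  moreover have "exp_fam \<epsilon> A \<in> carrier_mat n n" for \<epsilon>
    using A by (rule exp_fam_square)
  ultimately show ?thesis using A by (auto simp: md_def)
qed

context even_size begin

lemma exp_fam_0: "A \<in> carrier_mat n n \<Longrightarrow> exp_fam 0 A = 1\<^sub>m n"
  using mat_exp_zero by (simp add: exp_fam_def)

lemma md_conj:
  assumes F: "md n F L" "F 0 = 1\<^sub>m n" and P: "P \<in> carrier_mat n n" "P' \<in> carrier_mat n n"
  shows "md n (\<lambda>t. P * F t * P') (P * L * P')"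
proof -
  have L: "L \<in> carrier_mat n n" using F by (simp add: md_def)
  have 1: "md n (\<lambda>t. P * F t) (P * L)"
    using md_mult[OF md_const[OF P(1)] F(1)] F(2) P L by (simp add: closed_n)
  have "P * F 0 \<in> carrier_mat n n" using F P by simp
  then have "P * F 0 * 0\<^sub>m n n + P * L * P' = P * L * P'" using P L F(2) by (simp add: closed_n)
  then show ?thesis using md_mult[OF 1 md_const[OF P(2)]] by simp
qed

lemma tangent_Lie:
  assumes s: "s \<in> S_set n" "s' \<in> S_set n"
  shows "tangent s s' \<in> Lie_SU n"
proof -
  have c: "s \<in> carrier_mat n n" "s' \<in> carrier_mat n n" "- s' \<in> carrier_mat n n" using s by auto
  define \<gamma> where "\<gamma> = (\<lambda>t. xf t s * zf t (- s'))"
  have x0: "xf 0 s = 1\<^sub>m n" and z0: "zf 0 (- s') = 1\<^sub>m n"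
    using c by (simp_all add: xf_def zf_def exp_fam_0 D_Dm)
  have x: "md n (\<lambda>t. xf t s) (Dm * s * D_mat n)" and z: "md n (\<lambda>t. zf t (- s')) (D_mat n * (- s') * Dm)"
    unfolding xf_def zf_def using c by (intro md_conj md_exp exp_fam_0 D_carrier; simp)+
  have e: "D_mat n * (- s') * Dm = - (D_mat n * s' * Dm)"
    using c carrier_matD[OF D_carrier(1)] carrier_matD[OF D_carrier(2)] by simp
  have "xf 0 s * (D_mat n * (- s') * Dm) + Dm * s * D_mat n * zf 0 (- s') = tangent s s'"
  proof -
    define X where "X = Dm * s * D_mat n"
    define Z where "Z = D_mat n * s' * Dm"
    have "X \<in> carrier_mat n n" "Z \<in> carrier_mat n n" using c by (auto simp: X_def Z_def)
    then show ?thesis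
      unfolding e tangent_def X_def[symmetric] Z_def[symmetric] x0 z0 by (intro eq_matI) auto
  qed
  then have "md n \<gamma> (tangent s s')" using md_mult[OF x z] by (simp add: \<gamma>_def)
  moreover have "\<gamma> t \<in> carrier (SU n)" for t
    unfolding \<gamma>_def using xf_SU[OF s(1)] zf_SU[OF S_uminus[OF s(2)]] by (simp add: SU_mult_closed)
  moreover have "\<gamma> 0 = 1\<^sub>m n" by (simp add: \<gamma>_def x0 z0)
  ultimately show ?thesis by (auto simp: Lie_SU_def md_def)
qed

lemma Lie_carrier: "M \<in> Lie_SU n \<Longrightarrow> M \<in> carrier_mat n n"
  by (simp add: Lie_SU_def)

lemma continuous_map_cmult:
  assumes "continuous_map X euclidean f" shows "continuous_map X euclidean (\<lambda>x. c * f x :: complex)"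
proof -
  have "continuous_map euclidean euclidean (\<lambda>z. c * z :: complex)" by (auto intro!: continuous_intros)
  from continuous_map_compose[OF assms this] show ?thesis by (simp add: o_def)
qed

lemma continuous_map_neg_cnj:
  assumes "continuous_map X euclidean f" shows "continuous_map X euclidean (\<lambda>x. - cnj (f x))"
proof -
  have "continuous_map euclidean euclidean (\<lambda>z. - cnj z)" by (auto intro!: continuous_intros)
  from continuous_map_compose[OF assms this] show ?thesis by (simp add: o_def)
qed

text \<open>Here \<open>C\<^sup>d\<close> is identified with the functions on \<open>upos\<close> by a bijection \<open>h\<close>, and the maps from \<open>C\<^sup>d\<close> send \<open>v\<close> to the
  conjugates of \<open>skew_of v\<close>, which are continuous but only real linear in \<open>v\<close>.\<close>

lemma tangent_coordinates:
  "\<exists>f_X f_Z p_X p_Z.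
     continuous_mat_map n (d_XZ n) (D_inv_S_D n) f_X \<and>
     continuous_mat_map n (d_XZ n) (D_S_D_inv n) f_Z \<and>
     polynomial_map_on n (Lie_SU n) (d_XZ n) p_X \<and>
     polynomial_map_on n (Lie_SU n) (d_XZ n) p_Z \<and>
     (\<forall>v\<in>topspace (Cspace (d_XZ n)). \<forall>v'\<in>topspace (Cspace (d_XZ n)).
        f_X v - f_Z v' \<in> Lie_SU n \<and>
        p_X (f_X v - f_Z v') = v \<and> p_Z (f_X v - f_Z v') = v')"
proof -
  define d where "d = d_XZ n"
  obtain h where h: "bij_betw h {0..<d} upos"
    using ex_bij_betw_nat_finite[OF finite_upos] by (auto simp: card_upos d_def)
  define g where "g = inv_into {0..<d} h"
  have hpos: "h k \<in> upos" if "k < d" for k using bij_betw_apply[OF h, of k] that by simp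
  have gh: "g (h k) = k" if "k < d" for k
    unfolding g_def using h that by (intro inv_into_f_f) (auto simp: bij_betw_def)
  have g: "g e < d" if "e \<in> upos" for e
    using bij_betw_apply[OF bij_betw_inv_into[OF h], of e] that by (simp add: g_def)
  define E where "E = (\<lambda>v. skew_of (\<lambda>e. v (g e)))"
  have ES: "E v \<in> S_set n" for v by (simp add: E_def skew_of_S)
  then have Ec: "E v \<in> carrier_mat n n" for v by simp
  define fX fZ where "fX = (\<lambda>v. Dm * E v * D_mat n)" and "fZ = (\<lambda>v. D_mat n * E v * Dm)"
  define pX pZ where "pX = (\<lambda>M. \<lambda>k\<in>{..<d}. coordX (fst (h k)) (snd (h k)) M)"
    and "pZ = (\<lambda>M. \<lambda>k\<in>{..<d}. coordZ (fst (h k)) (snd (h k)) M)"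
  have top: "topspace (Cspace d) = (\<Pi>\<^sub>E k\<in>{..<d}. UNIV)" by (simp add: Cspace_def)
  have E_cont: "continuous_map (Cspace d) euclidean (\<lambda>v. E v $$ (i, j))" if ij: "i < n" "j < n" for i j
  proof -
    have proj: "continuous_map (Cspace d) euclidean (\<lambda>v. v (g e))" if "e \<in> upos" for e
      unfolding Cspace_def using continuous_map_product_projection[of "g e" "{..<d}" "\<lambda>_. euclidean"] g[OF that] by simp
    consider "(i, j) \<in> upos" | "(i, j) \<notin> upos" "(j, i) \<in> upos" | "(i, j) \<notin> upos" "(j, i) \<notin> upos" by blast
    then show ?thesis
    proof cases
      case 2
      then show ?thesis using continuous_map_neg_cnj[OF proj[OF 2(2)]] ij by (simp add: E_def skew_of_def)
    qed (use ij proj in \<open>simp_all add: E_def skew_of_def\<close>)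
  qed
  have PEP: "continuous_map (Cspace d) euclidean (\<lambda>v. (P * E v * P') $$ (i, j))"
    if P: "P \<in> carrier_mat n n" "P' \<in> carrier_mat n n" and ij: "i < n" "j < n" for P P' i j
  proof -
    have e: "(P * E v * P') $$ (i, j) = (\<Sum>l<n. P' $$ (l, j) * (\<Sum>k<n. P $$ (i, k) * E v $$ (k, l)))" for v
      by (rule mult_entry3) (use P ij Ec in auto)
    show ?thesis unfolding e using ij by (intro continuous_map_sum continuous_map_cmult E_cont) auto
  qed
  have contX: "continuous_mat_map n d (D_inv_S_D n) fX"
    unfolding continuous_mat_map_def fX_def D_inv_S_D_def D_inv_eq using ES PEP D_carrier by blast
  have contZ: "continuous_mat_map n d (D_S_D_inv n) fZ"
    unfolding continuous_mat_map_def fZ_def D_S_D_inv_def D_inv_eq using ES PEP D_carrier by blast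
  have poly: "\<exists>P\<in>mat_polys n. \<forall>M\<in>Lie_SU n. F M = eval_mat_poly P M" if F: "pfam n 1 (\<lambda>\<epsilon>. F)" for F
  proof -
    obtain p :: "real \<Rightarrow> mat_poly" where "\<forall>\<epsilon>. p \<epsilon> \<in> mat_polys n"
      "\<forall>\<epsilon>>0. \<forall>M\<in>carrier_mat n n. eval_mat_poly (p \<epsilon>) M = F M"
      using pfam_poly_family[OF F] by blast
    \<comment> \<open>The function does not depend on the parameter, so any value of it, such as 1, serves.\<close>
    then show ?thesis using Lie_carrier by (intro bexI[of _ "p 1"] ballI) simp_all
  qed
  have L: "pfam n 1 (\<lambda>\<epsilon>. coordX (fst (h k)) (snd (h k)))" "pfam n 1 (\<lambda>\<epsilon>. coordZ (fst (h k)) (snd (h k)))" if "k < d" for k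
  proof -
    have b: "fst (h k) < n" "snd (h k) < n"
      using hpos[OF that] upos_bounds[of "fst (h k)" "snd (h k)"] by simp_all
    show "pfam n 1 (\<lambda>\<epsilon>. coordX (fst (h k)) (snd (h k)))"
      by (rule coord_pfam(1)[where G = "\<lambda>\<epsilon> M. M", OF b]) (auto intro: pfam_entry)
    show "pfam n 1 (\<lambda>\<epsilon>. coordZ (fst (h k)) (snd (h k)))"
      by (rule coord_pfam(2)[where G = "\<lambda>\<epsilon> M. M", OF b]) (auto intro: pfam_entry)
  qed
  have polys: "polynomial_map_on n (Lie_SU n) d pX" "polynomial_map_on n (Lie_SU n) d pZ"
    unfolding polynomial_map_on_def top pX_def pZ_def using poly[OF L(1)] poly[OF L(2)] by auto
  have inverse: "fX v - fZ v' \<in> Lie_SU n \<and> pX (fX v - fZ v') = v \<and> pZ (fX v - fZ v') = v'"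
    if v: "v \<in> topspace (Cspace d)" "v' \<in> topspace (Cspace d)" for v v'
  proof -
    have t: "fX v - fZ v' = tangent (E v) (E v')" by (simp add: fX_def fZ_def tangent_def)
    have co: "coordX (fst (h k)) (snd (h k)) (tangent (E v) (E v')) = v k \<and> coordZ (fst (h k)) (snd (h k)) (tangent (E v) (E v')) = v' k"
      if k: "k < d" for k
    proof -
      obtain i j where e: "h k = (i, j)" by (cases "h k")
      then have p: "(i, j) \<in> upos" using hpos[OF k] by simp
      then show ?thesis
        using coordinates[OF ES[of v] ES[of v'] upos_bounds(1,2,4,3)[OF p]] gh[OF k] e
        by (simp add: E_def skew_of_entry)
    qed
    have "pX (fX v - fZ v') = v" "pZ (fX v - fZ v') = v'"
    proof -
      have ext: "(\<lambda>k\<in>{..<d}. u k) = w" if "w \<in> (\<Pi>\<^sub>E k\<in>{..<d}. UNIV)" "\<And>k. k < d \<Longrightarrow> u k = w k"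
        for u w :: "nat \<Rightarrow> complex"
      proof
        fix k show "(\<lambda>k\<in>{..<d}. u k) k = w k"
          by (cases "k < d") (use that PiE_arb[OF that(1), of k] in simp_all)
      qed
      show "pX (fX v - fZ v') = v" "pZ (fX v - fZ v') = v'"
        unfolding t pX_def pZ_def using v[unfolded top] co by (auto intro!: ext)
    qed
    then show ?thesis using tangent_Lie[OF ES ES] t by simp
  qed
  show ?thesis
    unfolding d_def[symmetric]
    by (rule exI[of _ fX], rule exI[of _ fZ], rule exI[of _ pX], rule exI[of _ pZ],
        intro conjI ballI contX contZ polys, simp_all add: inverse)
qed

section \<open>The invariant family\<close>

text \<open>The generators of the elements of \<open>Y_fam n q\<close>.\<close>

definition lat :: "nat \<Rightarrow> complex mat set" where
  "lat q = {A \<in> S_set n. \<forall>i<n. \<forall>j<n. A $$ (i, j) \<in> I_set q}"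

lemma I_set_image: "I_set q = (\<lambda>(a, b). Complex (of_int a) (of_int b)) `
    ({- \<lceil>sqrt (real q) / 2\<rceil>..\<lceil>sqrt (real q) / 2\<rceil>} \<times> {- \<lceil>sqrt (real q) / 2\<rceil>..\<lceil>sqrt (real q) / 2\<rceil>})"
  by (auto simp: I_set_def abs_le_iff image_iff)

lemma ceiling_sqrt_nonneg: "0 \<le> \<lceil>sqrt (real q) / 2\<rceil>"
  using le_of_int_ceiling[of "sqrt (real q) / 2"] real_sqrt_ge_zero[of "real q"] by linarith

lemma finite_I_set: "finite (I_set q)"
  unfolding I_set_image by (intro finite_imageI finite_cartesian_product) auto

lemma card_I_set: "card (I_set q) \<ge> q"
proof -
  define m where "m = \<lceil>sqrt (real q) / 2\<rceil>"
  have m0: "m \<ge> 0" unfolding m_def by (rule ceiling_sqrt_nonneg)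
  have "card (I_set q) = card ({- m..m} \<times> {- m..m})"
    unfolding I_set_image m_def[symmetric] by (rule card_image) (auto simp: inj_on_def)
  also have "\<dots> = (nat (2 * m + 1))\<^sup>2" by (simp add: power2_eq_square card_cartesian_product)
  finally have "real (card (I_set q)) = (2 * real_of_int m + 1)\<^sup>2" using m0 by simp
  moreover have "sqrt (real q) \<le> 2 * real_of_int m + 1"
    using le_of_int_ceiling[of "sqrt (real q) / 2"] unfolding m_def by linarith
  then have "(sqrt (real q))\<^sup>2 \<le> (2 * real_of_int m + 1)\<^sup>2" by (intro power_mono) auto
  ultimately show ?thesis by simp
qed

lemma I_set_closed: "0 \<in> I_set q" "z \<in> I_set q \<Longrightarrow> - cnj z \<in> I_set q"
proof -
  show "0 \<in> I_set q" using ceiling_sqrt_nonneg[of q] unfolding I_set_def by (auto intro!: exI[of _ 0] simp: complex_eq_iff)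
  assume "z \<in> I_set q"
  then obtain a b where "z = Complex (of_int a) (of_int b)" "\<bar>a\<bar> \<le> \<lceil>sqrt (real q) / 2\<rceil>" "\<bar>b\<bar> \<le> \<lceil>sqrt (real q) / 2\<rceil>"
    by (auto simp: I_set_def)
  then have "- cnj z = Complex (of_int (- a)) (of_int b) \<and> \<bar>- a\<bar> \<le> \<lceil>sqrt (real q) / 2\<rceil> \<and> \<bar>b\<bar> \<le> \<lceil>sqrt (real q) / 2\<rceil>"
    by (simp add: complex_eq_iff)
  then show "- cnj z \<in> I_set q" unfolding I_set_def by blast
qed

lemma skew_of_lat: "(\<And>e. e \<in> upos \<Longrightarrow> w e \<in> I_set q) \<Longrightarrow> skew_of w \<in> lat q"
  unfolding lat_def using skew_of_S[of w] I_set_closed(1)[of q] I_set_closed(2)[of _ q] by (auto simp: skew_of_def)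

lemma lat_image: "lat q = skew_of ` (\<Pi>\<^sub>E e\<in>upos. I_set q)"
proof
  show "lat q \<subseteq> skew_of ` (\<Pi>\<^sub>E e\<in>upos. I_set q)"
  proof
    fix A assume A: "A \<in> lat q"
    define w where "w = restrict (\<lambda>e. A $$ e) upos"
    have "skew_of w = skew_of (\<lambda>e. A $$ e)" by (auto simp: skew_of_def w_def intro!: eq_matI)
    then have "A = skew_of w" using S_eq_skew_of[of A] A by (simp add: lat_def)
    moreover have "w \<in> (\<Pi>\<^sub>E e\<in>upos. I_set q)" using A upos_bounds by (auto simp: w_def lat_def)
    ultimately show "A \<in> skew_of ` (\<Pi>\<^sub>E e\<in>upos. I_set q)" by blast
  qed
qed (auto intro!: skew_of_lat)

lemma finite_lat: "finite (lat q)"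
  unfolding lat_image by (intro finite_imageI finite_PiE finite_I_set) auto

lemma skew_of_inj: "inj_on skew_of (\<Pi>\<^sub>E e\<in>upos. T e)"
proof (rule inj_onI)
  fix w u assume wu: "w \<in> (\<Pi>\<^sub>E e\<in>upos. T e)" "u \<in> (\<Pi>\<^sub>E e\<in>upos. T e)" "skew_of w = skew_of u"
  have "w e = u e" if "e \<in> upos" for e
    using skew_of_entry[of "fst e" "snd e" w] skew_of_entry[of "fst e" "snd e" u] that wu(3) by simp
  then show "w = u" using wu(1,2) by (intro PiE_ext) auto
qed

lemma card_lat: "card (lat q) \<ge> q ^ d_XZ n"
proof -
  have "card (lat q) = card (\<Pi>\<^sub>E e\<in>upos. I_set q)" unfolding lat_image by (rule card_image[OF skew_of_inj])
  also have "\<dots> = card (I_set q) ^ d_XZ n" by (simp add: card_PiE card_upos)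
  finally show ?thesis using card_I_set[of q] by (simp add: power_mono)
qed

lemma latD:
  assumes "A \<in> lat q" shows "A \<in> S_set n" "A \<in> carrier_mat n n" "i < n \<Longrightarrow> j < n \<Longrightarrow> A $$ (i, j) \<in> I_set q"
  using assms by (auto simp: lat_def)

lemma Y_fam_eq: "Y_fam n q \<alpha> = (\<lambda>A. \<lambda>\<epsilon>\<in>{0<..<\<alpha>}. exp_fam \<epsilon> A) ` lat q"
  by (auto simp: Y_fam_def lat_def)

lemma at_eps_image:
  assumes "\<epsilon> \<in> {0<..<\<alpha>}"
  shows "at_eps ((\<lambda>a. \<lambda>\<epsilon>\<in>{0<..<\<alpha>}. F a \<epsilon>) ` W) \<epsilon> = (\<lambda>a. F a \<epsilon>) ` W"
proof -
  have "at_eps Y \<epsilon> = (\<lambda>x. x \<epsilon>) ` Y" for Y by (auto simp: at_eps_def)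
  then show ?thesis using assms by (simp add: image_image)
qed

lemma finite_bO:
  assumes "finite I" "\<And>i. i \<in> I \<Longrightarrow> bO 1 (F i)"
  obtains C where "\<forall>\<^sub>F \<epsilon> in at_right 0. \<forall>i\<in>I. cmod (F i \<epsilon>) \<le> C * \<epsilon>"
proof -
  have "\<forall>i\<in>I. \<exists>K. \<forall>\<^sub>F \<epsilon> in at_right 0. cmod (F i \<epsilon>) \<le> K * \<epsilon>"
    using assms(2) by (simp add: bO_def)
  then obtain K where K: "\<And>i. i \<in> I \<Longrightarrow> \<forall>\<^sub>F \<epsilon> in at_right 0. cmod (F i \<epsilon>) \<le> K i * \<epsilon>" by metis
  have "\<forall>\<^sub>F \<epsilon> in at_right 0. \<forall>i\<in>I. cmod (F i \<epsilon>) \<le> K i * \<epsilon>"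
    using assms(1) K by (intro eventually_ball_finite) auto
  moreover have "\<forall>\<^sub>F \<epsilon> in at_right 0. (0 :: real) < \<epsilon>" by (rule eventually_at_right_less)
  ultimately have "\<forall>\<^sub>F \<epsilon> in at_right 0. \<forall>i\<in>I. cmod (F i \<epsilon>) \<le> (\<Sum>i\<in>I. \<bar>K i\<bar>) * \<epsilon>"
  proof eventually_elim
    case (elim \<epsilon>)
    show ?case
    proof
      fix i assume i: "i \<in> I"
      have "\<bar>K i\<bar> \<le> (\<Sum>i\<in>I. \<bar>K i\<bar>)"
        by (rule member_le_sum[of i I "\<lambda>i. \<bar>K i\<bar>"]) (use i assms(1) in auto)
      then have "K i \<le> (\<Sum>i\<in>I. \<bar>K i\<bar>)" by linarith
      then have "K i * \<epsilon> \<le> (\<Sum>i\<in>I. \<bar>K i\<bar>) * \<epsilon>" using elim by (intro mult_right_mono) auto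
      then show "cmod (F i \<epsilon>) \<le> (\<Sum>i\<in>I. \<bar>K i\<bar>) * \<epsilon>" using elim(1) i order_trans by blast
    qed
  qed
  then show ?thesis by (rule that)
qed

lemma invariant_family:
  "\<exists>C::nat. \<forall>q\<ge>1. \<exists>\<alpha>>0. \<exists>p\<^sub>0.
     poly_family n (C * q) \<alpha> p\<^sub>0 \<and>
     (\<forall>\<epsilon>\<in>{0<..<\<alpha>}. p\<^sub>0 \<epsilon> \<in> Inv_polys n (X_set n \<epsilon>) (Z_set n \<epsilon>)) \<and>
     O_eps (\<lambda>\<epsilon>. {1\<^sub>m n}) (\<lambda>g \<epsilon>. eval_mat_poly (p\<^sub>0 \<epsilon>) g - 1) \<and>
     O_eps (\<lambda>\<epsilon>. (set_inv\<^bsub>SU n\<^esub> (at_eps (Y_fam n q \<alpha>) \<epsilon>)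
                    <#>\<^bsub>SU n\<^esub> at_eps (Y_fam n q \<alpha>) \<epsilon>) - {1\<^sub>m n})
       (\<lambda>g \<epsilon>. eval_mat_poly (p\<^sub>0 \<epsilon>) g)"
  (is "\<exists>C. \<forall>q\<ge>1. ?P C q")
proof (intro exI[of _ "form_bound * n"] allI impI)
  fix q :: nat assume q: "q \<ge> 1"
  obtain p :: "real \<Rightarrow> mat_poly" where "\<forall>\<alpha>. poly_family n (form_bound * n * q) \<alpha> p" "\<forall>\<epsilon>. p \<epsilon> \<in> mat_polys n"
    "\<forall>\<epsilon>>0. \<forall>M\<in>carrier_mat n n. eval_mat_poly (p \<epsilon>) M = inv_poly q \<epsilon> M"
    using pfam_poly_family[OF inv_poly_pfam] by blast
  then have p: "\<And>\<alpha>. poly_family n (form_bound * n * q) \<alpha> p" "\<And>\<epsilon>. p \<epsilon> \<in> mat_polys n"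
    "\<And>\<epsilon> M. \<epsilon> > 0 \<Longrightarrow> M \<in> carrier_mat n n \<Longrightarrow> eval_mat_poly (p \<epsilon>) M = inv_poly q \<epsilon> M"
    by blast+
  have ev: "\<forall>\<^sub>F \<epsilon> in at_right 0. \<epsilon> \<in> {0<..<1::real}" by (rule eventually_at_right_real) simp
  have "p \<epsilon> \<in> Inv_polys n (X_set n \<epsilon>) (Z_set n \<epsilon>)" if \<epsilon>: "\<epsilon> \<in> {0<..<1}" for \<epsilon>
    unfolding Inv_polys_def
  proof (intro CollectI conjI ballI p(2))
    fix x z M :: "complex mat" assume "x \<in> X_set n \<epsilon>" "z \<in> Z_set n \<epsilon>" and M: "M \<in> carrier_mat n n"
    then obtain A B where AB: "A \<in> S_set n" "B \<in> S_set n" "x = xf \<epsilon> A" "z = zf \<epsilon> B"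
      by (auto simp: X_set_def Z_set_def D_inv_eq xf_def zf_def)
    then have "x * M * z \<in> carrier_mat n n" using M by (auto intro!: mult_carrier_mat[of _ n n])
    then show "eval_mat_poly (p \<epsilon>) (x * M * z) = eval_mat_poly (p \<epsilon>) M"
      using \<epsilon> M AB by (simp add: p(3) inv_poly_invariant)
  qed
  moreover have "O_eps (\<lambda>\<epsilon>. {1\<^sub>m n}) (\<lambda>g \<epsilon>. eval_mat_poly (p \<epsilon>) g - 1)"
    unfolding O_eps_def
    by (rule exI[of _ 0], rule eventually_mono[OF ev]) (auto simp: p(3) inv_poly_one)
  moreover have "O_eps (\<lambda>\<epsilon>. (set_inv\<^bsub>SU n\<^esub> (at_eps (Y_fam n q 1) \<epsilon>) <#>\<^bsub>SU n\<^esub> at_eps (Y_fam n q 1) \<epsilon>) - {1\<^sub>m n})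
       (\<lambda>g \<epsilon>. eval_mat_poly (p \<epsilon>) g)"
  proof -
    define T where "T = {(A, A'). A \<in> lat q \<and> A' \<in> lat q \<and> A \<noteq> A'}"
    have "finite T" by (rule finite_subset[of _ "lat q \<times> lat q"]) (auto simp: T_def finite_lat)
    moreover have "bO 1 (\<lambda>\<epsilon>. inv_poly q \<epsilon> (exp_fam \<epsilon> (- fst i) * exp_fam \<epsilon> (snd i)))" if "i \<in> T" for i
      using inv_poly_lattice[of "fst i" q "snd i"] that q latD by (auto simp: T_def t1_def)
    ultimately obtain C where C: "\<forall>\<^sub>F \<epsilon> in at_right 0. \<forall>i\<in>T. cmod (inv_poly q \<epsilon> (exp_fam \<epsilon> (- fst i) * exp_fam \<epsilon> (snd i))) \<le> C * \<epsilon>"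
      using finite_bO[of T "\<lambda>i \<epsilon>. inv_poly q \<epsilon> (exp_fam \<epsilon> (- fst i) * exp_fam \<epsilon> (snd i))"] by blast
    show ?thesis
      unfolding O_eps_def
    proof (rule exI[of _ C], use C ev in eventually_elim, rule ballI)
      fix \<epsilon> :: real and g
      assume b: "\<forall>i\<in>T. cmod (inv_poly q \<epsilon> (exp_fam \<epsilon> (- fst i) * exp_fam \<epsilon> (snd i))) \<le> C * \<epsilon>" and \<epsilon>: "\<epsilon> \<in> {0<..<1}"
        and g: "g \<in> (set_inv\<^bsub>SU n\<^esub> (at_eps (Y_fam n q 1) \<epsilon>) <#>\<^bsub>SU n\<^esub> at_eps (Y_fam n q 1) \<epsilon>) - {1\<^sub>m n}"
      then obtain A A' where A: "A \<in> lat q" "A' \<in> lat q" "g = inv\<^bsub>SU n\<^esub> (exp_fam \<epsilon> A) * exp_fam \<epsilon> A'"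
        by (auto simp: Y_fam_eq at_eps_image[OF \<epsilon>] set_mult_def SET_INV_def)
      then have g': "g = exp_fam \<epsilon> (- A) * exp_fam \<epsilon> A'" using latD inv_exp_fam by auto
      have "A \<noteq> A'" using g g' exp_fam_inverse[OF latD(2)[OF A(1)]] by auto
      then have "cmod (inv_poly q \<epsilon> g) \<le> C * \<epsilon>" using b[rule_format, of "(A, A')"] A g' by (simp add: T_def)
      moreover have "g \<in> carrier_mat n n"
        unfolding g' using exp_fam_carrier[of "- A" \<epsilon>] exp_fam_carrier[of A' \<epsilon>] latD[OF A(1)] latD[OF A(2)] by auto
      ultimately show "cmod (eval_mat_poly (p \<epsilon>) g) \<le> C * \<epsilon>" using \<epsilon> by (simp add: p(3))
    qed
  qed
  ultimately show "?P (form_bound * n) q"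
    using p(1) by (intro exI[of _ 1] conjI exI[of _ p]) auto
qed

end

section \<open>Border-separating polynomials\<close>

text \<open>The Lagrange interpolation polynomial of degree \<open>q - 1\<close> on the nodes \<open>0, \<dots>, q - 1\<close> that is 1 at
  the node \<open>v < q\<close> and 0 at the others.\<close>

definition Lag :: "nat \<Rightarrow> nat \<Rightarrow> complex \<Rightarrow> complex" where
  "Lag q v z = (\<Prod>t\<in>{..<q} - {v}. 1 / (of_nat v - of_nat t) * (z - of_nat t))"

lemma Lag_pfam: "pfam n 1 F \<Longrightarrow> pfam n q (\<lambda>\<epsilon> M. Lag q v (F \<epsilon> M))"
proof (rule pfam_mono)
  assume F: "pfam n 1 F"
  show "pfam n (card ({..<q} - {v}) * 1) (\<lambda>\<epsilon> M. Lag q v (F \<epsilon> M))"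
    unfolding Lag_def
    by (intro pfam_prod pfam_cmult[of "\<lambda>_. c" for c] pfam_minus F pfam_const[of "\<lambda>_. c" for c] hol_ext_const)
  show "card ({..<q} - {v}) * 1 \<le> q"
    using card_mono[of "{..<q}" "{..<q} - {v}"] by simp
qed

lemma Lag_t1: "t1 F a \<Longrightarrow> t1 (\<lambda>\<epsilon>. Lag q v (F \<epsilon>)) (Lag q v a)"
  unfolding Lag_def by (intro t1_prod t1_cmult t1_diff t1_const)

lemma Lag_eval:
  assumes "u < q" shows "Lag q v (of_nat u) = (if u = v then 1 else 0)"
proof (cases "u = v")
  case True
  then show ?thesis unfolding Lag_def by (intro trans[OF prod.neutral]) auto
next
  case False
  then show ?thesis unfolding Lag_def using assms by (simp add: prod_zero_iff)
qed

lemma t1_separate: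
  assumes "t1 F a" "t1 G b" "a \<noteq> b"
  shows "\<forall>\<^sub>F \<epsilon> in at_right 0. F \<epsilon> \<noteq> G \<epsilon>"
proof -
  have "t1 (\<lambda>\<epsilon>. F \<epsilon> - G \<epsilon>) (a - b)" by (intro t1_diff assms)
  then obtain K where K: "\<forall>\<^sub>F \<epsilon> in at_right 0. cmod (F \<epsilon> - G \<epsilon> - (a - b)) \<le> K * \<epsilon>"
    by (auto simp: t1_def bO_def)
  define r where "r = cmod (a - b) / (\<bar>K\<bar> + 1)"
  have r: "r > 0" using assms(3) by (simp add: r_def)
  have "\<forall>\<^sub>F \<epsilon> in at_right 0. \<epsilon> \<in> {0<..<r}" using r by (rule eventually_at_right_real)
  with K show ?thesis
  proof eventually_elim
    case (elim \<epsilon>)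
    show ?case
    proof
      assume "F \<epsilon> = G \<epsilon>"
      then have "cmod (a - b) \<le> K * \<epsilon>" using elim(1) by (simp add: norm_minus_commute)
      also have "\<dots> \<le> (\<bar>K\<bar> + 1) * \<epsilon>" using elim(2) by (intro mult_right_mono) auto
      also have "\<dots> < (\<bar>K\<bar> + 1) * r" using elim(2) by (intro mult_strict_left_mono) auto
      also have "\<dots> = cmod (a - b)" by (simp add: r_def)
      finally show False by simp
    qed
  qed
qed

lemma hol_ext_mat_mult:
  assumes A: "A \<in> carrier_mat n n" "B \<in> carrier_mat n n" and ij: "i < n" "j < n"
    and F: "\<And>\<epsilon>. F \<epsilon> \<in> carrier_mat n n" "\<And>k l. k < n \<Longrightarrow> l < n \<Longrightarrow> hol_ext (\<lambda>\<epsilon>. F \<epsilon> $$ (k, l))"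
  shows "hol_ext (\<lambda>\<epsilon>. (A * F \<epsilon> * B) $$ (i, j))"
proof -
  have e: "(A * F \<epsilon> * B) $$ (i, j) = (\<Sum>l<n. B $$ (l, j) * (\<Sum>k<n. A $$ (i, k) * F \<epsilon> $$ (k, l)))" for \<epsilon>
    by (rule mult_entry3) (use A ij F in auto)
  show ?thesis unfolding e by (intro hol_ext_sum hol_ext_mult hol_ext_const F(2)) auto
qed

lemma choice2:
  assumes "\<forall>x\<in>X. \<forall>z\<in>Z. \<exists>p. Q x z p"
  shows "\<exists>f. \<forall>x\<in>X. \<forall>z\<in>Z. Q x z (f x z)"
  using assms by metis

context even_size begin

text \<open>The indices of the families in \<open>X\<close> and \<open>Z\<close>: assignments of natural numbers below \<open>q\<close> to the free coordinates.\<close>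

definition labels :: "nat \<Rightarrow> (nat \<times> nat \<Rightarrow> nat) set" where "labels q = (\<Pi>\<^sub>E e\<in>upos. {..<q})"

text \<open>The generator with given natural numbers as coordinates.\<close>

definition skew_nat :: "(nat \<times> nat \<Rightarrow> nat) \<Rightarrow> complex mat" where "skew_nat w = skew_of (\<lambda>e. of_nat (w e))"

lemma skew_nat_S [simp]: "skew_nat w \<in> S_set n"
  by (simp add: skew_nat_def skew_of_S)

lemma skew_nat_carrier [simp, intro]: "skew_nat w \<in> carrier_mat n n"
  by (rule S_carrier) simp

lemma finite_labels: "finite (labels q)"
  unfolding labels_def by (intro finite_PiE) auto

lemma card_labels: "card (labels q) = q ^ d_XZ n"
  by (simp add: labels_def card_PiE card_upos)

text \<open>The separating polynomial for the element of \<open>X\<close> with label \<open>w\<close> and that of \<open>Z\<close> with label \<open>u\<close>.\<close>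

definition sep_poly :: "nat \<Rightarrow> (nat \<times> nat \<Rightarrow> nat) \<Rightarrow> (nat \<times> nat \<Rightarrow> nat) \<Rightarrow> real \<Rightarrow> complex mat \<Rightarrow> complex" where
  "sep_poly q w u \<epsilon> M = inv_poly q \<epsilon> M * (\<Prod>e\<in>upos. Lag q (w e) (coordX (fst e) (snd e) (displ \<epsilon> M))) *
     (\<Prod>e\<in>upos. Lag q (u e) (coordZ (fst e) (snd e) (displ \<epsilon> M)))"

lemma sep_poly_pfam: "pfam n ((form_bound * n + 2 * card upos) * q) (sep_poly q w u)"
proof -
  have 1: "pfam n (card upos * q) (\<lambda>\<epsilon> M. \<Prod>e\<in>upos. Lag q (w e) (coordX (fst e) (snd e) (displ \<epsilon> M)))"
  proof (intro pfam_prod Lag_pfam)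
    fix e assume "e \<in> upos"
    then have "fst e < n" "snd e < n" using upos_bounds[of "fst e" "snd e"] by simp_all
    then show "pfam n 1 (\<lambda>\<epsilon> M. coordX (fst e) (snd e) (displ \<epsilon> M))"
      by (rule coord_pfam) (rule displ_pfam displ_carrier, assumption+)+
  qed
  have 2: "pfam n (card upos * q) (\<lambda>\<epsilon> M. \<Prod>e\<in>upos. Lag q (u e) (coordZ (fst e) (snd e) (displ \<epsilon> M)))"
  proof (intro pfam_prod Lag_pfam)
    fix e assume "e \<in> upos"
    then have "fst e < n" "snd e < n" using upos_bounds[of "fst e" "snd e"] by simp_all
    then show "pfam n 1 (\<lambda>\<epsilon> M. coordZ (fst e) (snd e) (displ \<epsilon> M))"
      by (rule coord_pfam) (rule displ_pfam displ_carrier, assumption+)+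
  qed
  have d: "form_bound * n * q + card upos * q + card upos * q = (form_bound * n + 2 * card upos) * q"
    by (simp add: algebra_simps)
  show ?thesis
    using pfam_mult[OF pfam_mult[OF inv_poly_pfam[of q] 1] 2] unfolding sep_poly_def d .
qed

lemma xyz_carrier:
  assumes "s \<in> carrier_mat n n" "A \<in> carrier_mat n n" "A' \<in> carrier_mat n n" "s' \<in> carrier_mat n n"
  shows "xyz \<epsilon> s A A' s' \<in> carrier_mat n n"
  using xyz_expansion[OF assms] m3_carrier(1) by blast

text \<open>If \<open>A \<noteq> A'\<close>, the invariant factor tends to 0 and the Lagrange factors stay bounded. If \<open>A = A'\<close>, the
  invariant factor is 1 and the Lagrange factors compare the labels.\<close>

lemma sep_poly_limit:
  assumes A: "A \<in> lat q" "A' \<in> lat q" and q: "q \<ge> 1"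
    and w: "w1 \<in> labels q" "u1 \<in> labels q" "w \<in> labels q" "u \<in> labels q"
  shows "t1 (\<lambda>\<epsilon>. sep_poly q w u \<epsilon> (xyz \<epsilon> (skew_nat w1) A A' (skew_nat u1))) (if A = A' \<and> w1 = w \<and> u1 = u then 1 else 0)"
proof -
  have c: "A \<in> carrier_mat n n" "A' \<in> carrier_mat n n" using A latD by auto
  define g where "g = (\<lambda>\<epsilon>. xyz \<epsilon> (skew_nat w1) A A' (skew_nat u1))"
  obtain L C where L: "m3 n g (1\<^sub>m n) L C" "A = A' \<Longrightarrow> L = tangent (skew_nat w1) (skew_nat u1)"
    using xyz_expansion[OF skew_nat_carrier[of w1] c skew_nat_carrier[of u1]] unfolding g_def by blast
  have gc: "g \<epsilon> \<in> carrier_mat n n" for \<epsilon> using m3_carrier(1)[OF L(1)] .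
  have Lc: "L \<in> carrier_mat n n" using m3_carrier(3)[OF L(1)] .
  have e12: "exp_fam \<epsilon> (- A) * exp_fam \<epsilon> A' \<in> carrier_mat n n" for \<epsilon>
    using exp_fam_carrier[of "- A" \<epsilon>] exp_fam_carrier[OF c(2), of \<epsilon>] c by auto
  have P: "t1 (\<lambda>\<epsilon>. inv_poly q \<epsilon> (g \<epsilon>)) (if A = A' then 1 else 0)"
  proof -
    have "inv_poly q \<epsilon> (g \<epsilon>) = inv_poly q \<epsilon> (exp_fam \<epsilon> (- A) * exp_fam \<epsilon> A')" for \<epsilon>
      unfolding g_def xyz_def by (rule inv_poly_invariant) (auto intro: S_uminus e12)
    then show ?thesis
      using inv_poly_lattice[of A q A'] q A latD exp_fam_inverse[OF c(1)] by (auto simp: inv_poly_one)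
  qed
  have co: "t1 (\<lambda>\<epsilon>. coordX (fst e) (snd e) (displ \<epsilon> (g \<epsilon>))) (coordX (fst e) (snd e) L)"
    "t1 (\<lambda>\<epsilon>. coordZ (fst e) (snd e) (displ \<epsilon> (g \<epsilon>))) (coordZ (fst e) (snd e) L)" if "e \<in> upos" for e
  proof -
    have b: "fst e < n" "snd e < n" using that upos_bounds[of "fst e" "snd e"] by simp_all
    show "t1 (\<lambda>\<epsilon>. coordX (fst e) (snd e) (displ \<epsilon> (g \<epsilon>))) (coordX (fst e) (snd e) L)"
      using gc Lc displ_t1[OF L(1)] by (intro coord_t1[OF b]) auto
    show "t1 (\<lambda>\<epsilon>. coordZ (fst e) (snd e) (displ \<epsilon> (g \<epsilon>))) (coordZ (fst e) (snd e) L)"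
      using gc Lc displ_t1[OF L(1)] by (intro coord_t1[OF b]) auto
  qed
  have lim: "t1 (\<lambda>\<epsilon>. sep_poly q w u \<epsilon> (g \<epsilon>)) ((if A = A' then 1 else 0) *
      (\<Prod>e\<in>upos. Lag q (w e) (coordX (fst e) (snd e) L)) * (\<Prod>e\<in>upos. Lag q (u e) (coordZ (fst e) (snd e) L)))"
    unfolding sep_poly_def by (intro t1_mult P t1_prod Lag_t1 co)
  have prod: "(\<Prod>e\<in>upos. Lag q (v e) (of_nat (v1 e))) = (if v1 = v then 1 else 0)"
    if v: "v1 \<in> labels q" "v \<in> labels q" for v v1
  proof (cases "v1 = v")
    case True
    then show ?thesis using v by (simp add: Lag_eval labels_def PiE_iff)
  next
    case False
    then obtain e where e: "e \<in> upos" "v1 e \<noteq> v e" using v PiE_ext unfolding labels_def by metis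
    then have "Lag q (v e) (of_nat (v1 e)) = 0" using v by (simp add: Lag_eval labels_def PiE_iff)
    then show ?thesis using False e by (simp add: prod_zero_iff) blast
  qed
  have "(if A = A' then 1 else 0) * (\<Prod>e\<in>upos. Lag q (w e) (coordX (fst e) (snd e) L)) *
      (\<Prod>e\<in>upos. Lag q (u e) (coordZ (fst e) (snd e) L)) = (if A = A' \<and> w1 = w \<and> u1 = u then 1 else 0 :: complex)"
  proof (cases "A = A'")
    case True
    have "coordX (fst e) (snd e) L = of_nat (w1 e) \<and> coordZ (fst e) (snd e) L = of_nat (u1 e)" if "e \<in> upos" for e
    proof -
      obtain i j where e: "e = (i, j)" by (cases e)
      then have p: "(i, j) \<in> upos" using that by simp
      show ?thesis
        using coordinates[OF skew_nat_S[of w1] skew_nat_S[of u1] upos_bounds(1,2,4,3)[OF p]] p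
        unfolding L(2)[OF True] e by (simp add: skew_nat_def skew_of_entry)
    qed
    then have "(\<Prod>e\<in>upos. Lag q (w e) (coordX (fst e) (snd e) L)) = (\<Prod>e\<in>upos. Lag q (w e) (of_nat (w1 e)))"
      "(\<Prod>e\<in>upos. Lag q (u e) (coordZ (fst e) (snd e) L)) = (\<Prod>e\<in>upos. Lag q (u e) (of_nat (u1 e)))"
      by (auto intro!: prod.cong)
    then show ?thesis using prod w True by simp
  qed simp
  then show ?thesis using lim by (simp add: g_def)
qed

lemma zero_lat: "0\<^sub>m n n \<in> lat q"
  unfolding lat_def using I_set_closed(1) by (auto intro!: S_setI)

lemma xyz_same:
  assumes "A \<in> carrier_mat n n"
  shows "xyz \<epsilon> s A A s' = xyz \<epsilon> s (0\<^sub>m n n) (0\<^sub>m n n) s'"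
  using assms exp_fam_inverse[OF assms] exp_fam_inverse[of "0\<^sub>m n n"] by (simp add: xyz_def)

text \<open>The polynomials take values near 0 and 1, so for small parameters the products \<open>x y\<^sup>-\<^sup>1 y' z\<^sup>-\<^sup>1\<close> that agree with some \<open>x' z'\<^sup>-\<^sup>1\<close> are the trivial ones.\<close>

lemma xyz_separated:
  assumes q: "q \<ge> 1"
  obtains \<alpha> where "\<alpha> > 0" "\<And>\<epsilon> w1 A A' u1 w u. \<lbrakk>0 < \<epsilon>; \<epsilon> < \<alpha>; w1 \<in> labels q; A \<in> lat q; A' \<in> lat q; u1 \<in> labels q; w \<in> labels q; u \<in> labels q;
     xyz \<epsilon> (skew_nat w1) A A' (skew_nat u1) = xyz \<epsilon> (skew_nat w) (0\<^sub>m n n) (0\<^sub>m n n) (skew_nat u)\<rbrakk> \<Longrightarrow> A = A' \<and> w1 = w \<and> u1 = u"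
proof -
  \<comment> \<open>The finitely many nontrivial coincidences; each is excluded for small parameters by \<open>sep_poly\<close>.\<close>
  define T where "T = {(w1, A, A', u1, w, u). w1 \<in> labels q \<and> A \<in> lat q \<and> A' \<in> lat q \<and> u1 \<in> labels q \<and>
    w \<in> labels q \<and> u \<in> labels q \<and> \<not> (A = A' \<and> w1 = w \<and> u1 = u)}"
  define ne where "ne = (\<lambda>(w1, A, A', u1, w, u) \<epsilon>.
    xyz \<epsilon> (skew_nat w1) A A' (skew_nat u1) \<noteq> xyz \<epsilon> (skew_nat w) (0\<^sub>m n n) (0\<^sub>m n n) (skew_nat u))"
  have fin: "finite T"
  proof (rule finite_subset)
    show "T \<subseteq> labels q \<times> lat q \<times> lat q \<times> labels q \<times> labels q \<times> labels q" by (auto simp: T_def)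
  qed (intro finite_cartesian_product finite_labels finite_lat)
  have "\<forall>i\<in>T. \<forall>\<^sub>F \<epsilon> in at_right 0. ne i \<epsilon>"
  proof
    fix i assume "i \<in> T"
    then obtain w1 A A' u1 w u where i: "i = (w1, A, A', u1, w, u)" and
      m: "w1 \<in> labels q" "A \<in> lat q" "A' \<in> lat q" "u1 \<in> labels q" "w \<in> labels q" "u \<in> labels q" "\<not> (A = A' \<and> w1 = w \<and> u1 = u)"
      by (auto simp: T_def)
    have "t1 (\<lambda>\<epsilon>. sep_poly q w u \<epsilon> (xyz \<epsilon> (skew_nat w1) A A' (skew_nat u1))) 0"
      using sep_poly_limit[OF m(2,3) q m(1,4,5,6)] m(7) by (simp only: if_False)
    moreover have "t1 (\<lambda>\<epsilon>. sep_poly q w u \<epsilon> (xyz \<epsilon> (skew_nat w) (0\<^sub>m n n) (0\<^sub>m n n) (skew_nat u))) 1"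
      using sep_poly_limit[OF zero_lat zero_lat q m(5,6,5,6)] by simp
    ultimately have "\<forall>\<^sub>F \<epsilon> in at_right 0. sep_poly q w u \<epsilon> (xyz \<epsilon> (skew_nat w1) A A' (skew_nat u1)) \<noteq>
        sep_poly q w u \<epsilon> (xyz \<epsilon> (skew_nat w) (0\<^sub>m n n) (0\<^sub>m n n) (skew_nat u))"
      by (rule t1_separate) simp
    then show "\<forall>\<^sub>F \<epsilon> in at_right 0. ne i \<epsilon>"
      by (rule eventually_mono) (auto simp: ne_def i)
  qed
  then have "\<forall>\<^sub>F \<epsilon> in at_right 0. \<forall>i\<in>T. ne i \<epsilon>"
    using fin by (rule eventually_ball_finite[rotated])
  then obtain \<alpha> where \<alpha>: "\<alpha> > 0" "\<And>\<epsilon>. 0 < \<epsilon> \<Longrightarrow> \<epsilon> < \<alpha> \<Longrightarrow> \<forall>i\<in>T. ne i \<epsilon>"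
    unfolding eventually_at_right_field by auto
  show ?thesis
  proof (rule that[OF \<alpha>(1)], rule ccontr)
    fix \<epsilon> w1 A A' u1 w u
    assume m: "0 < \<epsilon>" "\<epsilon> < \<alpha>" "w1 \<in> labels q" "A \<in> lat q" "A' \<in> lat q" "u1 \<in> labels q" "w \<in> labels q" "u \<in> labels q"
      and e: "xyz \<epsilon> (skew_nat w1) A A' (skew_nat u1) = xyz \<epsilon> (skew_nat w) (0\<^sub>m n n) (0\<^sub>m n n) (skew_nat u)"
      and "\<not> (A = A' \<and> w1 = w \<and> u1 = u)"
    then have "(w1, A, A', u1, w, u) \<in> T" by (simp add: T_def)
    with \<alpha>(2)[OF m(1,2)] have "ne (w1, A, A', u1, w, u) \<epsilon>" by blast
    with e show False by (simp add: ne_def)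
  qed
qed

lemma group_familyI:
  assumes "\<And>\<epsilon>. F \<epsilon> \<in> SU_carrier n" "\<And>i j. i < n \<Longrightarrow> j < n \<Longrightarrow> hol_ext (\<lambda>\<epsilon>. F \<epsilon> $$ (i, j))"
  shows "group_family n \<alpha> (\<lambda>\<epsilon>\<in>{0<..<\<alpha>}. F \<epsilon>)"
  unfolding group_family_def
proof (intro conjI allI impI)
  show "(\<lambda>\<epsilon>\<in>{0<..<\<alpha>}. F \<epsilon>) \<in> {0<..<\<alpha>} \<rightarrow>\<^sub>E carrier (SU n)" using assms(1) by simp
  fix i j assume "i < n" "j < n"
  from hol_ext_real_analytic[OF assms(2)[OF this]]
  show "real_analytic_on {0<..<\<alpha>} (\<lambda>\<epsilon>. (\<lambda>\<epsilon>\<in>{0<..<\<alpha>}. F \<epsilon>) \<epsilon> $$ (i, j))"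
    by (rule real_analytic_on_cong) simp
qed

lemma xyz_group:
  assumes "s \<in> S_set n" "A \<in> S_set n" "A' \<in> S_set n" "s' \<in> S_set n"
  shows "xf \<epsilon> s \<otimes>\<^bsub>SU n\<^esub> inv\<^bsub>SU n\<^esub> (exp_fam \<epsilon> A) \<otimes>\<^bsub>SU n\<^esub> exp_fam \<epsilon> A' \<otimes>\<^bsub>SU n\<^esub> inv\<^bsub>SU n\<^esub> (zf \<epsilon> s') = xyz \<epsilon> s A A' s'"
proof -
  have "xf \<epsilon> s \<in> carrier_mat n n" "exp_fam \<epsilon> (- A) \<in> carrier_mat n n" "exp_fam \<epsilon> A' \<in> carrier_mat n n"
    using assms S_carrier[OF S_uminus[OF assms(2)]] by auto
  then show ?thesis
    using assms by (simp add: xyz_def inv_exp_fam inv_zf assoc_n)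
qed

lemma xyz_group_short:
  assumes "s \<in> S_set n" "s' \<in> S_set n"
  shows "xf \<epsilon> s \<otimes>\<^bsub>SU n\<^esub> inv\<^bsub>SU n\<^esub> (zf \<epsilon> s') = xyz \<epsilon> s (0\<^sub>m n n) (0\<^sub>m n n) s'"
  using assms exp_fam_inverse[of "0\<^sub>m n n" \<epsilon>] by (simp add: xyz_def inv_zf)

lemma separating_families:
  "\<exists>C::nat. \<forall>q\<ge>1. \<exists>\<alpha>>0. \<exists>X_q Y_q Z_q.
     Y_q = Y_fam n q \<alpha> \<and>
     finite X_q \<and> finite Y_q \<and> finite Z_q \<and>
     (\<forall>x \<in> X_q \<union> Y_q \<union> Z_q. group_family n \<alpha> x) \<and>
     card X_q \<ge> q ^ d_XZ n \<and> card Y_q \<ge> q ^ d_XZ n \<and> card Z_q \<ge> q ^ d_XZ n \<and>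
     TPP_families n \<alpha> X_q Y_q Z_q \<and>
     (\<exists>f. border_separating n (C * q) X_q Y_q Z_q f)"
  (is "\<exists>C. \<forall>q\<ge>1. ?P C q")
proof (intro exI[of _ "form_bound * n + 2 * card upos"] allI impI)
  fix q :: nat assume q: "q \<ge> 1"
  obtain \<alpha> where \<alpha>: "\<alpha> > 0" and sep: "\<And>\<epsilon> w1 A A' u1 w u. \<lbrakk>0 < \<epsilon>; \<epsilon> < \<alpha>; w1 \<in> labels q; A \<in> lat q; A' \<in> lat q; u1 \<in> labels q; w \<in> labels q; u \<in> labels q;
     xyz \<epsilon> (skew_nat w1) A A' (skew_nat u1) = xyz \<epsilon> (skew_nat w) (0\<^sub>m n n) (0\<^sub>m n n) (skew_nat u)\<rbrakk> \<Longrightarrow> A = A' \<and> w1 = w \<and> u1 = u"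
    using xyz_separated[OF q] by metis
  define fx fy fz where "fx = (\<lambda>w. \<lambda>\<epsilon>\<in>{0<..<\<alpha>}. xf \<epsilon> (skew_nat w))" and "fy = (\<lambda>A. \<lambda>\<epsilon>\<in>{0<..<\<alpha>}. exp_fam \<epsilon> A)"
    and "fz = (\<lambda>u. \<lambda>\<epsilon>\<in>{0<..<\<alpha>}. zf \<epsilon> (skew_nat u))"
  define X Y Z where "X = fx ` labels q" and "Y = fy ` lat q" and "Z = fz ` labels q"
  have Y_eq: "Y = Y_fam n q \<alpha>" by (simp add: Y_def fy_def Y_fam_eq)
  have SUs: "xf \<epsilon> (skew_nat w) \<in> SU_carrier n" "zf \<epsilon> (skew_nat w) \<in> SU_carrier n"
    "A \<in> lat q \<Longrightarrow> exp_fam \<epsilon> A \<in> SU_carrier n" for \<epsilon> w A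
    using exp_fam_SU latD(1) by (simp_all add: xf_SU zf_SU)
  have w0: "restrict (\<lambda>_. 0) upos \<in> labels q" using q by (simp add: labels_def)
  define o0 where "o0 = restrict (\<lambda>_. 0 :: nat) upos"
  have o0: "o0 \<in> labels q" using w0 by (simp add: o0_def)
  \<comment> \<open>Injectivity of the labellings is tested at a single parameter value.\<close>
  define e0 where "e0 = \<alpha> / 2"
  have e0: "0 < e0" "e0 < \<alpha>" using \<alpha> by (simp_all add: e0_def)

  have "inj_on fx (labels q)"
  proof (rule inj_onI)
    fix w1 w assume m: "w1 \<in> labels q" "w \<in> labels q" "fx w1 = fx w"
    have "xf e0 (skew_nat w1) = xf e0 (skew_nat w)" using fun_cong[OF m(3), of e0] e0 by (simp add: fx_def)
    then have "xyz e0 (skew_nat w1) (0\<^sub>m n n) (0\<^sub>m n n) (skew_nat o0) = xyz e0 (skew_nat w) (0\<^sub>m n n) (0\<^sub>m n n) (skew_nat o0)"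
      by (simp add: xyz_def)
    from sep[OF e0 m(1) zero_lat zero_lat o0 m(2) o0 this] show "w1 = w" by simp
  qed
  then have cardX: "card X = q ^ d_XZ n" by (simp add: X_def card_image card_labels)
  have "inj_on fz (labels q)"
  proof (rule inj_onI)
    fix u1 u assume m: "u1 \<in> labels q" "u \<in> labels q" "fz u1 = fz u"
    have "zf e0 (skew_nat u1) = zf e0 (skew_nat u)" using fun_cong[OF m(3), of e0] e0 by (simp add: fz_def)
    then have "zf e0 (- skew_nat u1) = zf e0 (- skew_nat u)" by (simp flip: inv_zf)
    then have "xyz e0 (skew_nat o0) (0\<^sub>m n n) (0\<^sub>m n n) (skew_nat u1) = xyz e0 (skew_nat o0) (0\<^sub>m n n) (0\<^sub>m n n) (skew_nat u)"
      by (simp add: xyz_def)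
    from sep[OF e0 o0 zero_lat zero_lat m(1) o0 m(2) this] show "u1 = u" by simp
  qed
  then have cardZ: "card Z = q ^ d_XZ n" by (simp add: Z_def card_image card_labels)
  have "inj_on fy (lat q)"
  proof (rule inj_onI)
    fix A A' assume m: "A \<in> lat q" "A' \<in> lat q" "fy A = fy A'"
    have "exp_fam e0 A = exp_fam e0 A'" using fun_cong[OF m(3), of e0] e0 by (simp add: fy_def)
    then have "xyz e0 (skew_nat o0) A A' (skew_nat o0) = xyz e0 (skew_nat o0) A A (skew_nat o0)"
      by (simp add: xyz_def)
    also have "\<dots> = xyz e0 (skew_nat o0) (0\<^sub>m n n) (0\<^sub>m n n) (skew_nat o0)"
      using m(1) by (intro xyz_same latD)
    finally show "A = A'" using sep[OF e0 o0 m(1,2) o0 o0 o0] by simp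
  qed
  then have cardY: "card Y \<ge> q ^ d_XZ n" using card_lat[of q] by (simp add: Y_def card_image)

  have fam: "group_family n \<alpha> x" if x: "x \<in> X \<union> Y \<union> Z" for x
  proof -
    have hol: "hol_ext (\<lambda>\<epsilon>. exp_fam \<epsilon> B $$ (i, j))" "hol_ext (\<lambda>\<epsilon>. xf \<epsilon> B $$ (i, j))" "hol_ext (\<lambda>\<epsilon>. zf \<epsilon> B $$ (i, j))"
      if "B \<in> carrier_mat n n" "i < n" "j < n" for B i j
      unfolding xf_def zf_def using that by (auto intro!: hol_ext_mat_exp hol_ext_mat_mult)
    consider w where "x = fx w" | A where "x = fy A" "A \<in> lat q" | u where "x = fz u"
      using x unfolding X_def Y_def Z_def by blast
    then show ?thesis
    proof cases
      case 1 then show ?thesis unfolding fx_def by (simp only:) (intro group_familyI SUs hol skew_nat_carrier)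
    next
      case 2 then show ?thesis unfolding fy_def by (simp only:) (intro group_familyI SUs hol latD(2))
    next
      case 3 then show ?thesis unfolding fz_def by (simp only:) (intro group_familyI SUs hol skew_nat_carrier)
    qed
  qed

  have at: "at_eps X \<epsilon> = (\<lambda>w. xf \<epsilon> (skew_nat w)) ` labels q" "at_eps Y \<epsilon> = exp_fam \<epsilon> ` lat q"
    "at_eps Z \<epsilon> = (\<lambda>u. zf \<epsilon> (skew_nat u)) ` labels q" if "\<epsilon> \<in> {0<..<\<alpha>}" for \<epsilon>
    unfolding X_def Y_def Z_def fx_def fy_def fz_def by (rule at_eps_image[OF that])+

  have tpp: "TPP_families n \<alpha> X Y Z"
    unfolding TPP_families_def
  proof
    fix \<epsilon> assume \<epsilon>: "\<epsilon> \<in> {0<..<\<alpha>}"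
    have key: "x = x' \<and> y = y' \<and> z = z'"
      if x: "x \<in> at_eps X \<epsilon>" "x' \<in> at_eps X \<epsilon>" and y: "y \<in> at_eps Y \<epsilon>" "y' \<in> at_eps Y \<epsilon>"
        and z: "z \<in> at_eps Z \<epsilon>" "z' \<in> at_eps Z \<epsilon>"
        and one: "inv\<^bsub>SU n\<^esub> x \<otimes>\<^bsub>SU n\<^esub> x' \<otimes>\<^bsub>SU n\<^esub> inv\<^bsub>SU n\<^esub> y \<otimes>\<^bsub>SU n\<^esub> y' \<otimes>\<^bsub>SU n\<^esub> inv\<^bsub>SU n\<^esub> z \<otimes>\<^bsub>SU n\<^esub> z' = \<one>\<^bsub>SU n\<^esub>"
      for x x' y y' z z'
    proof -
      obtain w w' A A' u u' where p: "w \<in> labels q" "w' \<in> labels q" "A \<in> lat q" "A' \<in> lat q" "u \<in> labels q" "u' \<in> labels q"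
        "x = xf \<epsilon> (skew_nat w)" "x' = xf \<epsilon> (skew_nat w')" "y = exp_fam \<epsilon> A" "y' = exp_fam \<epsilon> A'" "z = zf \<epsilon> (skew_nat u)" "z' = zf \<epsilon> (skew_nat u')"
        using x y z unfolding at[OF \<epsilon>] by blast
      have c: "x \<in> carrier (SU n)" "x' \<in> carrier (SU n)" "y \<in> carrier (SU n)" "y' \<in> carrier (SU n)"
        "z \<in> carrier (SU n)" "z' \<in> carrier (SU n)"
        using p SUs by auto
      \<comment> \<open>The relation is rewritten as \<open>x' y\<^sup>-\<^sup>1 y' z\<^sup>-\<^sup>1 = x z'\<^sup>-\<^sup>1\<close>.\<close>
      define t where "t = x' \<otimes>\<^bsub>SU n\<^esub> inv\<^bsub>SU n\<^esub> y \<otimes>\<^bsub>SU n\<^esub> y' \<otimes>\<^bsub>SU n\<^esub> inv\<^bsub>SU n\<^esub> z"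
      have tc: "t \<in> carrier (SU n)" unfolding t_def using c by (intro SU.m_closed SU.inv_closed)
      have "inv\<^bsub>SU n\<^esub> x \<otimes>\<^bsub>SU n\<^esub> t \<otimes>\<^bsub>SU n\<^esub> z' = \<one>\<^bsub>SU n\<^esub>"
        using one c unfolding t_def by (simp add: SU.m_assoc del: SU_simps)
      then have "inv\<^bsub>SU n\<^esub> x \<otimes>\<^bsub>SU n\<^esub> t = inv\<^bsub>SU n\<^esub> z'"
        using SU.inv_equality[of "inv\<^bsub>SU n\<^esub> x \<otimes>\<^bsub>SU n\<^esub> t" z'] c tc SU.m_closed SU.inv_closed by metis
      then have "inv\<^bsub>SU n\<^esub> z' = inv\<^bsub>SU n\<^esub> x \<otimes>\<^bsub>SU n\<^esub> t" by (rule sym)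
      then have "t = x \<otimes>\<^bsub>SU n\<^esub> inv\<^bsub>SU n\<^esub> z'"
        using SU.inv_solve_left[OF SU.inv_closed[OF c(6)] c(1) tc] by blast
      then have "xyz \<epsilon> (skew_nat w') A A' (skew_nat u) = xyz \<epsilon> (skew_nat w) (0\<^sub>m n n) (0\<^sub>m n n) (skew_nat u')"
        unfolding t_def p using p latD(1) by (simp only: xyz_group xyz_group_short skew_nat_S)
      with sep[of \<epsilon> w' A A' u w u'] \<epsilon> p show ?thesis by auto
    qed
    have one: "inv\<^bsub>SU n\<^esub> x \<otimes>\<^bsub>SU n\<^esub> x \<otimes>\<^bsub>SU n\<^esub> inv\<^bsub>SU n\<^esub> y \<otimes>\<^bsub>SU n\<^esub> y \<otimes>\<^bsub>SU n\<^esub> inv\<^bsub>SU n\<^esub> z \<otimes>\<^bsub>SU n\<^esub> z = \<one>\<^bsub>SU n\<^esub>"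
      if "x \<in> carrier (SU n)" "y \<in> carrier (SU n)" "z \<in> carrier (SU n)" for x y z
      using that by (simp add: SU.m_assoc del: SU_simps)
    have sub: "at_eps X \<epsilon> \<subseteq> carrier (SU n)" "at_eps Y \<epsilon> \<subseteq> carrier (SU n)" "at_eps Z \<epsilon> \<subseteq> carrier (SU n)"
      using SUs by (auto simp: at[OF \<epsilon>])
    show "TPP (SU n) (at_eps X \<epsilon>) (at_eps Y \<epsilon>) (at_eps Z \<epsilon>)"
      unfolding TPP_def
    proof (intro conjI sub ballI iffI)
      fix x x' y y' z z'
      assume m: "x \<in> at_eps X \<epsilon>" "x' \<in> at_eps X \<epsilon>" "y \<in> at_eps Y \<epsilon>" "y' \<in> at_eps Y \<epsilon>" "z \<in> at_eps Z \<epsilon>" "z' \<in> at_eps Z \<epsilon>"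
      show "x = x'" "y = y'" "z = z'"
        if "inv\<^bsub>SU n\<^esub> x \<otimes>\<^bsub>SU n\<^esub> x' \<otimes>\<^bsub>SU n\<^esub> inv\<^bsub>SU n\<^esub> y \<otimes>\<^bsub>SU n\<^esub> y' \<otimes>\<^bsub>SU n\<^esub> inv\<^bsub>SU n\<^esub> z \<otimes>\<^bsub>SU n\<^esub> z' = \<one>\<^bsub>SU n\<^esub>"
        using key[OF m that] by simp_all
      show "inv\<^bsub>SU n\<^esub> x \<otimes>\<^bsub>SU n\<^esub> x' \<otimes>\<^bsub>SU n\<^esub> inv\<^bsub>SU n\<^esub> y \<otimes>\<^bsub>SU n\<^esub> y' \<otimes>\<^bsub>SU n\<^esub> inv\<^bsub>SU n\<^esub> z \<otimes>\<^bsub>SU n\<^esub> z' = \<one>\<^bsub>SU n\<^esub>"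
        if "x = x' \<and> y = y' \<and> z = z'"
        using one[of x y z] that m sub by blast
    qed
  qed
  have border: "\<exists>f. border_separating n ((form_bound * n + 2 * card upos) * q) X Y Z f"
  proof -
    have ev: "\<forall>\<^sub>F \<epsilon> in at_right 0. \<epsilon> \<in> {0<..<\<alpha>}" by (rule eventually_at_right_real[OF \<alpha>])
    have "\<forall>x\<in>X. \<forall>z\<in>Z. \<exists>p. (\<exists>\<beta>>0. poly_family n ((form_bound * n + 2 * card upos) * q) \<beta> p) \<and>
       O_eps (\<lambda>\<epsilon>. {x \<epsilon> \<otimes>\<^bsub>SU n\<^esub> inv\<^bsub>SU n\<^esub> (z \<epsilon>)}) (\<lambda>g \<epsilon>. eval_mat_poly (p \<epsilon>) g - 1) \<and>
       O_eps (\<lambda>\<epsilon>. (at_eps X \<epsilon> <#>\<^bsub>SU n\<^esub> set_inv\<^bsub>SU n\<^esub> (at_eps Y \<epsilon>)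
                    <#>\<^bsub>SU n\<^esub> at_eps Y \<epsilon> <#>\<^bsub>SU n\<^esub> set_inv\<^bsub>SU n\<^esub> (at_eps Z \<epsilon>))
                 - {x \<epsilon> \<otimes>\<^bsub>SU n\<^esub> inv\<^bsub>SU n\<^esub> (z \<epsilon>)})
         (\<lambda>g \<epsilon>. eval_mat_poly (p \<epsilon>) g)"
      (is "\<forall>x\<in>X. \<forall>z\<in>Z. \<exists>p. ?Q x z p")
    proof (intro ballI)
      fix x z assume "x \<in> X" "z \<in> Z"
      then obtain w u where wu: "w \<in> labels q" "u \<in> labels q" "x = fx w" "z = fz u" by (auto simp: X_def Z_def)
      have xz: "x \<epsilon> \<otimes>\<^bsub>SU n\<^esub> inv\<^bsub>SU n\<^esub> (z \<epsilon>) = xyz \<epsilon> (skew_nat w) (0\<^sub>m n n) (0\<^sub>m n n) (skew_nat u)" if "\<epsilon> \<in> {0<..<\<alpha>}" for \<epsilon>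
        using xyz_group_short[OF skew_nat_S skew_nat_S, of \<epsilon> w u] that by (simp add: wu fx_def fz_def del: SU_simps)
      obtain p :: "real \<Rightarrow> mat_poly" where p: "\<forall>\<alpha>. poly_family n ((form_bound * n + 2 * card upos) * q) \<alpha> p"
        "\<forall>\<epsilon>>0. \<forall>M\<in>carrier_mat n n. eval_mat_poly (p \<epsilon>) M = sep_poly q w u \<epsilon> M"
        using pfam_poly_family[OF sep_poly_pfam[of q w u]] by blast
      have gc: "xyz \<epsilon> (skew_nat w1) A A' (skew_nat u1) \<in> carrier_mat n n" if "A \<in> lat q" "A' \<in> lat q" for \<epsilon> w1 A A' u1
        using that by (intro xyz_carrier skew_nat_carrier latD)
      define T where "T = {(w1, A, A', u1). w1 \<in> labels q \<and> A \<in> lat q \<and> A' \<in> lat q \<and> u1 \<in> labels q \<and>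
        \<not> (A = A' \<and> w1 = w \<and> u1 = u)}"
      define G where "G = (\<lambda>(w1, A, A', u1) \<epsilon>. sep_poly q w u \<epsilon> (xyz \<epsilon> (skew_nat w1) A A' (skew_nat u1)))"
      have fin: "finite T"
      proof (rule finite_subset)
        show "T \<subseteq> labels q \<times> lat q \<times> lat q \<times> labels q" by (auto simp: T_def)
      qed (intro finite_cartesian_product finite_labels finite_lat)
      have bO: "bO 1 (G i)" if "i \<in> T" for i
      proof -
        obtain w1 A A' u1 where i: "i = (w1, A, A', u1)" by (cases i)
        then have m: "w1 \<in> labels q" "A \<in> lat q" "A' \<in> lat q" "u1 \<in> labels q" "\<not> (A = A' \<and> w1 = w \<and> u1 = u)"
          using that by (simp_all add: T_def)
        have "t1 (\<lambda>\<epsilon>. sep_poly q w u \<epsilon> (xyz \<epsilon> (skew_nat w1) A A' (skew_nat u1))) 0"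
          using sep_poly_limit[OF m(2,3) q m(1,4) wu(1,2)] m(5) by (simp only: if_False)
        then show ?thesis by (simp add: t1_def G_def i)
      qed
      obtain C where C: "\<forall>\<^sub>F \<epsilon> in at_right 0. \<forall>i\<in>T. cmod (G i \<epsilon>) \<le> C * \<epsilon>"
        by (rule finite_bO[OF fin bO])
      have "t1 (\<lambda>\<epsilon>. sep_poly q w u \<epsilon> (xyz \<epsilon> (skew_nat w) (0\<^sub>m n n) (0\<^sub>m n n) (skew_nat u))) 1"
        using sep_poly_limit[OF zero_lat zero_lat q wu(1,2,1,2)] by simp
      then obtain C' where C': "\<forall>\<^sub>F \<epsilon> in at_right 0. cmod (sep_poly q w u \<epsilon> (xyz \<epsilon> (skew_nat w) (0\<^sub>m n n) (0\<^sub>m n n) (skew_nat u)) - 1) \<le> C' * \<epsilon>"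
        by (auto simp: t1_def bO_def)
      have 1: "O_eps (\<lambda>\<epsilon>. {x \<epsilon> \<otimes>\<^bsub>SU n\<^esub> inv\<^bsub>SU n\<^esub> (z \<epsilon>)}) (\<lambda>g \<epsilon>. eval_mat_poly (p \<epsilon>) g - 1)"
        unfolding O_eps_def
      proof (rule exI[of _ C'], use C' ev in eventually_elim, rule ballI)
        fix \<epsilon> :: real and g
        assume "cmod (sep_poly q w u \<epsilon> (xyz \<epsilon> (skew_nat w) (0\<^sub>m n n) (0\<^sub>m n n) (skew_nat u)) - 1) \<le> C' * \<epsilon>" "\<epsilon> \<in> {0<..<\<alpha>}"
          "g \<in> {x \<epsilon> \<otimes>\<^bsub>SU n\<^esub> inv\<^bsub>SU n\<^esub> (z \<epsilon>)}"
        then show "cmod (eval_mat_poly (p \<epsilon>) g - 1) \<le> C' * \<epsilon>"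
          using p(2) gc[OF zero_lat zero_lat, of \<epsilon> w u] by (simp add: xz del: SU_simps)
      qed
      have 2: "O_eps (\<lambda>\<epsilon>. (at_eps X \<epsilon> <#>\<^bsub>SU n\<^esub> set_inv\<^bsub>SU n\<^esub> (at_eps Y \<epsilon>)
                    <#>\<^bsub>SU n\<^esub> at_eps Y \<epsilon> <#>\<^bsub>SU n\<^esub> set_inv\<^bsub>SU n\<^esub> (at_eps Z \<epsilon>))
                 - {x \<epsilon> \<otimes>\<^bsub>SU n\<^esub> inv\<^bsub>SU n\<^esub> (z \<epsilon>)})
         (\<lambda>g \<epsilon>. eval_mat_poly (p \<epsilon>) g)"
        unfolding O_eps_def
      proof (rule exI[of _ C], use C ev in eventually_elim, rule ballI)
        fix \<epsilon> :: real and g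
        assume b: "\<forall>i\<in>T. cmod (G i \<epsilon>) \<le> C * \<epsilon>" and \<epsilon>: "\<epsilon> \<in> {0<..<\<alpha>}"
          and g: "g \<in> (at_eps X \<epsilon> <#>\<^bsub>SU n\<^esub> set_inv\<^bsub>SU n\<^esub> (at_eps Y \<epsilon>)
                    <#>\<^bsub>SU n\<^esub> at_eps Y \<epsilon> <#>\<^bsub>SU n\<^esub> set_inv\<^bsub>SU n\<^esub> (at_eps Z \<epsilon>))
                 - {x \<epsilon> \<otimes>\<^bsub>SU n\<^esub> inv\<^bsub>SU n\<^esub> (z \<epsilon>)}"
        then obtain w1 A A' u1 where m: "w1 \<in> labels q" "A \<in> lat q" "A' \<in> lat q" "u1 \<in> labels q"
          and g1: "g = xf \<epsilon> (skew_nat w1) \<otimes>\<^bsub>SU n\<^esub> inv\<^bsub>SU n\<^esub> (exp_fam \<epsilon> A) \<otimes>\<^bsub>SU n\<^esub> exp_fam \<epsilon> A' \<otimes>\<^bsub>SU n\<^esub> inv\<^bsub>SU n\<^esub> (zf \<epsilon> (skew_nat u1))"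
          unfolding at[OF \<epsilon>] set_mult_def SET_INV_def by blast
        have g2: "g = xyz \<epsilon> (skew_nat w1) A A' (skew_nat u1)"
          unfolding g1 using m by (intro xyz_group skew_nat_S latD)
        have "\<not> (A = A' \<and> w1 = w \<and> u1 = u)"
        proof
          assume "A = A' \<and> w1 = w \<and> u1 = u"
          then have "g = xyz \<epsilon> (skew_nat w) (0\<^sub>m n n) (0\<^sub>m n n) (skew_nat u)"
            using g2 xyz_same[OF latD(2)[OF m(2)]] by simp
          then show False using g xz[OF \<epsilon>] by (simp del: SU_simps)
        qed
        then have "cmod (G (w1, A, A', u1) \<epsilon>) \<le> C * \<epsilon>" using b m by (simp add: T_def)
        then show "cmod (eval_mat_poly (p \<epsilon>) g) \<le> C * \<epsilon>"
          using p(2) gc[OF m(2,3)] \<epsilon> by (simp add: G_def g2)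
      qed
      show "\<exists>p. ?Q x z p"
        using p(1) 1 2 by (intro exI[of _ p] conjI exI[of _ "1 :: real"]) auto
    qed
    from choice2[OF this] show ?thesis unfolding border_separating_def .
  qed
  have fin: "finite X" "finite Y" "finite Z"
    by (simp_all add: X_def Y_def Z_def finite_labels finite_lat)
  show "?P (form_bound * n + 2 * card upos) q"
    by (rule exI[of _ \<alpha>], rule conjI[OF \<alpha>], rule exI[of _ X], rule exI[of _ Y], rule exI[of _ Z],
        intro conjI ballI Y_eq fin fam cardY tpp border)
       (simp_all add: cardX cardZ)
qed

end

theorem theorem3p1:
  fixes n :: nat
  assumes "n \<ge> 2" and "even n"
  shows
    "(\<exists>f_X f_Z p_X p_Z.
        continuous_mat_map n (d_XZ n) (D_inv_S_D n) f_X \<and>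
        continuous_mat_map n (d_XZ n) (D_S_D_inv n) f_Z \<and>
        polynomial_map_on n (Lie_SU n) (d_XZ n) p_X \<and>
        polynomial_map_on n (Lie_SU n) (d_XZ n) p_Z \<and>
        (\<forall>v\<in>topspace (Cspace (d_XZ n)). \<forall>v'\<in>topspace (Cspace (d_XZ n)).
           f_X v - f_Z v' \<in> Lie_SU n \<and>
           p_X (f_X v - f_Z v') = v \<and> p_Z (f_X v - f_Z v') = v'))
     \<and>
     (\<exists>C::nat. \<forall>q\<ge>1. \<exists>\<alpha>>0. \<exists>p\<^sub>0.
        poly_family n (C * q) \<alpha> p\<^sub>0 \<and>
        (\<forall>\<epsilon>\<in>{0<..<\<alpha>}. p\<^sub>0 \<epsilon> \<in> Inv_polys n (X_set n \<epsilon>) (Z_set n \<epsilon>)) \<and>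
        O_eps (\<lambda>\<epsilon>. {1\<^sub>m n}) (\<lambda>g \<epsilon>. eval_mat_poly (p\<^sub>0 \<epsilon>) g - 1) \<and>
        O_eps (\<lambda>\<epsilon>. (set_inv\<^bsub>SU n\<^esub> (at_eps (Y_fam n q \<alpha>) \<epsilon>)
                       <#>\<^bsub>SU n\<^esub> at_eps (Y_fam n q \<alpha>) \<epsilon>) - {1\<^sub>m n})
          (\<lambda>g \<epsilon>. eval_mat_poly (p\<^sub>0 \<epsilon>) g))
     \<and>
     (\<exists>C::nat. \<forall>q\<ge>1. \<exists>\<alpha>>0. \<exists>X_q Y_q Z_q.
        Y_q = Y_fam n q \<alpha> \<and>
        finite X_q \<and> finite Y_q \<and> finite Z_q \<and>
        (\<forall>x \<in> X_q \<union> Y_q \<union> Z_q. group_family n \<alpha> x) \<and>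
        card X_q \<ge> q ^ d_XZ n \<and> card Y_q \<ge> q ^ d_XZ n \<and> card Z_q \<ge> q ^ d_XZ n \<and>
        TPP_families n \<alpha> X_q Y_q Z_q \<and>
        (\<exists>f. border_separating n (C * q) X_q Y_q Z_q f))"
proof -
  interpret even_size n by unfold_locales (use assms in auto)
  show ?thesis using tangent_coordinates invariant_family separating_families by blast
qed

end
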